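(* Let $q=2^{2m+1}$ for an integer $m\ge 0$, and let $G$ be the Suzuki group ${}^2B_2(q)$. Then, for all $c\in\mathbb{Z}^+\cup\{\infty\}$, the group $G$ has a $2$-minimal $c$-nilpotent cover. Furthermore, if $m\ge 1$, then $$\omega_c(G)=\begin{cases} q^4+q^2+1 & \text{if } c\ge 2,\\ q^4+q^3-q^2+q-1 & \text{if } c=1.\end{cases}$$ If $m=0$, then $\omega_c(G)=6$ for all $c\in\mathbb{Z}^+\cup\{\infty\}$.
   Context: ${}^2B_2(q)$ denotes the Suzuki group over $\mathbb{F}_q$, $q=2^{2m+1}$, of order $q^2(q^2+1)(q-1)$ (so ${}^2B_2(2)\cong C_5\rtimes C_4$). For $c\in\mathbb{Z}^+$, a group is $c$-nilpotent if it is nilpotent of class at most $c$; it is $\infty$-nilpotent if it is nilpotent. A subset $X$ of a group $G$ is non-$c$-nilpotent if for any two distinct $x,y\in X$ the subgroup $\langle x,y\rangle$ is not $c$-nilpotent; $\omega_c(G)$ is the maximum order of a non-$c$-nilpotent subset of $G$. A family $\mathcal{N}$ of $c$-nilpotent subgroups of $G$ is a $c$-nilpotent cover of $G$ if every element of $G$ lies in some member of $\mathcal{N}$; it is $2$-minimal if one can choose for each member $X_i\in\mathcal{N}$ an element $g_i\in X_i$ (a distinguished element) such that $\langle g_i,g_j\rangle$ is not $c$-nilpotent whenever $i\ne j$. The condition $c\ge 2$ includes $c=\infty$. *)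

theory Defs
  imports "HOL-Analysis.Analysis" "HOL-Algebra.Generated_Groups" "HOL-Library.Extended_Nat"
begin

section \<open>Nilpotency of bounded class\<close>

text \<open>The index is shifted so that the \<open>n\<close>-th term is the usual \<open>\<gamma>\<^bsub>n+1\<^esub>\<close>: a group has
  class at most \<open>n\<close> iff the \<open>n\<close>-th term is trivial.\<close>

primrec lower_central_series :: "('a, 'b) monoid_scheme \<Rightarrow> nat \<Rightarrow> 'a set" where
  "lower_central_series G 0 = carrier G"
| "lower_central_series G (Suc n) = generate G
     (\<Union>x \<in> lower_central_series G n. \<Union>y \<in> carrier G.
        { x \<otimes>\<^bsub>G\<^esub> y \<otimes>\<^bsub>G\<^esub> inv\<^bsub>G\<^esub> x \<otimes>\<^bsub>G\<^esub> inv\<^bsub>G\<^esub> y })"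

text \<open>For \<open>c = \<infinity>\<close> the bound on \<open>n\<close> is vacuous and this is plain nilpotency.\<close>

definition c_nilpotent :: "enat \<Rightarrow> ('a, 'b) monoid_scheme \<Rightarrow> bool" where
  "c_nilpotent c G \<longleftrightarrow>
     group G \<and> (\<exists>n. enat n \<le> c \<and> lower_central_series G n = {\<one>\<^bsub>G\<^esub>})"

definition c_nilpotent_subgroup :: "enat \<Rightarrow> ('a, 'b) monoid_scheme \<Rightarrow> 'a set \<Rightarrow> bool" where
  "c_nilpotent_subgroup c G H \<longleftrightarrow> subgroup H G \<and> c_nilpotent c (G\<lparr>carrier := H\<rparr>)"

definition non_c_nilpotent_subset :: "enat \<Rightarrow> ('a, 'b) monoid_scheme \<Rightarrow> 'a set \<Rightarrow> bool" where
  "non_c_nilpotent_subset c G X \<longleftrightarrow> X \<subseteq> carrier G \<and>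
     (\<forall>x \<in> X. \<forall>y \<in> X. x \<noteq> y \<longrightarrow> \<not> c_nilpotent_subgroup c G (generate G {x, y}))"

text \<open>Meaningful for finite \<open>G\<close>, where the maximum is over a finite nonempty set.\<close>

definition omega_nilp :: "enat \<Rightarrow> ('a, 'b) monoid_scheme \<Rightarrow> nat" where
  "omega_nilp c G = Max (card ` {X. non_c_nilpotent_subset c G X})"

definition c_nilpotent_cover :: "enat \<Rightarrow> ('a, 'b) monoid_scheme \<Rightarrow> 'a set set \<Rightarrow> bool" where
  "c_nilpotent_cover c G \<N> \<longleftrightarrow> (\<forall>H \<in> \<N>. c_nilpotent_subgroup c G H) \<and> carrier G \<subseteq> \<Union>\<N>"

text \<open>The function \<open>g\<close> picks the distinguished elements.\<close>

definition two_minimal :: "enat \<Rightarrow> ('a, 'b) monoid_scheme \<Rightarrow> 'a set set \<Rightarrow> bool" where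
  "two_minimal c G \<N> \<longleftrightarrow> (\<exists>g. (\<forall>H \<in> \<N>. g H \<in> H) \<and>
     (\<forall>H \<in> \<N>. \<forall>K \<in> \<N>. H \<noteq> K \<longrightarrow>
        \<not> c_nilpotent_subgroup c G (generate G {g H, g K})))"


section \<open>The Suzuki groups\<close>

text \<open>Suzuki's realisation as a group of \<open>4 \<times> 4\<close> matrices over the field with
  \<open>q = 2 ^ (2 * m + 1)\<close> elements.  The map \<open>suz_twist m\<close> is the field automorphism whose square is
  the Frobenius map: \<open>(x ^ 2 ^ (m + 1)) ^ 2 ^ (m + 1) = x ^ (2 * q) = x\<^sup>2\<close>.
  The matrices \<open>suz_S m a b\<close> form a Sylow 2-subgroup and the matrices \<open>suz_M m l\<close> a cyclic
  group of order \<open>q - 1\<close> normalising it.\<close>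

definition GL4 :: "('a::field ^ 4 ^ 4) monoid" where
  "GL4 = \<lparr>carrier = {A. invertible A}, mult = (**), one = mat 1\<rparr>"

definition suz_twist :: "nat \<Rightarrow> 'a::field \<Rightarrow> 'a" where
  "suz_twist m x = x ^ (2 ^ (m + 1))"

definition suz_S :: "nat \<Rightarrow> 'a::field \<Rightarrow> 'a \<Rightarrow> 'a ^ 4 ^ 4" where
  "suz_S m a b = (let t = suz_twist m in
     vector [vector [1, 0, 0, 0],
             vector [a, 1, 0, 0],
             vector [b, t a, 1, 0],
             vector [a ^ 2 * t a + a * b + t b, a * t a + b, a, 1]])"

definition suz_M :: "nat \<Rightarrow> 'a::field \<Rightarrow> 'a ^ 4 ^ 4" where
  "suz_M m l =
     vector [vector [l ^ (1 + 2 ^ m), 0, 0, 0],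
             vector [0, l ^ (2 ^ m), 0, 0],
             vector [0, 0, inverse l ^ (2 ^ m), 0],
             vector [0, 0, 0, inverse l ^ (1 + 2 ^ m)]]"

definition suz_T :: "'a::field ^ 4 ^ 4" where
  "suz_T = vector [vector [0, 0, 0, 1],
                   vector [0, 0, 1, 0],
                   vector [0, 1, 0, 0],
                   vector [1, 0, 0, 0]]"

text \<open>Intended only for a field \<open>'a\<close> with exactly \<open>2 ^ (2 * m + 1)\<close> elements.\<close>

definition suzuki_group :: "nat \<Rightarrow> ('a::field ^ 4 ^ 4) monoid" where
  "suzuki_group m = GL4\<lparr>carrier := generate GL4
     ({suz_S m a b |a b. True} \<union> {suz_M m l |l. l \<noteq> 0} \<union> {suz_T})\<rparr>"

end

theory Submission
  imports Defs "HOL-Algebra.Multiplicative_Group"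
begin

text \<open>The Suzuki group acts on \<open>q\<^sup>2 + 1\<close> points, which are taken here to be the conjugates of the
Sylow 2-subgroup \<open>U\<close>.  Any two points can be moved to any other two, the stabiliser of two
points is cyclic of order \<open>q - 1\<close>, and a nontrivial element fixes one, two or no points.
Accordingly its centralizer lies in a conjugate of \<open>U\<close>, equals a conjugate of the two-point
stabiliser \<open>H\<close> (a split torus), or is a further abelian group (a nonsplit torus).  These
subgroups meet pairwise in the identity and cover the group, and the centralizer of a nontrivial
element stays inside the member that contains the element (\<open>piece_cong\<close>).

This partition controls nilpotency.  If \<open>x\<close> and \<open>y\<close> generate a nilpotent group, then a nontrivial
central element \<open>z\<close> of that group commutes with both, so \<open>x\<close> and \<open>y\<close> lie in the member of \<open>z\<close>.
As \<open>U\<close> has class at most two, the partition is a 2-minimal cover for every \<open>c \<ge> 2\<close>, with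
arbitrary nontrivial elements as distinguished ones.  For \<open>c = 1\<close> each conjugate of \<open>U\<close> is
replaced by the centralizers of its elements of order four; the resulting family consists of all
centralizers of elements \<open>x\<close> with \<open>x\<^sup>2 \<noteq> 1\<close>.  By the pigeonhole principle
(\<open>omega_nilp_eq_card_cover\<close>) \<open>\<omega>\<^sub>c\<close> is the number of members of the cover.

What remains is to count the nonsplit tori, and this is done without knowing their orders
\<open>q + r + 1\<close> and \<open>q - r + 1\<close>, where \<open>r\<^sup>2 = 2q\<close>.  If a fixed-point-free \<open>x\<close> is inverted by an
involution \<open>t\<close>, then \<open>t\<close> acts without fixed points on the centralizer \<open>A\<close> of \<open>x\<close>; hence it inverts
\<open>A\<close>, which is therefore abelian, and the normalizer of \<open>A\<close> is \<open>A\<close> extended by a subgroup of \<open>U\<close>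
of order 2 or 4 (\<open>card_N\<close>, \<open>card_Q\<close>).  Every fixed-point-free element arises in this way
(\<open>fix0_real\<close>): it is conjugate to some \<open>T u\<close>, the characteristic polynomial of \<open>T u\<close>
depends only on its trace, every nonzero trace occurs for a product \<open>T z\<close> of two involutions, and
such a product has a cyclic vector, so that \<open>(T z)\<^sup>n = 1\<close> forces \<open>(T u)\<^sup>n = 1\<close>.  A Sylow-type
argument then puts \<open>T u\<close> into a conjugate of the centralizer of \<open>T z\<close>.  Finally, a class of tori
of order \<open>\<alpha> \<ge> 3\<close> and index \<open>w\<close> in their normalizers covers a fraction \<open>(1 - 1/\<alpha>)/w\<close> of the
group.  Comparing with the known number of fixed-point-free elements, which is less than half of
the group, leaves only one possibility if \<open>q > 2\<close>: two classes, both with \<open>w = 4\<close>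
(\<open>card_nonsplit\<close>).  For \<open>q = 2\<close> there is a single torus, of order five.

The group theory is carried out in the locale \<open>suzuki_like\<close>, whose axioms are checked for the
matrices of the Suzuki group at the end.\<close>

section \<open>Conjugation, centralizers and normalizers\<close>

lemma card_image_fibres:
  assumes "finite S" "\<And>y. y \<in> f ` S \<Longrightarrow> card {x \<in> S. f x = y} = k"
  shows "card S = card (f ` S) * k"
proof -
  have "card S = (\<Sum>y\<in>f ` S. card {x \<in> S. f x = y})"
    using sum.image_gen[OF assms(1), of "\<lambda>_. 1::nat" f] by simp
  thus ?thesis using assms(2) by simp
qed

context group
begin

definition conj_elt :: "'a \<Rightarrow> 'a \<Rightarrow> 'a" where "conj_elt g x = g \<otimes> x \<otimes> inv g"
definition conj_set :: "'a \<Rightarrow> 'a set \<Rightarrow> 'a set" where "conj_set g X = conj_elt g ` X"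
definition centralizer :: "'a \<Rightarrow> 'a set" where "centralizer x = {y \<in> carrier G. y \<otimes> x = x \<otimes> y}"
definition normalizer :: "'a set \<Rightarrow> 'a set" where "normalizer X = {g \<in> carrier G. conj_set g X = X}"
definition conjugates :: "'a set \<Rightarrow> 'a set set" where "conjugates X = (\<lambda>g. conj_set g X) ` carrier G"

lemma cancel_inv_left:
  "x \<in> carrier G \<Longrightarrow> y \<in> carrier G \<Longrightarrow> inv x \<otimes> (x \<otimes> y) = y"
  "x \<in> carrier G \<Longrightarrow> y \<in> carrier G \<Longrightarrow> x \<otimes> (inv x \<otimes> y) = y"
  by (simp_all add: m_assoc[symmetric])

lemma inv_mult_eq_oneD:
  assumes "x \<in> carrier G" "y \<in> carrier G" "inv x \<otimes> y = \<one>" shows "y = x"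
proof -
  have "x \<otimes> (inv x \<otimes> y) = x" using assms by simp
  then show ?thesis using assms(1,2) by (simp add: cancel_inv_left)
qed

lemmas word = m_assoc inv_mult_group cancel_inv_left

lemma conj_elt_closed [simp]: "g \<in> carrier G \<Longrightarrow> x \<in> carrier G \<Longrightarrow> conj_elt g x \<in> carrier G"
  by (simp add: conj_elt_def)

lemma conj_elt_comp:
  "g \<in> carrier G \<Longrightarrow> h \<in> carrier G \<Longrightarrow> x \<in> carrier G \<Longrightarrow>
   conj_elt (g \<otimes> h) x = conj_elt g (conj_elt h x)"
  by (simp add: conj_elt_def word)

lemma conj_elt_one [simp]: "x \<in> carrier G \<Longrightarrow> conj_elt \<one> x = x"
  by (simp add: conj_elt_def)

lemma conj_elt_of_one [simp]: "g \<in> carrier G \<Longrightarrow> conj_elt g \<one> = \<one>"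
  by (simp add: conj_elt_def)

lemma conj_elt_mult:
  "g \<in> carrier G \<Longrightarrow> x \<in> carrier G \<Longrightarrow> y \<in> carrier G \<Longrightarrow>
   conj_elt g (x \<otimes> y) = conj_elt g x \<otimes> conj_elt g y"
  by (simp add: conj_elt_def word)

lemma conj_elt_inv:
  "g \<in> carrier G \<Longrightarrow> x \<in> carrier G \<Longrightarrow> conj_elt g (inv x) = inv (conj_elt g x)"
  by (simp add: conj_elt_def word)

lemma conj_elt_pow:
  "g \<in> carrier G \<Longrightarrow> x \<in> carrier G \<Longrightarrow> conj_elt g (x [^] (n::nat)) = conj_elt g x [^] n"
  by (induction n) (simp_all add: conj_elt_mult)

lemma conj_elt_inverse [simp]:
  "g \<in> carrier G \<Longrightarrow> x \<in> carrier G \<Longrightarrow> conj_elt g (conj_elt (inv g) x) = x"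
  "g \<in> carrier G \<Longrightarrow> x \<in> carrier G \<Longrightarrow> conj_elt (inv g) (conj_elt g x) = x"
  by (simp_all add: conj_elt_comp[symmetric])

lemma conj_elt_eq_iff [simp]:
  "g \<in> carrier G \<Longrightarrow> x \<in> carrier G \<Longrightarrow> y \<in> carrier G \<Longrightarrow> conj_elt g x = conj_elt g y \<longleftrightarrow> x = y"
  by (metis conj_elt_inverse(2))

lemma conj_elt_eq_one [simp]:
  "g \<in> carrier G \<Longrightarrow> x \<in> carrier G \<Longrightarrow> conj_elt g x = \<one> \<longleftrightarrow> x = \<one>"
  by (metis conj_elt_eq_iff conj_elt_of_one one_closed)

lemma conj_elt_fixed_iff:
  "g \<in> carrier G \<Longrightarrow> x \<in> carrier G \<Longrightarrow> conj_elt g x = x \<longleftrightarrow> g \<otimes> x = x \<otimes> g"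
  using inv_solve_right'[of x "g \<otimes> x" g] by (simp add: conj_elt_def eq_commute)

lemma conj_elt_conj:
  "g \<in> carrier G \<Longrightarrow> c \<in> carrier G \<Longrightarrow> x \<in> carrier G \<Longrightarrow>
   conj_elt (conj_elt g c) (conj_elt g x) = conj_elt g (conj_elt c x)"
  by (simp add: conj_elt_def word)

lemma conj_set_subset: "g \<in> carrier G \<Longrightarrow> X \<subseteq> carrier G \<Longrightarrow> conj_set g X \<subseteq> carrier G"
  by (auto simp: conj_set_def)

lemma conj_set_comp:
  "g \<in> carrier G \<Longrightarrow> h \<in> carrier G \<Longrightarrow> X \<subseteq> carrier G \<Longrightarrow>
   conj_set (g \<otimes> h) X = conj_set g (conj_set h X)"
  unfolding conj_set_def image_image by (rule image_cong) (auto simp: conj_elt_comp)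

lemma conj_set_one [simp]: "X \<subseteq> carrier G \<Longrightarrow> conj_set \<one> X = X"
proof -
  assume X: "X \<subseteq> carrier G"
  have "conj_elt \<one> ` X = id ` X" by (rule image_cong) (use X in auto)
  then show ?thesis by (simp add: conj_set_def)
qed

lemma conj_set_inverse:
  "g \<in> carrier G \<Longrightarrow> X \<subseteq> carrier G \<Longrightarrow> conj_set g (conj_set (inv g) X) = X"
  "g \<in> carrier G \<Longrightarrow> X \<subseteq> carrier G \<Longrightarrow> conj_set (inv g) (conj_set g X) = X"
  by (simp_all add: conj_set_comp[symmetric])

lemma mem_conj_set_iff:
  assumes "g \<in> carrier G" "X \<subseteq> carrier G" "x \<in> carrier G"
  shows "x \<in> conj_set g X \<longleftrightarrow> conj_elt (inv g) x \<in> X"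
proof
  assume "x \<in> conj_set g X"
  then show "conj_elt (inv g) x \<in> X" using assms by (auto simp: conj_set_def)
next
  assume "conj_elt (inv g) x \<in> X"
  then have "conj_elt g (conj_elt (inv g) x) \<in> conj_set g X" by (auto simp: conj_set_def)
  then show "x \<in> conj_set g X" using assms by simp
qed

lemma conj_set_eq_swap:
  assumes "g \<in> carrier G" "X \<subseteq> carrier G" "Y \<subseteq> carrier G"
  shows "conj_set g X = Y \<longleftrightarrow> X = conj_set (inv g) Y"
  using assms conj_set_inverse by metis

lemma conj_set_card: "g \<in> carrier G \<Longrightarrow> X \<subseteq> carrier G \<Longrightarrow> card (conj_set g X) = card X"
  unfolding conj_set_def by (rule card_image) (auto simp: inj_on_def subset_iff)

lemma conj_set_eqI:
  assumes "finite X" "g \<in> carrier G" "X \<subseteq> carrier G" "\<And>x. x \<in> X \<Longrightarrow> conj_elt g x \<in> X"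
  shows "conj_set g X = X"
proof (rule card_subset_eq[OF assms(1) _ conj_set_card[OF assms(2,3)]])
  show "conj_set g X \<subseteq> X" using assms(4) by (auto simp: conj_set_def)
qed

lemma conj_set_subgroup:
  assumes "subgroup K G" "g \<in> carrier G" shows "subgroup (conj_set g K) G"
proof (rule subgroupI)
  note K = subgroup.subset[OF assms(1)]
  show "conj_set g K \<subseteq> carrier G" using K assms by (simp add: conj_set_subset)
  show "conj_set g K \<noteq> {}" using subgroup.one_closed[OF assms(1)] by (auto simp: conj_set_def)
  fix a b assume "a \<in> conj_set g K"
  then obtain x where x: "x \<in> K" "a = conj_elt g x" by (auto simp: conj_set_def)
  show "inv a \<in> conj_set g K"
    using x assms(2) K conj_elt_inv[of g x] subgroup.m_inv_closed[OF assms(1) x(1)]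
    by (auto simp: conj_set_def intro!: image_eqI[of _ _ "inv x"])
  assume "b \<in> conj_set g K"
  then obtain y where y: "y \<in> K" "b = conj_elt g y" by (auto simp: conj_set_def)
  have "a \<otimes> b = conj_elt g (x \<otimes> y)" using x y K assms by (simp add: conj_elt_mult subsetD)
  then show "a \<otimes> b \<in> conj_set g K"
    using x y subgroup.m_closed[OF assms(1)] by (auto simp: conj_set_def)
qed

lemma subgroup_pow_card:
  assumes "subgroup K G" "x \<in> K" shows "x [^] card K = \<one>"
proof -
  interpret K: group "G\<lparr>carrier := K\<rparr>" using assms(1) is_group by (rule subgroup.subgroup_is_group)
  show ?thesis using K.pow_order_eq_1[of x] assms(2) by (simp add: order_def nat_pow_consistent[symmetric])
qed

lemma centralizer_subset: "centralizer x \<subseteq> carrier G" by (auto simp: centralizer_def)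

lemma centralizer_subgroup: "x \<in> carrier G \<Longrightarrow> subgroup (centralizer x) G"
proof (rule subgroupI)
  assume x: "x \<in> carrier G"
  fix a b assume a: "a \<in> centralizer x"
  have a': "a \<in> carrier G" "a \<otimes> x = x \<otimes> a" using a by (auto simp: centralizer_def)
  have "inv a \<otimes> x = inv a \<otimes> (x \<otimes> a) \<otimes> inv a" using a' x by (simp add: m_assoc)
  also have "\<dots> = inv a \<otimes> (a \<otimes> x) \<otimes> inv a" by (simp add: a')
  also have "\<dots> = x \<otimes> inv a" using a'(1) x by (simp add: word)
  finally show "inv a \<in> centralizer x" using a'(1) x by (simp add: centralizer_def)
  assume b: "b \<in> centralizer x"
  have "a \<otimes> b \<otimes> x = a \<otimes> (x \<otimes> b)" using a b x by (simp add: centralizer_def word)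
  also have "\<dots> = x \<otimes> (a \<otimes> b)" using a b x by (simp add: centralizer_def m_assoc[symmetric])
  finally show "a \<otimes> b \<in> centralizer x" using a b by (simp add: centralizer_def)
qed (auto simp: centralizer_def)

lemma centralizer_sym: "x \<in> carrier G \<Longrightarrow> y \<in> centralizer x \<Longrightarrow> x \<in> centralizer y"
  by (auto simp: centralizer_def)

lemma centralizer_self: "x \<in> carrier G \<Longrightarrow> x \<in> centralizer x" by (auto simp: centralizer_def)

lemma centralizer_conj:
  assumes "g \<in> carrier G" "x \<in> carrier G"
  shows "centralizer (conj_elt g x) = conj_set g (centralizer x)"
proof (rule Set.set_eqI)
  fix y
  show "y \<in> centralizer (conj_elt g x) \<longleftrightarrow> y \<in> conj_set g (centralizer x)"
  proof (cases "y \<in> carrier G")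
    case True
    have "conj_elt (inv g) y \<otimes> x = x \<otimes> conj_elt (inv g) y \<longleftrightarrow>
       conj_elt g (conj_elt (inv g) y \<otimes> x) = conj_elt g (x \<otimes> conj_elt (inv g) y)"
      using True assms by simp
    also have "\<dots> \<longleftrightarrow> y \<otimes> conj_elt g x = conj_elt g x \<otimes> y"
      using True assms by (simp add: conj_elt_mult del: conj_elt_eq_iff)
    finally show ?thesis using True assms
      by (simp add: mem_conj_set_iff centralizer_subset) (simp add: centralizer_def)
  qed (use assms conj_set_subset[OF _ centralizer_subset] in \<open>auto simp: centralizer_def\<close>)
qed

lemma normalizer_subset: "normalizer X \<subseteq> carrier G" by (auto simp: normalizer_def)

lemma normalizer_subgroup: "X \<subseteq> carrier G \<Longrightarrow> subgroup (normalizer X) G"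
proof (rule subgroupI)
  assume X: "X \<subseteq> carrier G"
  have "\<one> \<in> normalizer X" using X by (simp add: normalizer_def)
  then show "normalizer X \<noteq> {}" by blast
  fix a assume "a \<in> normalizer X"
  then have a: "a \<in> carrier G" "conj_set a X = X" by (auto simp: normalizer_def)
  show "inv a \<in> normalizer X"
    using conj_set_inverse(2)[of a X] a X by (simp add: normalizer_def)
  fix b assume "b \<in> normalizer X"
  then show "a \<otimes> b \<in> normalizer X" using a X by (simp add: normalizer_def conj_set_comp)
qed (simp add: normalizer_subset)

lemma normalizer_conj:
  assumes "g \<in> carrier G" "X \<subseteq> carrier G"
  shows "normalizer (conj_set g X) = conj_set g (normalizer X)"
proof (rule Set.set_eqI)
  fix y
  show "y \<in> normalizer (conj_set g X) \<longleftrightarrow> y \<in> conj_set g (normalizer X)"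
  proof (cases "y \<in> carrier G")
    case True
    have "conj_set (conj_elt (inv g) y) X = conj_set (inv g) (conj_set y (conj_set g X))"
      using assms True by (simp add: conj_elt_def conj_set_comp conj_set_subset)
    then show ?thesis using True assms
      by (simp add: mem_conj_set_iff normalizer_subset)
        (simp add: normalizer_def conj_set_eq_swap[of "inv g"] conj_set_subset)
  qed (use assms conj_set_subset[OF _ normalizer_subset] in \<open>auto simp: normalizer_def\<close>)
qed

lemma conjugates_subset: "X \<subseteq> carrier G \<Longrightarrow> Y \<in> conjugates X \<Longrightarrow> Y \<subseteq> carrier G"
  by (auto simp: conjugates_def dest: conj_set_subset)

lemma conjugates_closed:
  "X \<subseteq> carrier G \<Longrightarrow> Y \<in> conjugates X \<Longrightarrow> g \<in> carrier G \<Longrightarrow> conj_set g Y \<in> conjugates X"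
  unfolding conjugates_def by (auto simp: conj_set_comp[symmetric])

lemma conjugates_self: "X \<subseteq> carrier G \<Longrightarrow> X \<in> conjugates X"
  unfolding conjugates_def using conj_set_one by (metis imageI one_closed)

lemma conjugates_eq:
  assumes "X \<subseteq> carrier G" "Y \<in> conjugates X" shows "conjugates Y = conjugates X"
proof -
  obtain h where h: "h \<in> carrier G" "Y = conj_set h X" using assms by (auto simp: conjugates_def)
  have Y: "Y \<subseteq> carrier G" using assms by (rule conjugates_subset)
  have "X = conj_set (inv h) Y" using h assms by (simp add: conj_set_inverse)
  then have "X \<in> conjugates Y" using h by (auto simp: conjugates_def)
  then show ?thesis
    using conjugates_closed assms Y unfolding conjugates_def by (intro equalityI image_subsetI) blast+
qed

lemma finite_conjugates: "finite (carrier G) \<Longrightarrow> finite (conjugates X)"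
  by (simp add: conjugates_def)

lemma conjugates_card:
  assumes "finite (carrier G)" "X \<subseteq> carrier G"
  shows "card (carrier G) = card (conjugates X) * card (normalizer X)"
  unfolding conjugates_def
proof (rule card_image_fibres[OF assms(1)])
  fix Y assume "Y \<in> (\<lambda>g. conj_set g X) ` carrier G"
  then obtain h where h: "h \<in> carrier G" "Y = conj_set h X" by auto
  have "{g \<in> carrier G. conj_set g X = Y} = (\<otimes>) h ` normalizer X"
  proof (intro Set.set_eqI iffI)
    fix g assume "g \<in> {g \<in> carrier G. conj_set g X = Y}"
    then have "inv h \<otimes> g \<in> normalizer X" "g = h \<otimes> (inv h \<otimes> g)" using h assms
      by (auto simp: normalizer_def conj_set_comp conj_set_inverse cancel_inv_left)
    then show "g \<in> (\<otimes>) h ` normalizer X" by blast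
  qed (use h assms in \<open>auto simp: normalizer_def conj_set_comp\<close>)
  moreover have "inj_on ((\<otimes>) h) (normalizer X)" using h by (auto simp: inj_on_def normalizer_def)
  ultimately show "card {g \<in> carrier G. conj_set g X = Y} = card (normalizer X)"
    by (simp add: card_image)
qed

text \<open>A group acting freely is partitioned into regular orbits.  Applied to conjugation on the points,
this bounds the orders of fixed-point-free elements; applied to a class of tori, it replaces
Sylow's theorems.\<close>

lemma free_action_dvd:
  assumes K: "subgroup K G" "finite K" and X: "finite \<X>" "\<And>X. X \<in> \<X> \<Longrightarrow> X \<subseteq> carrier G"
    and closed: "\<And>X k. X \<in> \<X> \<Longrightarrow> k \<in> K \<Longrightarrow> conj_set k X \<in> \<X>"
    and free: "\<And>X k. X \<in> \<X> \<Longrightarrow> k \<in> K \<Longrightarrow> conj_set k X = X \<Longrightarrow> k = \<one>"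
  shows "card K dvd card \<X>"
proof -
  note sub = subgroup.subset[OF K(1), THEN subsetD]
  define orb where "orb X = (\<lambda>k. conj_set k X) ` K" for X
  have self: "X \<in> orb X" if "X \<in> \<X>" for X
    unfolding orb_def using conj_set_one[OF X(2)[OF that]] subgroup.one_closed[OF K(1)] by (metis imageI)
  have eq: "orb (conj_set k X) = orb X" if "X \<in> \<X>" "k \<in> K" for X k
  proof -
    have "orb (conj_set k X) = (\<lambda>l. conj_set (l \<otimes> k) X) ` K"
      unfolding orb_def by (rule image_cong) (use that X(2) sub in \<open>auto simp: conj_set_comp\<close>)
    also have "\<dots> = (\<lambda>l. conj_set l X) ` ((\<lambda>l. l \<otimes> k) ` K)" by (simp add: image_image)
    also have "(\<lambda>l. l \<otimes> k) ` K = K"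
    proof (rule card_subset_eq[OF K(2)])
      show "(\<lambda>l. l \<otimes> k) ` K \<subseteq> K" using K that by (auto simp: subgroup.m_closed)
      show "card ((\<lambda>l. l \<otimes> k) ` K) = card K"
        by (rule card_image) (use that sub in \<open>auto simp: inj_on_def\<close>)
    qed
    finally show ?thesis by (simp add: orb_def)
  qed
  have card: "card (orb X) = card K" if "X \<in> \<X>" for X
    unfolding orb_def
  proof (rule card_image, rule inj_onI)
    fix k l assume kl: "k \<in> K" "l \<in> K" "conj_set k X = conj_set l X"
    then have "conj_set (inv l \<otimes> k) X = X"
      using sub X(2)[OF that] by (simp add: conj_set_comp conj_set_inverse)
    then have "inv l \<otimes> k = \<one>"
      using free[OF that] kl K by (simp add: subgroup.m_closed subgroup.m_inv_closed)
    then show "k = l" using kl sub by (metis inv_inv inv_equality inv_closed)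
  qed
  have U: "\<Union>(orb ` \<X>) = \<X>" using self closed by (auto simp: orb_def)
  show ?thesis
  proof (subst U[symmetric], rule dvd_partition)
    show "\<forall>c1\<in>orb ` \<X>. \<forall>c2\<in>orb ` \<X>. c1 \<noteq> c2 \<longrightarrow> c1 \<inter> c2 = {}"
    proof (clarify, rule ccontr)
      fix A B assume AB: "A \<in> \<X>" "B \<in> \<X>" "orb A \<noteq> orb B" "orb A \<inter> orb B \<noteq> {}"
      then obtain k l where "k \<in> K" "l \<in> K" "conj_set k A = conj_set l B" by (auto simp: orb_def)
      then show False using AB eq by metis
    qed
  qed (use X(1) card U in auto)
qed

text \<open>Used for the elements with one, two or no fixed points, which are partitioned by the points, the
split tori and the nonsplit tori.\<close>

lemma card_Union_punctured:
  assumes "finite \<X>" "\<And>X. X \<in> \<X> \<Longrightarrow> finite X" "\<And>X. X \<in> \<X> \<Longrightarrow> \<one> \<in> X"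
    and "\<And>X Y x. X \<in> \<X> \<Longrightarrow> Y \<in> \<X> \<Longrightarrow> X \<noteq> Y \<Longrightarrow> x \<in> X \<Longrightarrow> x \<in> Y \<Longrightarrow> x = \<one>"
  shows "card (\<Union>\<X> - {\<one>}) = (\<Sum>X\<in>\<X>. card X - 1)"
proof -
  have "\<Union>\<X> - {\<one>} = (\<Union>X\<in>\<X>. X - {\<one>})" by blast
  also have "card \<dots> = (\<Sum>X\<in>\<X>. card (X - {\<one>}))"
    by (rule card_UN_disjoint) (use assms in blast)+
  also have "\<dots> = (\<Sum>X\<in>\<X>. card X - 1)"
    by (rule sum.cong) (use assms in \<open>auto simp: card_Diff_singleton\<close>)
  finally show ?thesis .
qed

section \<open>Nilpotency\<close>

lemma lower_central_series_Suc:
  assumes "subgroup K G" "lower_central_series (G\<lparr>carrier := K\<rparr>) n \<subseteq> K"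
  shows "lower_central_series (G\<lparr>carrier := K\<rparr>) (Suc n) =
    generate G (\<Union>x \<in> lower_central_series (G\<lparr>carrier := K\<rparr>) n. \<Union>y \<in> K.
        { x \<otimes> y \<otimes> inv x \<otimes> inv y })"
proof -
  let ?L = "lower_central_series (G\<lparr>carrier := K\<rparr>) n"
  have eq: "(\<Union>x \<in> ?L. \<Union>y \<in> carrier (G\<lparr>carrier := K\<rparr>).
        { x \<otimes>\<^bsub>G\<lparr>carrier := K\<rparr>\<^esub> y \<otimes>\<^bsub>G\<lparr>carrier := K\<rparr>\<^esub> inv\<^bsub>G\<lparr>carrier := K\<rparr>\<^esub> x \<otimes>\<^bsub>G\<lparr>carrier := K\<rparr>\<^esub> inv\<^bsub>G\<lparr>carrier := K\<rparr>\<^esub> y })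
     = (\<Union>x \<in> ?L. \<Union>y \<in> K. { x \<otimes> y \<otimes> inv x \<otimes> inv y })"
    using assms by (intro SUP_cong) (auto simp: subset_iff)
  have "(\<Union>x \<in> ?L. \<Union>y \<in> K. { x \<otimes> y \<otimes> inv x \<otimes> inv y }) \<subseteq> K"
    using assms by (auto simp: subset_iff subgroup.m_closed subgroup.m_inv_closed)
  then show ?thesis
    by (simp only: lower_central_series.simps eq generate_consistent[OF _ assms(1)])
qed

lemma lower_central_series_subset:
  assumes "subgroup K G"
  shows "lower_central_series (G\<lparr>carrier := K\<rparr>) n \<subseteq> K \<and> \<one> \<in> lower_central_series (G\<lparr>carrier := K\<rparr>) n"
proof (induction n)
  case 0 show ?case using subgroup.one_closed[OF assms] by simp
next
  case (Suc n)
  show ?case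
    unfolding lower_central_series_Suc[OF assms conjunct1[OF Suc.IH]]
    by (intro conjI generate.one generate_subgroup_incl[OF _ assms])
      (use Suc.IH in \<open>blast intro: subgroup.m_closed[OF assms] subgroup.m_inv_closed[OF assms]\<close>)
qed

lemmas lower_central_series_Suc' =
  lower_central_series_Suc[OF _ conjunct1[OF lower_central_series_subset]]

lemma commutator_eq_one_iff:
  "x \<in> carrier G \<Longrightarrow> y \<in> carrier G \<Longrightarrow> x \<otimes> y \<otimes> inv x \<otimes> inv y = \<one> \<longleftrightarrow> x \<otimes> y = y \<otimes> x"
  using inv_solve_right'[of \<one> "x \<otimes> y" "y \<otimes> x"] by (simp add: inv_mult_group m_assoc eq_commute)

text \<open>The last nontrivial term of the lower central series is central.\<close>

lemma nilpotent_center: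
  assumes "c_nilpotent_subgroup c G K" "K \<noteq> {\<one>}"
  obtains z where "z \<in> K" "z \<noteq> \<one>" "\<And>k. k \<in> K \<Longrightarrow> z \<otimes> k = k \<otimes> z"
proof -
  let ?L = "lower_central_series (G\<lparr>carrier := K\<rparr>)"
  have K: "subgroup K G" using assms by (simp add: c_nilpotent_subgroup_def)
  obtain n where "?L n = {\<one>}"
    using assms by (auto simp: c_nilpotent_subgroup_def c_nilpotent_def)
  define k where "k = (LEAST n. ?L n = {\<one>})"
  have k: "?L k = {\<one>}" unfolding k_def by (rule LeastI) fact
  have "?L 0 = K" by simp
  then have "k \<noteq> 0" using k assms(2) by (intro notI) (simp del: lower_central_series.simps)
  then obtain j where j: "k = Suc j" by (cases k) auto
  then have "?L j \<noteq> {\<one>}" 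
    using not_less_Least[of j "\<lambda>n. ?L n = {\<one>}"]
    unfolding k_def[symmetric] by (simp del: lower_central_series.simps)
  then obtain z where z: "z \<in> ?L j" "z \<noteq> \<one>" using lower_central_series_subset[OF K, of j] by blast
  show thesis
  proof (rule that)
    show zK: "z \<in> K" using z lower_central_series_subset[OF K, of j] by blast
    fix y assume y: "y \<in> K"
    have "z \<otimes> y \<otimes> inv z \<otimes> inv y \<in> ?L k"
      unfolding j lower_central_series_Suc'[OF K K]
      by (rule generate.incl) (use z y in blast)
    then show "z \<otimes> y = y \<otimes> z"
      using k zK y subgroup.subset[OF K] by (auto simp: commutator_eq_one_iff subset_iff)
  qed (rule z)
qed

lemma nilpotent_if_central_commutators:
  assumes K: "subgroup K G" and Z: "subgroup Z G" and c: "2 \<le> c"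
    and comm: "\<And>x y. x \<in> K \<Longrightarrow> y \<in> K \<Longrightarrow> x \<otimes> y \<otimes> inv x \<otimes> inv y \<in> Z"
    and central: "\<And>z y. z \<in> Z \<Longrightarrow> y \<in> K \<Longrightarrow> z \<otimes> y = y \<otimes> z"
  shows "c_nilpotent_subgroup c G K"
proof -
  let ?L = "lower_central_series (G\<lparr>carrier := K\<rparr>)"
  have L1: "?L (Suc 0) \<subseteq> Z"
    unfolding lower_central_series_Suc'[OF K K]
    by (rule generate_subgroup_incl[OF _ Z]) (auto simp: comm)
  have "?L (Suc (Suc 0)) \<subseteq> {\<one>}"
    unfolding lower_central_series_Suc'[OF K K, of "Suc 0"]
  proof (rule generate_subgroup_incl[OF _ triv_subgroup], clarsimp simp del: lower_central_series.simps)
    fix x y assume "x \<in> ?L (Suc 0)" "y \<in> K"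
    then show "x \<otimes> y \<otimes> inv x \<otimes> inv y = \<one>"
      using L1 central subgroup.subset[OF K] subgroup.subset[OF Z]
      by (subst commutator_eq_one_iff) blast+
  qed
  then have "?L 2 = {\<one>}" using lower_central_series_subset[OF K, of 2] by (auto simp: numeral_2_eq_2)
  moreover have "enat 2 \<le> c" using c by (simp add: numeral_eq_enat)
  ultimately show ?thesis
    unfolding c_nilpotent_subgroup_def c_nilpotent_def
    using K subgroup.subgroup_is_group[OF K is_group] by auto
qed

lemma nilpotent_if_commutative:
  assumes K: "subgroup K G" and c: "1 \<le> c"
    and comm: "\<And>x y. x \<in> K \<Longrightarrow> y \<in> K \<Longrightarrow> x \<otimes> y = y \<otimes> x"
  shows "c_nilpotent_subgroup c G K"
proof -
  let ?L = "lower_central_series (G\<lparr>carrier := K\<rparr>)"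
  have "?L (Suc 0) \<subseteq> {\<one>}"
    unfolding lower_central_series_Suc'[OF K K]
  proof (rule generate_subgroup_incl[OF _ triv_subgroup], clarsimp)
    fix x y assume "x \<in> K" "y \<in> K"
    then show "x \<otimes> y \<otimes> inv x \<otimes> inv y = \<one>"
      using comm subgroup.subset[OF K] by (subst commutator_eq_one_iff) blast+
  qed
  then have "?L 1 = {\<one>}" using lower_central_series_subset[OF K, of 1] by auto
  moreover have "enat 1 \<le> c" using c by (simp add: one_enat_def)
  ultimately show ?thesis
    unfolding c_nilpotent_subgroup_def c_nilpotent_def
    using K subgroup.subgroup_is_group[OF K is_group] by auto
qed

lemma one_nilpotent_commute:
  assumes "c_nilpotent_subgroup 1 G K" "x \<in> K" "y \<in> K"
  shows "x \<otimes> y = y \<otimes> x"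
proof -
  let ?L = "lower_central_series (G\<lparr>carrier := K\<rparr>)"
  have K: "subgroup K G" using assms by (simp add: c_nilpotent_subgroup_def)
  obtain n where n: "enat n \<le> 1" "?L n = {\<one>}"
    using assms by (auto simp: c_nilpotent_subgroup_def c_nilpotent_def)
  then have "n = 0 \<or> n = Suc 0" by (auto simp: one_enat_def)
  then show ?thesis
  proof
    assume "n = 0"
    then show ?thesis using n assms by simp
  next
    assume "n = Suc 0"
    have "x \<otimes> y \<otimes> inv x \<otimes> inv y \<in> ?L (Suc 0)"
      unfolding lower_central_series_Suc'[OF K K]
      by (rule generate.incl) (use assms in auto)
    then show ?thesis using n \<open>n = Suc 0\<close> assms subgroup.subset[OF K]
      by (auto simp: commutator_eq_one_iff subset_iff simp del: lower_central_series.simps)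
  qed
qed

lemma nilpotent_subgroup_mono:
  assumes "c_nilpotent_subgroup c G K" "subgroup L G" "L \<subseteq> K"
  shows "c_nilpotent_subgroup c G L"
proof -
  have K: "subgroup K G" using assms by (simp add: c_nilpotent_subgroup_def)
  have mono: "lower_central_series (G\<lparr>carrier := L\<rparr>) n \<subseteq> lower_central_series (G\<lparr>carrier := K\<rparr>) n" for n
  proof (induction n)
    case (Suc n)
    show ?case
      unfolding lower_central_series_Suc'[OF K K] lower_central_series_Suc'[OF assms(2) assms(2)]
      by (rule mono_generate) (use Suc assms(3) in blast)
  qed (use assms in simp)
  obtain n where n: "enat n \<le> c" "lower_central_series (G\<lparr>carrier := K\<rparr>) n = {\<one>}"
    using assms by (auto simp: c_nilpotent_subgroup_def c_nilpotent_def)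
  then have "lower_central_series (G\<lparr>carrier := L\<rparr>) n = {\<one>}"
    using mono[of n] lower_central_series_subset[OF assms(2), of n] by auto
  then show ?thesis
    unfolding c_nilpotent_subgroup_def c_nilpotent_def
    using n assms(2) subgroup.subgroup_is_group[OF assms(2) is_group] by auto
qed

text \<open>The members of the cover are indexed by elements of \<open>R\<close>, so every member comes with
distinguished elements.  A transversal of \<open>R\<close> with respect to \<open>P\<close> is a non-\<open>c\<close>-nilpotent set;
conversely two elements of one member generate a subgroup of a \<open>c\<close>-nilpotent group, so a
non-\<open>c\<close>-nilpotent set meets each member at most once.\<close>

lemma omega_nilp_eq_card_cover:
  assumes fin: "finite (carrier G)" and R: "R \<subseteq> carrier G"
    and nilp: "\<And>x. x \<in> R \<Longrightarrow> c_nilpotent_subgroup c G (P x)"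
    and self: "\<And>x. x \<in> R \<Longrightarrow> x \<in> P x"
    and cover: "carrier G \<subseteq> \<Union>(P ` R)"
    and sep: "\<And>x y. x \<in> R \<Longrightarrow> y \<in> R \<Longrightarrow> P x \<noteq> P y \<Longrightarrow> \<not> c_nilpotent_subgroup c G (generate G {x, y})"
  shows "c_nilpotent_cover c G (P ` R)" "two_minimal c G (P ` R)" "omega_nilp c G = card (P ` R)"
proof -
  have finR: "finite R" using fin R finite_subset by blast
  have small: "c_nilpotent_subgroup c G (generate G {x, y})"
    if "z \<in> R" "x \<in> P z" "y \<in> P z" for x y z
  proof -
    have "subgroup (P z) G" using nilp[OF that(1)] by (simp add: c_nilpotent_subgroup_def)
    then have "generate G {x, y} \<subseteq> P z" "{x, y} \<subseteq> carrier G"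
      using that generate_subgroup_incl[of "{x, y}" "P z"] by (auto dest: subgroup.subset)
    then show ?thesis using nilpotent_subgroup_mono[OF nilp[OF that(1)]] generate_is_subgroup by blast
  qed
  show "c_nilpotent_cover c G (P ` R)" unfolding c_nilpotent_cover_def using nilp cover by auto
  define r where "r = inv_into R P"
  have r: "r H \<in> R" "P (r H) = H" if "H \<in> P ` R" for H
    using that by (simp_all add: r_def inv_into_into f_inv_into_f)
  show "two_minimal c G (P ` R)" unfolding two_minimal_def
  proof (intro exI[of _ r] conjI ballI impI)
    fix H K assume "H \<in> P ` R"
    then show "r H \<in> H" using r self by metis
    assume "K \<in> P ` R" "H \<noteq> K"
    then show "\<not> c_nilpotent_subgroup c G (generate G {r H, r K})"
      using sep r \<open>H \<in> P ` R\<close> by metis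
  qed
  have inj: "inj_on r (P ` R)" unfolding r_def by (rule inj_on_inv_into) simp
  have low: "non_c_nilpotent_subset c G (r ` P ` R)"
    unfolding non_c_nilpotent_subset_def
  proof (intro conjI ballI impI)
    show "r ` P ` R \<subseteq> carrier G" using r R by blast
    fix x y assume "x \<in> r ` P ` R" "y \<in> r ` P ` R" "x \<noteq> y"
    then show "\<not> c_nilpotent_subgroup c G (generate G {x, y})" using sep r by (metis imageE)
  qed
  have up: "card X \<le> card (P ` R)" if "non_c_nilpotent_subset c G X" for X
  proof -
    have "\<forall>x\<in>X. \<exists>H\<in>P ` R. x \<in> H" using that cover by (auto simp: non_c_nilpotent_subset_def)
    then obtain h where h: "\<And>x. x \<in> X \<Longrightarrow> h x \<in> P ` R \<and> x \<in> h x" by metis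
    have "inj_on h X"
    proof (rule inj_onI, rule ccontr)
      fix x y assume xy: "x \<in> X" "y \<in> X" "h x = h y" "x \<noteq> y"
      obtain z where "z \<in> R" "h x = P z" using h xy by blast
      then show False using small[of z x y] h xy that unfolding non_c_nilpotent_subset_def by metis
    qed
    then show ?thesis using h finR by (intro card_inj_on_le[of h]) auto
  qed
  have "finite {X. non_c_nilpotent_subset c G X}"
    by (rule finite_subset[of _ "Pow (carrier G)"]) (use fin in \<open>auto simp: non_c_nilpotent_subset_def\<close>)
  moreover have "card (r ` P ` R) = card (P ` R)" by (rule card_image[OF inj])
  ultimately show "omega_nilp c G = card (P ` R)"
    unfolding omega_nilp_def using low up
    by (intro Max_eqI finite_imageI) (blast, blast, metis imageI mem_Collect_eq)
qed

end

section \<open>Groups with a Bruhat decomposition of Suzuki type\<close>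

text \<open>\<open>U\<close> is a Sylow 2-subgroup, \<open>Z\<close> the subgroup of its squares, which is central, \<open>H\<close> a complement
of \<open>U\<close> in its normalizer \<open>U H\<close>, and \<open>T\<close> an involution that moves the point \<open>U\<close> to its
opposite.  The axiom \<open>opposite\<close> says that \<open>T U T\<close> meets \<open>U H\<close> trivially.  By \<open>U_square_inj\<close>
squaring is injective on \<open>U\<close> modulo \<open>Z\<close>, and by \<open>U_commute\<close> two elements of \<open>U\<close> outside \<open>Z\<close>
commute only if they agree modulo \<open>Z\<close>.  The axiom \<open>trace\<close> is all that the group theory needs to
know of linear algebra: for matrices, \<open>z\<close> is chosen such that \<open>T z\<close> and \<open>T u\<close> have the same
characteristic polynomial, and the first alternative is the case of trace \<open>0\<close>.\<close>

locale suzuki_like = group G for G (structure) +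
  fixes U Z H :: "'a set" and T :: 'a and q :: nat
  assumes fin: "finite (carrier G)"
    and U_subgroup: "subgroup U G" and H_subgroup: "subgroup H G" and Z_subgroup: "subgroup Z G"
    and Z_subset_U: "Z \<subseteq> U"
    and T_carrier [simp]: "T \<in> carrier G" and T_T: "T \<otimes> T = \<one>"
    and card_U: "card U = q ^ 2" and card_Z: "card Z = q" and card_H: "card H = q - 1"
    and q_ge_2: "2 \<le> q" and even_q: "even q"
    and H_U: "h \<in> H \<Longrightarrow> u \<in> U \<Longrightarrow> \<exists>v\<in>U. h \<otimes> u = v \<otimes> h"
    and H_commute: "h \<in> H \<Longrightarrow> k \<in> H \<Longrightarrow> h \<otimes> k = k \<otimes> h"
    and T_H: "h \<in> H \<Longrightarrow> T \<otimes> h \<otimes> T \<otimes> h = \<one>"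
    and bruhat: "g \<in> carrier G \<Longrightarrow>
      \<exists>v\<in>U. \<exists>h\<in>H. g = v \<otimes> h \<or> (\<exists>u\<in>U. g = u \<otimes> T \<otimes> (v \<otimes> h))"
    and opposite: "u \<in> U \<Longrightarrow> v \<in> U \<Longrightarrow> h \<in> H \<Longrightarrow> T \<otimes> u \<otimes> T = v \<otimes> h \<Longrightarrow> u = \<one>"
    and H_U_free: "h \<in> H \<Longrightarrow> u \<in> U \<Longrightarrow> h \<otimes> u = u \<otimes> h \<Longrightarrow> h = \<one> \<or> u = \<one>"
    and Z_central: "z \<in> Z \<Longrightarrow> u \<in> U \<Longrightarrow> z \<otimes> u = u \<otimes> z"
    and Z_square: "z \<in> Z \<Longrightarrow> z \<otimes> z = \<one>"
    and U_square: "u \<in> U \<Longrightarrow> u \<otimes> u \<in> Z"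
    and U_square_inj: "u \<in> U \<Longrightarrow> v \<in> U \<Longrightarrow> u \<otimes> u = v \<otimes> v \<Longrightarrow> \<exists>z\<in>Z. u = z \<otimes> v"
    and U_commutator: "u \<in> U \<Longrightarrow> v \<in> U \<Longrightarrow> \<exists>z\<in>Z. u \<otimes> v = z \<otimes> (v \<otimes> u)"
    and U_commute: "u \<in> U - Z \<Longrightarrow> v \<in> U - Z \<Longrightarrow> u \<otimes> v = v \<otimes> u \<Longrightarrow> \<exists>z\<in>Z. u = z \<otimes> v"
    and trace: "u \<in> U \<Longrightarrow> (T \<otimes> u) [^] (4::nat) = \<one> \<or>
      (\<exists>z\<in>Z. z \<noteq> \<one> \<and> (\<forall>n::nat. (T \<otimes> z) [^] n = \<one> \<longrightarrow> (T \<otimes> u) [^] n = \<one>))"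
begin

section \<open>The point stabiliser\<close>

definition B where "B = {u \<otimes> h | u h. u \<in> U \<and> h \<in> H}"

lemma U_carrier [simp]: "u \<in> U \<Longrightarrow> u \<in> carrier G" using subgroup.subset[OF U_subgroup] by blast
lemma H_carrier [simp]: "u \<in> H \<Longrightarrow> u \<in> carrier G" using subgroup.subset[OF H_subgroup] by blast
lemma Z_U [simp]: "u \<in> Z \<Longrightarrow> u \<in> U" using Z_subset_U by blast
lemma B_carrier: "B \<subseteq> carrier G" by (auto simp: B_def)
lemma U_sub: "U \<subseteq> carrier G" and H_sub: "H \<subseteq> carrier G" by auto
lemma U_closed [simp]: "u \<in> U \<Longrightarrow> v \<in> U \<Longrightarrow> u \<otimes> v \<in> U" "u \<in> U \<Longrightarrow> inv u \<in> U" "\<one> \<in> U"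
  using U_subgroup by (auto simp: subgroup_def)
lemma H_closed [simp]: "u \<in> H \<Longrightarrow> v \<in> H \<Longrightarrow> u \<otimes> v \<in> H" "u \<in> H \<Longrightarrow> inv u \<in> H" "\<one> \<in> H"
  using H_subgroup by (auto simp: subgroup_def)
lemma Z_closed [simp]: "u \<in> Z \<Longrightarrow> v \<in> Z \<Longrightarrow> u \<otimes> v \<in> Z" "u \<in> Z \<Longrightarrow> inv u \<in> Z" "\<one> \<in> Z"
  using Z_subgroup by (auto simp: subgroup_def)

lemma B_I: "u \<in> U \<Longrightarrow> h \<in> H \<Longrightarrow> u \<otimes> h \<in> B" by (auto simp: B_def)
lemma U_B: "u \<in> U \<Longrightarrow> u \<in> B" using B_I[of u \<one>] by simp
lemma H_B: "u \<in> H \<Longrightarrow> u \<in> B" using B_I[of \<one> u] by simp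

lemma finite_sub: "X \<subseteq> carrier G \<Longrightarrow> finite X" using fin finite_subset by blast

lemma H_conj_U: "h \<in> H \<Longrightarrow> u \<in> U \<Longrightarrow> conj_elt h u \<in> U"
proof -
  assume hu: "h \<in> H" "u \<in> U"
  then obtain v where v: "v \<in> U" "h \<otimes> u = v \<otimes> h" using H_U by blast
  then have "conj_elt h u = v" using hu by (simp add: conj_elt_def word)
  then show ?thesis using v by simp
qed

lemma T_cancel [simp]: "x \<in> carrier G \<Longrightarrow> T \<otimes> (T \<otimes> x) = x"
  using T_T by (simp add: m_assoc[symmetric])

lemma T_swap: "h \<in> H \<Longrightarrow> h \<otimes> T = T \<otimes> inv h"
proof -
  assume h: "h \<in> H"
  have "inv h = T \<otimes> h \<otimes> T" by (rule inv_equality) (use T_H[OF h] h in auto)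
  then show ?thesis using h by (simp add: m_assoc)
qed

lemma U_Int_H: "x \<in> U \<Longrightarrow> x \<in> H \<Longrightarrow> x = \<one>"
proof (rule opposite[of x \<one> "inv x"])
  assume x: "x \<in> U" "x \<in> H"
  have "T \<otimes> (x \<otimes> T) = inv x" using x by (simp add: T_swap)
  then show "T \<otimes> x \<otimes> T = \<one> \<otimes> inv x" using x by (simp add: m_assoc)
qed auto

text \<open>The product decomposition of \<open>U H\<close> and, below, the Bruhat decomposition are unique.  This gives the
order of the group and reduces equations between elements to equations in \<open>U\<close> and \<open>H\<close>.\<close>

lemma U_H_unique:
  assumes "u \<in> U" "v \<in> U" "h \<in> H" "k \<in> H" "u \<otimes> h = v \<otimes> k" shows "u = v" "h = k"
proof -
  have "inv v \<otimes> (u \<otimes> h) \<otimes> inv h = inv v \<otimes> (v \<otimes> k) \<otimes> inv h" by (simp add: assms)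
  then have eq: "inv v \<otimes> u = k \<otimes> inv h" using assms(1-4) by (simp add: word)
  moreover have "inv v \<otimes> u \<in> U" "k \<otimes> inv h \<in> H" using assms(1-4) by simp_all
  ultimately have "inv v \<otimes> u = \<one>" using U_Int_H by metis
  then show "u = v" using assms(1-4) by (simp add: inv_mult_eq_oneD)
  then show "h = k" using assms by simp
qed

lemma B_mult: "a \<in> B \<Longrightarrow> b \<in> B \<Longrightarrow> a \<otimes> b \<in> B"
proof -
  assume "a \<in> B" "b \<in> B"
  then obtain u h v k where *: "u \<in> U" "h \<in> H" "v \<in> U" "k \<in> H" "a = u \<otimes> h" "b = v \<otimes> k"
    by (auto simp: B_def)
  then have "a \<otimes> b = (u \<otimes> conj_elt h v) \<otimes> (h \<otimes> k)" by (simp add: conj_elt_def word)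
  then show "a \<otimes> b \<in> B" using * H_conj_U by (simp add: B_I)
qed

lemma B_inv: "a \<in> B \<Longrightarrow> inv a \<in> B"
proof -
  assume "a \<in> B"
  then obtain u h where *: "u \<in> U" "h \<in> H" "a = u \<otimes> h" by (auto simp: B_def)
  then have "inv a = inv h \<otimes> inv u" by (simp add: inv_mult_group)
  then show "inv a \<in> B" using * by (simp add: B_mult H_B U_B)
qed

lemma U_nontrivial: obtains u where "u \<in> U" "u \<noteq> \<one>"
proof -
  have "card U \<ge> 4" using power_mono[OF q_ge_2, of 2] card_U by simp
  then have "\<not> U \<subseteq> {\<one>}" using card_mono[of "{\<one>}" U] by auto
  then show ?thesis using that by blast
qed

lemma T_notin_B: "T \<notin> B"
proof
  assume T: "T \<in> B"
  obtain u where u: "u \<in> U" "u \<noteq> \<one>" by (rule U_nontrivial)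
  have "T \<otimes> u \<otimes> T \<in> B" using T u by (simp add: B_mult U_B)
  then show False using opposite u by (auto simp: B_def)
qed

lemma bruhat_cases:
  assumes "g \<in> carrier G"
  obtains "g \<in> B" | u v h where "u \<in> U" "v \<in> U" "h \<in> H" "g = u \<otimes> T \<otimes> (v \<otimes> h)"
  using bruhat[OF assms] B_I by blast

lemma bruhat_disjoint: "u \<in> U \<Longrightarrow> b \<in> B \<Longrightarrow> u \<otimes> T \<otimes> b \<notin> B"
proof
  assume *: "u \<in> U" "b \<in> B" "u \<otimes> T \<otimes> b \<in> B"
  then have "inv u \<otimes> (u \<otimes> T \<otimes> b) \<otimes> inv b \<in> B" by (simp add: B_mult B_inv U_B)
  moreover have "b \<in> carrier G" using * B_carrier by blast
  ultimately show False using T_notin_B * by (simp add: word)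
qed

lemma bruhat_unique:
  assumes "u \<in> U" "v \<in> U" "a \<in> B" "b \<in> B" "u \<otimes> T \<otimes> a = v \<otimes> T \<otimes> b"
  shows "u = v" "a = b"
proof -
  have c: "a \<in> carrier G" "b \<in> carrier G" using assms B_carrier by auto
  have "T \<otimes> inv v \<otimes> (u \<otimes> T \<otimes> a) \<otimes> inv a = T \<otimes> inv v \<otimes> (v \<otimes> T \<otimes> b) \<otimes> inv a" by (simp add: assms)
  then have "T \<otimes> (inv v \<otimes> u) \<otimes> T = b \<otimes> inv a" using assms(1-4) c by (simp add: word)
  moreover have "b \<otimes> inv a \<in> B" using assms by (simp add: B_mult B_inv)
  ultimately have "inv v \<otimes> u = \<one>" using opposite[of "inv v \<otimes> u"] assms(1,2) by (auto simp: B_def)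
  then show "u = v" using assms(1,2) by (simp add: inv_mult_eq_oneD)
  then show "a = b" using assms c by simp
qed

lemma card_B: "card B = q ^ 2 * (q - 1)"
proof -
  have "B = (\<lambda>(u, h). u \<otimes> h) ` (U \<times> H)" by (auto simp: B_def)
  moreover have "inj_on (\<lambda>(u, h). u \<otimes> h) (U \<times> H)" by (auto simp: inj_on_def dest: U_H_unique)
  ultimately show ?thesis by (simp add: card_image card_cartesian_product card_U card_H)
qed

lemma card_G: "card (carrier G) = q ^ 2 * (q - 1) * (q ^ 2 + 1)"
proof -
  let ?C = "(\<lambda>(u, b). u \<otimes> T \<otimes> b) ` (U \<times> B)"
  have "carrier G = B \<union> ?C"
  proof
    show "carrier G \<subseteq> B \<union> ?C"
    proof
      fix g assume "g \<in> carrier G"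
      then show "g \<in> B \<union> ?C" by (cases rule: bruhat_cases) (auto simp: image_iff intro!: B_I)
    qed
  qed (use B_carrier in auto)
  moreover have "B \<inter> ?C = {}" using bruhat_disjoint by auto
  moreover have "card ?C = card U * card B"
    by (subst card_image) (auto simp: inj_on_def card_cartesian_product dest: bruhat_unique)
  ultimately have "card (carrier G) = card B + card U * card B"
    using finite_sub[OF B_carrier] finite_sub[OF U_sub] by (simp add: card_Un_disjoint)
  then show ?thesis by (simp add: card_U card_B algebra_simps)
qed

text \<open>Distinct points have trivial intersection: after conjugation this is the statement that
\<open>T U T\<close> and \<open>U\<close> meet trivially.\<close>

lemma U_Int_conj:
  assumes "g \<in> carrier G" "g \<notin> B" "x \<in> U" "x \<in> conj_set g U" shows "x = \<one>"
  using assms(1)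
proof (cases rule: bruhat_cases)
  case (2 u v h)
  obtain y where y: "y \<in> U" "x = conj_elt g y" using assms by (auto simp: conj_set_def)
  define w where "w = conj_elt v (conj_elt h y)"
  have w: "w \<in> U" using y 2 H_conj_U by (simp add: w_def conj_elt_def)
  have "T \<otimes> w \<otimes> T = inv u \<otimes> x \<otimes> u"
    using 2 y T_T inv_equality[OF T_T] unfolding w_def y conj_elt_def by (simp add: word)
  then have "w = \<one>" using w 2 assms opposite[of w "inv u \<otimes> x \<otimes> u" \<one>] by simp
  then have "y = \<one>" using 2 y by (simp add: w_def)
  then show ?thesis using y assms by simp
qed (use assms in simp)

lemma normalizer_U: "normalizer U = B"
proof
  show "B \<subseteq> normalizer U"
  proof
    fix b assume "b \<in> B"
    then obtain u h where b: "u \<in> U" "h \<in> H" "b = u \<otimes> h" by (auto simp: B_def)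
    have "conj_set h U = U" using b H_conj_U by (intro conj_set_eqI finite_sub) auto
    moreover have "conj_set u U = U" using b by (intro conj_set_eqI finite_sub) (auto simp: conj_elt_def)
    ultimately show "b \<in> normalizer U" using b by (simp add: normalizer_def conj_set_comp U_sub)
  qed
  show "normalizer U \<subseteq> B"
  proof (rule subsetI, rule ccontr)
    fix g assume "g \<in> normalizer U" "g \<notin> B"
    moreover obtain u where "u \<in> U" "u \<noteq> \<one>" by (rule U_nontrivial)
    ultimately show False using U_Int_conj[of g u] by (auto simp: normalizer_def)
  qed
qed

text \<open>Since no nontrivial element of \<open>H\<close> commutes with a nontrivial one of \<open>U\<close>, the map \<open>u \<mapsto> u h u\<^sup>-\<^sup>1 h\<^sup>-\<^sup>1\<close> is injective,
hence surjective, on \<open>U\<close>; so the coset \<open>U h\<close> is a single \<open>U\<close>-class when \<open>h \<noteq> 1\<close>.\<close>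

lemma B_cases:
  assumes "b \<in> B"
  obtains "b \<in> U" | u h where "u \<in> U" "h \<in> H" "h \<noteq> \<one>" "b = conj_elt u h"
proof -
  obtain v h where b: "v \<in> U" "h \<in> H" "b = v \<otimes> h" using assms by (auto simp: B_def)
  show thesis
  proof (cases "h = \<one>")
    case False
    define f where "f u = u \<otimes> conj_elt h (inv u)" for u
    have "inj_on f U"
    proof (rule inj_onI)
      fix u w assume uw: "u \<in> U" "w \<in> U" "f u = f w"
      have "inv w \<otimes> f u \<otimes> h \<otimes> u = inv w \<otimes> f w \<otimes> h \<otimes> u" using uw by simp
      then have "h \<otimes> (inv w \<otimes> u) = (inv w \<otimes> u) \<otimes> h"
        using uw(1,2) b by (simp add: f_def conj_elt_def word)
      then have "inv w \<otimes> u = \<one>" using H_U_free[of h "inv w \<otimes> u"] uw b False by simp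
      then show "u = w" using uw by (simp add: inv_mult_eq_oneD)
    qed
    moreover have "f ` U \<subseteq> U" using b H_conj_U by (auto simp: f_def)
    ultimately have "f ` U = U" using finite_sub[OF U_sub] by (simp add: endo_inj_surj)
    then obtain u where u: "u \<in> U" "f u = v" using b by (metis imageE)
    have "b = conj_elt u h" unfolding b(3) u(2)[symmetric] using u(1) b by (simp add: f_def conj_elt_def word)
    then show thesis using that(2) u b False by blast
  qed (use b that in simp)
qed

section \<open>Points, split tori and fixed points\<close>

abbreviation points where "points \<equiv> conjugates U"
abbreviation split_tori where "split_tori \<equiv> conjugates H"
text \<open>The names refer to the action on the points: an element outside the identity lies in a point if it
fixes just that point, and in a split torus if it fixes just two.\<close>

definition fix1 where "fix1 = \<Union>points - {\<one>}"
definition fix2 where "fix2 = \<Union>split_tori - {\<one>}"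
definition fix0 where "fix0 = carrier G - (\<Union>points \<union> \<Union>split_tori)"

lemma point_carrier: "V \<in> points \<Longrightarrow> V \<subseteq> carrier G" using conjugates_subset[OF U_sub] .
lemma torus_carrier: "V \<in> split_tori \<Longrightarrow> V \<subseteq> carrier G" using conjugates_subset[OF H_sub] .

lemma point_subgroup: "V \<in> points \<Longrightarrow> subgroup V G"
  using conj_set_subgroup[OF U_subgroup] by (auto simp: conjugates_def)
lemma torus_subgroup: "V \<in> split_tori \<Longrightarrow> subgroup V G"
  using conj_set_subgroup[OF H_subgroup] by (auto simp: conjugates_def)

lemma conj_in_point: "g \<in> carrier G \<Longrightarrow> V \<in> points \<Longrightarrow> conj_set g V \<in> points"
  using conjugates_closed[OF U_sub] .
lemma conj_in_torus: "g \<in> carrier G \<Longrightarrow> V \<in> split_tori \<Longrightarrow> conj_set g V \<in> split_tori"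
  using conjugates_closed[OF H_sub] .

lemma U_point: "U \<in> points" and H_torus: "H \<in> split_tori"
  using conjugates_self U_sub H_sub by auto

lemma card_points: "card points = q ^ 2 + 1"
proof -
  have "q ^ 2 * (q - 1) * card points = q ^ 2 * (q - 1) * (q ^ 2 + 1)"
    using conjugates_card[OF fin U_sub] by (simp add: normalizer_U card_B card_G mult.commute)
  moreover have "q ^ 2 * (q - 1) \<noteq> 0" using q_ge_2 by simp
  ultimately show ?thesis by (metis mult_left_cancel)
qed

lemma U_Int_point: "V \<in> points \<Longrightarrow> V \<noteq> U \<Longrightarrow> x \<in> U \<Longrightarrow> x \<in> V \<Longrightarrow> x = \<one>"
proof -
  assume *: "V \<in> points" "V \<noteq> U" "x \<in> U" "x \<in> V"
  then obtain g where g: "g \<in> carrier G" "V = conj_set g U" by (auto simp: conjugates_def)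
  then have "g \<notin> B" using * by (auto simp: normalizer_U[symmetric] normalizer_def)
  then show "x = \<one>" using U_Int_conj g * by simp
qed

lemma points_Int: "V \<in> points \<Longrightarrow> W \<in> points \<Longrightarrow> V \<noteq> W \<Longrightarrow> x \<in> V \<Longrightarrow> x \<in> W \<Longrightarrow> x = \<one>"
proof -
  assume *: "V \<in> points" "W \<in> points" "V \<noteq> W" "x \<in> V" "x \<in> W"
  then obtain g where g: "g \<in> carrier G" "V = conj_set g U" by (auto simp: conjugates_def)
  have x: "x \<in> carrier G" using * point_carrier by blast
  have "conj_elt (inv g) x = \<one>"
  proof (rule U_Int_point[of "conj_set (inv g) W"])
    show "conj_set (inv g) W \<noteq> U"
      using * g conj_set_inverse(1)[of g W] point_carrier[of W] by auto
    show "conj_elt (inv g) x \<in> U" using * g x by (simp add: mem_conj_set_iff U_sub)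
    show "conj_elt (inv g) x \<in> conj_set (inv g) W" using * by (auto simp: conj_set_def)
  qed (use * g conj_in_point in auto)
  then show ?thesis using x g by simp
qed

lemma types_carrier: "fix1 \<subseteq> carrier G" "fix2 \<subseteq> carrier G" "fix0 \<subseteq> carrier G"
  using point_carrier torus_carrier by (auto simp: fix1_def fix2_def fix0_def)

lemma types_cover: "x \<in> carrier G \<Longrightarrow> x = \<one> \<or> x \<in> fix1 \<or> x \<in> fix2 \<or> x \<in> fix0"
  by (auto simp: fix1_def fix2_def fix0_def)

lemma one_notin_types: "\<one> \<notin> fix1" "\<one> \<notin> fix2" "\<one> \<notin> fix0"
  using U_point by (auto simp: fix1_def fix2_def fix0_def intro!: bexI[of _ U])

lemma fix1_conjE:
  assumes "x \<in> fix1" obtains g u where "g \<in> carrier G" "u \<in> U" "u \<noteq> \<one>" "x = conj_elt g u"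
  using assms by (auto simp: fix1_def conjugates_def conj_set_def)

lemma fix2_conjE:
  assumes "x \<in> fix2" obtains g h where "g \<in> carrier G" "h \<in> H" "h \<noteq> \<one>" "x = conj_elt g h"
  using assms by (auto simp: fix2_def conjugates_def conj_set_def)

lemma conj_fix1: "g \<in> carrier G \<Longrightarrow> x \<in> fix1 \<Longrightarrow> conj_elt g x \<in> fix1"
proof -
  assume *: "g \<in> carrier G" "x \<in> fix1"
  then obtain V where "V \<in> points" "x \<in> V" "x \<noteq> \<one>" by (auto simp: fix1_def)
  then have "conj_elt g x \<in> conj_set g V" "conj_set g V \<in> points" "conj_elt g x \<noteq> \<one>"
    using * types_carrier conj_in_point by (auto simp: conj_set_def)
  then show ?thesis by (auto simp: fix1_def)
qed

lemma conj_fix2: "g \<in> carrier G \<Longrightarrow> x \<in> fix2 \<Longrightarrow> conj_elt g x \<in> fix2"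
proof -
  assume *: "g \<in> carrier G" "x \<in> fix2"
  then obtain V where "V \<in> split_tori" "x \<in> V" "x \<noteq> \<one>" by (auto simp: fix2_def)
  then have "conj_elt g x \<in> conj_set g V" "conj_set g V \<in> split_tori" "conj_elt g x \<noteq> \<one>"
    using * types_carrier conj_in_torus by (auto simp: conj_set_def)
  then show ?thesis by (auto simp: fix2_def)
qed

lemma U_fix1: "u \<in> U \<Longrightarrow> u \<noteq> \<one> \<Longrightarrow> u \<in> fix1" using U_point by (auto simp: fix1_def)
lemma H_fix2: "u \<in> H \<Longrightarrow> u \<noteq> \<one> \<Longrightarrow> u \<in> fix2" using H_torus by (auto simp: fix2_def)

lemma fix0_alt: "x \<in> carrier G \<Longrightarrow> x \<noteq> \<one> \<Longrightarrow> x \<notin> fix1 \<Longrightarrow> x \<notin> fix2 \<Longrightarrow> x \<in> fix0"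
  using types_cover by blast

lemma fix0_not: "x \<in> fix0 \<Longrightarrow> x \<notin> fix1" "x \<in> fix0 \<Longrightarrow> x \<notin> fix2"
  by (auto simp: fix1_def fix2_def fix0_def)

lemma conj_fix0: "g \<in> carrier G \<Longrightarrow> x \<in> fix0 \<Longrightarrow> conj_elt g x \<in> fix0"
proof (rule fix0_alt)
  assume *: "g \<in> carrier G" "x \<in> fix0"
  then have x: "x \<in> carrier G" using types_carrier by blast
  show "conj_elt g x \<in> carrier G" using * x by simp
  show "conj_elt g x \<noteq> \<one>" using * x one_notin_types by auto
  show "conj_elt g x \<notin> fix1" using conj_fix1[of "inv g" "conj_elt g x"] * x fix0_not by auto
  show "conj_elt g x \<notin> fix2" using conj_fix2[of "inv g" "conj_elt g x"] * x fix0_not by auto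
qed

lemma fix1_power4: "x \<in> fix1 \<Longrightarrow> x [^] (4::nat) = \<one>"
proof -
  assume "x \<in> fix1"
  then obtain g u where g: "g \<in> carrier G" "u \<in> U" "x = conj_elt g u" by (rule fix1_conjE)
  have "u [^] (4::nat) = (u \<otimes> u) \<otimes> (u \<otimes> u)"
    using g by (simp add: numeral_eq_Suc m_assoc)
  also have "\<dots> = \<one>" using g U_square Z_square by simp
  finally have "conj_elt g (u [^] (4::nat)) = \<one>" using g by simp
  then show ?thesis using g by (simp add: conj_elt_pow)
qed

lemma fix2_power: "x \<in> fix2 \<Longrightarrow> x [^] (q - 1) = \<one>"
proof -
  assume "x \<in> fix2"
  then obtain g u where g: "g \<in> carrier G" "u \<in> H" "x = conj_elt g u" by (rule fix2_conjE)
  then have "u [^] (q - 1) = \<one>" using subgroup_pow_card[OF H_subgroup, of u] by (simp add: card_H)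
  then have "conj_elt g (u [^] (q - 1)) = \<one>" using g by simp
  then show ?thesis using g by (simp add: conj_elt_pow)
qed

lemma pow_coprime_one:
  fixes a b :: nat
  assumes "x \<in> carrier G" "x [^] a = \<one>" "x [^] b = \<one>" "coprime a b" shows "x = \<one>"
proof -
  have "ord x dvd a" "ord x dvd b" using assms pow_eq_id by auto
  then have "ord x = 1" using assms(4) by (metis coprime_common_divisor_nat nat_dvd_1_iff_1 coprime_common_divisor)
  then show ?thesis using assms(1) pow_ord_eq_1[of x] by simp
qed

lemma coprime_4: "odd n \<Longrightarrow> coprime (4::nat) n"
  using coprime_power_left_iff[of 2 2 n] by simp

lemma fix1_fix2_disjoint: "x \<in> fix1 \<Longrightarrow> x \<notin> fix2"
proof
  assume x: "x \<in> fix1" "x \<in> fix2"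
  have "odd (q - 1)" using even_q q_ge_2 by simp
  then have "x = \<one>" using fix1_power4[OF x(1)] fix2_power[OF x(2)] x types_carrier
    by (intro pow_coprime_one[of x 4 "q - 1"] coprime_4) auto
  then show False using x one_notin_types by simp
qed

lemma normalizer_point_types:
  assumes "V \<in> points" "g \<in> normalizer V" "g \<noteq> \<one>" shows "g \<in> V \<or> g \<in> fix2"
proof -
  obtain k where k: "k \<in> carrier G" "V = conj_set k U" using assms by (auto simp: conjugates_def)
  have g: "g \<in> carrier G" using assms by (auto simp: normalizer_def)
  then have "conj_elt (inv k) g \<in> B" using assms(2) k
    by (simp add: normalizer_conj U_sub mem_conj_set_iff normalizer_subset flip: normalizer_U)
  then show ?thesis
  proof (cases rule: B_cases)
    case 1
    then show ?thesis using k g by (simp add: mem_conj_set_iff U_sub)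
  next
    case (2 u h)
    then have "conj_elt k (conj_elt (inv k) g) = conj_elt (k \<otimes> u) h" using k by (simp add: conj_elt_comp)
    then have "g = conj_elt (k \<otimes> u) h" using k g by simp
    then show ?thesis using conj_fix2[OF _ H_fix2] 2 k by simp
  qed
qed

lemma fix0_not_normalizes:
  assumes "x \<in> fix0" "V \<in> points" shows "conj_set x V \<noteq> V"
proof
  assume "conj_set x V = V"
  then have "x \<in> V \<or> x \<in> fix2" using assms types_carrier one_notin_types
    by (intro normalizer_point_types) (auto simp: normalizer_def)
  then show False using assms fix0_not by (auto simp: fix0_def)
qed

text \<open>A subgroup whose nontrivial elements fix no point acts freely on the \<open>q\<^sup>2 + 1\<close> points.\<close>

lemma fix0_subgroup_dvd:
  assumes "subgroup K G" "K - {\<one>} \<subseteq> fix0" shows "card K dvd q ^ 2 + 1"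
  unfolding card_points[symmetric]
proof (rule free_action_dvd[OF assms(1)])
  have K: "K \<subseteq> carrier G" using subgroup.subset[OF assms(1)] .
  then show "finite K" by (rule finite_sub)
  show "finite points" by (rule finite_conjugates[OF fin])
  fix X k assume X: "X \<in> points" 
  show "X \<subseteq> carrier G" by (rule point_carrier[OF X])
  assume k: "k \<in> K"
  show "conj_set k X \<in> points" using k K X by (auto intro: conj_in_point)
  assume "conj_set k X = X"
  then show "k = \<one>" using fix0_not_normalizes[OF _ X] k assms(2) by auto
qed

section \<open>Centralizers\<close>

text \<open>What commutes with \<open>x\<close> fixes the only point that \<open>x\<close> fixes, so it lies in \<open>U H\<close>; there it is
in \<open>U\<close>, or conjugate under \<open>U\<close> to a nontrivial element of \<open>H\<close>, which commutes with no nontrivial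
element of \<open>U\<close>.\<close>

lemma centralizer_U_subset: "x \<in> U \<Longrightarrow> x \<noteq> \<one> \<Longrightarrow> centralizer x \<subseteq> U"
proof
  fix c assume x: "x \<in> U" "x \<noteq> \<one>" and c: "c \<in> centralizer x"
  have c': "c \<in> carrier G" "c \<otimes> x = x \<otimes> c" using c by (auto simp: centralizer_def)
  have "conj_elt c x = x" using c' x by (simp add: conj_elt_fixed_iff)
  then have "x \<in> conj_set c U" using x by (force simp: conj_set_def)
  then have "c \<in> B" using U_Int_conj c' x by blast
  then show "c \<in> U"
  proof (cases rule: B_cases)
    case (2 u h)
    have "conj_elt (conj_elt (inv u) c) (conj_elt (inv u) x) = conj_elt (inv u) (conj_elt c x)"
      using 2(1) x c'(1) by (intro conj_elt_conj) auto
    then have "conj_elt h (conj_elt (inv u) x) = conj_elt (inv u) x"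
      using 2 \<open>conj_elt c x = x\<close> by simp
    then have "h \<otimes> conj_elt (inv u) x = conj_elt (inv u) x \<otimes> h"
      using 2 x by (simp add: conj_elt_fixed_iff)
    moreover have "conj_elt (inv u) x \<in> U" using 2 x by (simp add: conj_elt_def)
    ultimately have "conj_elt (inv u) x = \<one>" using H_U_free 2 by blast
    then show ?thesis using 2 x by simp
  qed
qed

lemma centralizer_Z: "z \<in> Z \<Longrightarrow> z \<noteq> \<one> \<Longrightarrow> centralizer z = U"
  using centralizer_U_subset[of z] Z_central by (auto simp: centralizer_def)

lemma centralizer_point: "V \<in> points \<Longrightarrow> x \<in> V \<Longrightarrow> x \<noteq> \<one> \<Longrightarrow> centralizer x \<subseteq> V"
proof -
  assume V: "V \<in> points" and x: "x \<in> V" "x \<noteq> \<one>"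
  then obtain g u where g: "g \<in> carrier G" "V = conj_set g U" "u \<in> U" "x = conj_elt g u"
    by (auto simp: conjugates_def conj_set_def)
  then have "centralizer u \<subseteq> U" using x centralizer_U_subset by auto
  then show ?thesis using g by (auto simp: centralizer_conj conj_set_def)
qed

lemma no_involution_H: "h \<in> H \<Longrightarrow> h \<otimes> h = \<one> \<Longrightarrow> h = \<one>"
proof (rule ccontr)
  assume h: "h \<in> H" "h \<otimes> h = \<one>" "h \<noteq> \<one>"
  have "odd (q - 1)" using even_q q_ge_2 by simp
  moreover have "h [^] (q - 1) = \<one>" using fix2_power[OF H_fix2] h by simp
  moreover have "h [^] (2::nat) = \<one>" using h by (simp add: numeral_eq_Suc)
  ultimately have "h = \<one>" using h by (intro pow_coprime_one[of h 2 "q - 1"]) auto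
  then show False using h by simp
qed

text \<open>Both the centralizers of elements of \<open>H\<close> and the normalizer of \<open>H\<close> come from this computation:
write \<open>c\<close> in its Bruhat form, move \<open>k\<close> to the right in \<open>k c\<close>, and compare with \<open>c h\<close>.\<close>

lemma H_transporter:
  assumes "c \<in> carrier G" "h \<in> H" "h \<noteq> \<one>" "k \<in> H" "c \<otimes> h = k \<otimes> c"
  shows "(c \<in> H \<and> k = h) \<or> (\<exists>l\<in>H. c = T \<otimes> l \<and> k = inv h)"
proof -
  have k1: "k \<noteq> \<one>" using assms by auto
  show ?thesis using assms(1)
  proof (cases rule: bruhat_cases)
    case 1
    then obtain u l where c: "u \<in> U" "l \<in> H" "c = u \<otimes> l" by (auto simp: B_def)
    have "u \<otimes> (h \<otimes> l) = u \<otimes> (l \<otimes> h)" using c assms H_commute by simp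
    also have "\<dots> = k \<otimes> (u \<otimes> l)" using c assms by (simp add: m_assoc)
    also have "\<dots> = conj_elt k u \<otimes> (k \<otimes> l)" using c assms by (simp add: conj_elt_def word)
    finally have *: "u \<otimes> (h \<otimes> l) = conj_elt k u \<otimes> (k \<otimes> l)" .
    have eq: "u = conj_elt k u" "h \<otimes> l = k \<otimes> l"
      using U_H_unique[OF _ _ _ _ *] c assms H_conj_U by auto
    then have "k \<otimes> u = u \<otimes> k" using c assms conj_elt_fixed_iff[of k u] by simp
    then have "u = \<one>" using H_U_free c assms k1 by blast
    then show ?thesis using c assms eq by simp
  next
    case (2 u v l)
    have "u \<otimes> T \<otimes> (v \<otimes> (h \<otimes> l)) = u \<otimes> T \<otimes> (v \<otimes> (l \<otimes> h))" using 2 assms H_commute by simp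
    also have "\<dots> = k \<otimes> (u \<otimes> T \<otimes> (v \<otimes> l))" using 2 assms by (simp add: m_assoc)
    also have "\<dots> = conj_elt k u \<otimes> (k \<otimes> T) \<otimes> (v \<otimes> l)" using 2 assms by (simp add: conj_elt_def word)
    also have "\<dots> = conj_elt k u \<otimes> (T \<otimes> inv k) \<otimes> (v \<otimes> l)" by (simp only: T_swap[OF assms(4)])
    also have "\<dots> = conj_elt k u \<otimes> T \<otimes> (conj_elt (inv k) v \<otimes> (inv k \<otimes> l))"
      using 2(1-3) assms(4) by (simp add: conj_elt_def word)
    finally have *: "u \<otimes> T \<otimes> (v \<otimes> (h \<otimes> l)) = conj_elt k u \<otimes> T \<otimes> (conj_elt (inv k) v \<otimes> (inv k \<otimes> l))" .
    have b: "u = conj_elt k u" "v \<otimes> (h \<otimes> l) = conj_elt (inv k) v \<otimes> (inv k \<otimes> l)"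
      using bruhat_unique[OF _ _ _ _ *] 2 assms by (auto simp: H_conj_U B_I)
    have b': "v = conj_elt (inv k) v" "h \<otimes> l = inv k \<otimes> l"
      using U_H_unique[OF _ _ _ _ b(2)] 2 assms by (auto simp: H_conj_U)
    have "k \<otimes> u = u \<otimes> k" using b 2 assms conj_elt_fixed_iff[of k u] by simp
    then have u: "u = \<one>" using H_U_free 2 assms k1 by blast
    have "inv k \<otimes> v = v \<otimes> inv k" using b' 2 assms conj_elt_fixed_iff[of "inv k" v] by simp
    then have v: "v = \<one>" using H_U_free[of "inv k" v] 2 assms k1 by auto
    have "h = inv k" using b' 2 assms by simp
    then show ?thesis using 2 u v assms by (auto intro!: bexI[of _ l])
  qed
qed

lemma centralizer_H: "h \<in> H \<Longrightarrow> h \<noteq> \<one> \<Longrightarrow> centralizer h = H"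
proof
  assume h: "h \<in> H" "h \<noteq> \<one>"
  show "centralizer h \<subseteq> H"
  proof
    fix c assume "c \<in> centralizer h"
    then have "(c \<in> H \<and> h = h) \<or> (\<exists>l\<in>H. c = T \<otimes> l \<and> h = inv h)"
      using h by (intro H_transporter) (auto simp: centralizer_def)
    moreover have "h \<noteq> inv h" using no_involution_H[of h] h by (metis H_carrier r_inv)
    ultimately show "c \<in> H" by auto
  qed
qed (use H_commute in \<open>auto simp: centralizer_def\<close>)

lemma centralizer_torus: "K \<in> split_tori \<Longrightarrow> x \<in> K \<Longrightarrow> x \<noteq> \<one> \<Longrightarrow> centralizer x = K"
proof -
  assume V: "K \<in> split_tori" and x: "x \<in> K" "x \<noteq> \<one>"
  then obtain g u where g: "g \<in> carrier G" "K = conj_set g H" "u \<in> H" "x = conj_elt g u"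
    by (auto simp: conjugates_def conj_set_def)
  then show ?thesis using x centralizer_H by (simp add: centralizer_conj)
qed

lemma centralizer_fix1_fix2:
  assumes "x \<in> fix1 \<or> x \<in> fix2" shows "centralizer x \<inter> fix0 = {}"
  using assms centralizer_point centralizer_torus unfolding fix1_def fix2_def fix0_def by blast

lemma centralizer_fix0: "x \<in> fix0 \<Longrightarrow> centralizer x - {\<one>} \<subseteq> fix0"
proof
  fix y assume x: "x \<in> fix0" and y: "y \<in> centralizer x - {\<one>}"
  then have "x \<in> centralizer y" using types_carrier centralizer_sym by blast
  then have "\<not> (y \<in> fix1 \<or> y \<in> fix2)" using centralizer_fix1_fix2[of y] x by blast
  then show "y \<in> fix0" using y types_cover centralizer_subset by blast
qed

lemma fix0_power: "x \<in> fix0 \<Longrightarrow> x [^] (q ^ 2 + 1) = \<one>"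
proof -
  assume x: "x \<in> fix0"
  then have xc: "x \<in> carrier G" using types_carrier by blast
  have "x [^] card (centralizer x) = \<one>"
    by (rule subgroup_pow_card[OF centralizer_subgroup[OF xc] centralizer_self[OF xc]])
  moreover have "card (centralizer x) dvd q ^ 2 + 1"
    using fix0_subgroup_dvd[OF centralizer_subgroup[OF xc] centralizer_fix0[OF x]] .
  ultimately show ?thesis using xc by (metis pow_eq_id dvd_trans)
qed

lemma fix0_odd:
  assumes "x \<in> fix0" "x [^] n = \<one>" shows "\<not> coprime n (q ^ 2 + 1)"
  using assms pow_coprime_one[OF _ assms(2) fix0_power[OF assms(1)]] types_carrier one_notin_types by blast

lemma odd_q2: "odd (q ^ 2 + 1)" using even_q by simp

lemma centralizer_inv: "x \<in> carrier G \<Longrightarrow> centralizer (inv x) = centralizer x"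
proof -
  have *: "centralizer x \<subseteq> centralizer (inv x)" if "x \<in> carrier G" for x
    using that subgroup.m_inv_closed[OF centralizer_subgroup, of _ x]
    by (auto dest!: centralizer_sym[of x] intro!: centralizer_sym[of _ "inv x"] simp: centralizer_def)
  show "x \<in> carrier G \<Longrightarrow> ?thesis" using *[of x] *[of "inv x"] by auto
qed

end

section \<open>Tori inverted by an involution\<close>

text \<open>A fixed-point-free involutive automorphism \<open>\<sigma>\<close> of a finite group inverts it: the map
\<open>a \<mapsto> a\<^sup>-\<^sup>1 \<sigma>(a)\<close> is injective, hence surjective, and \<open>\<sigma>\<close> inverts its values.  Here \<open>s\<close> commutes only
with elements of \<open>U\<close>, which fix a point.\<close>

lemma (in suzuki_like) involution_inverts:
  assumes A: "subgroup A G" "A - {\<one>} \<subseteq> fix0" and s: "s \<in> Z" "s \<noteq> \<one>" and sA: "conj_set s A = A"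
  shows "a \<in> A \<Longrightarrow> conj_elt s a = inv a"
    and "a \<in> A \<Longrightarrow> \<exists>c\<in>A. inv c \<otimes> inv c = a"
proof -
  have Ac: "a \<in> carrier G" if "a \<in> A" for a using subgroup.subset[OF A(1)] that by blast
  have sc: "s \<in> carrier G" "inv s = s" using s inv_equality[OF Z_square] by simp_all
  have ss: "conj_elt s (conj_elt s a) = a" if "a \<in> A" for a
    using conj_elt_inverse(1)[of s a] sc Ac[OF that] by simp
  have sA': "conj_elt s a \<in> A" if "a \<in> A" for a using that sA by (auto simp: conj_set_def)
  define f where "f a = inv a \<otimes> conj_elt s a" for a
  have "inj_on f A"
  proof (rule inj_onI)
    fix a b assume ab: "a \<in> A" "b \<in> A" "f a = f b"
    define a' b' where "a' = conj_elt s a" and "b' = conj_elt s b"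
    have c: "a \<in> carrier G" "b \<in> carrier G" "a' \<in> carrier G" "b' \<in> carrier G"
      using Ac ab sc by (simp_all add: a'_def b'_def)
    have "inv a \<otimes> a' = inv b \<otimes> b'" using ab by (simp add: f_def a'_def b'_def)
    then have "a \<otimes> (inv a \<otimes> a') \<otimes> inv b' = a \<otimes> (inv b \<otimes> b') \<otimes> inv b'" by simp
    then have "a' \<otimes> inv b' = a \<otimes> inv b" using c by (simp add: cancel_inv_left m_assoc)
    then have "conj_elt s (a \<otimes> inv b) = a \<otimes> inv b"
      using c sc(1) by (simp add: a'_def b'_def conj_elt_mult conj_elt_inv)
    then have "a \<otimes> inv b \<in> centralizer s"
      using ab sc Ac by (simp add: conj_elt_fixed_iff centralizer_def)
    then have "a \<otimes> inv b \<in> U" using centralizer_Z s by simp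
    moreover have "a \<otimes> inv b \<in> A" using ab A by (simp add: subgroup.m_closed subgroup.m_inv_closed)
    ultimately have "a \<otimes> inv b = \<one>" using U_fix1[of "a \<otimes> inv b"] A(2) fix0_not(1)[of "a \<otimes> inv b"] by auto
    then show "a = b" using c inv_equality[of a "inv b"] by simp
  qed
  moreover have "f ` A \<subseteq> A" using A sA' by (auto simp: f_def subgroup.m_closed subgroup.m_inv_closed)
  moreover have "finite A" using finite_sub subgroup.subset[OF A(1)] by blast
  ultimately have surj: "f ` A = A" by (simp add: endo_inj_surj)
  show inv: "conj_elt s a = inv a" if "a \<in> A" for a
  proof -
    have "a \<in> f ` A" using that by (simp add: surj)
    then obtain c where c: "c \<in> A" "a = f c" by blast
    have "conj_elt s a = inv (conj_elt s c) \<otimes> c"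
      using c Ac[OF c(1)] sc(1) ss[OF c(1)] by (simp add: f_def conj_elt_mult conj_elt_inv)
    then show ?thesis using c Ac[OF c(1)] sc(1) by (simp add: f_def inv_mult_group)
  qed
  show "\<exists>c\<in>A. inv c \<otimes> inv c = a" if "a \<in> A"
  proof -
    have "a \<in> f ` A" using that by (simp add: surj)
    then obtain c where c: "c \<in> A" "a = f c" by blast
    then have "a = inv c \<otimes> inv c" by (simp add: f_def inv)
    then show ?thesis using c by blast
  qed
qed

lemma (in suzuki_like) real_centralizer_inverted:
  assumes "t \<in> Z" "t \<noteq> \<one>" "x \<in> fix0" "conj_elt t x = inv x"
  shows "conj_set t (centralizer x) = centralizer x"
    and "a \<in> centralizer x \<Longrightarrow> conj_elt t a = inv a"
    and "a \<in> centralizer x \<Longrightarrow> \<exists>c\<in>centralizer x. inv c \<otimes> inv c = a"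
    and "a \<in> centralizer x \<Longrightarrow> b \<in> centralizer x \<Longrightarrow> a \<otimes> b = b \<otimes> a"
proof -
  have x: "x \<in> carrier G" using assms types_carrier by blast
  note C = centralizer_subgroup[OF x]
  have t: "t \<in> carrier G" using assms by simp
  show 0: "conj_set t (centralizer x) = centralizer x"
    using centralizer_conj[OF t x] assms(4) x by (simp add: centralizer_inv)
  note inv = involution_inverts[OF C centralizer_fix0[OF assms(3)] assms(1,2) 0]
  show "conj_elt t a = inv a" if "a \<in> centralizer x" using inv(1) that .
  show "\<exists>c\<in>centralizer x. inv c \<otimes> inv c = a" if "a \<in> centralizer x" using inv(2) that .
  show "a \<otimes> b = b \<otimes> a" if ab: "a \<in> centralizer x" "b \<in> centralizer x"
  proof -
    have c: "a \<in> carrier G" "b \<in> carrier G" using ab centralizer_subset by auto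
    have "inv (a \<otimes> b) = conj_elt t (a \<otimes> b)" using inv(1) subgroup.m_closed[OF C] ab by simp
    also have "\<dots> = inv a \<otimes> inv b" using c t inv(1) ab by (simp add: conj_elt_mult)
    also have "\<dots> = inv (b \<otimes> a)" using c by (simp add: inv_mult_group)
    finally have "inv (inv (a \<otimes> b)) = inv (inv (b \<otimes> a))" by simp
    then show ?thesis using c by simp
  qed
qed

text \<open>A fixed-point-free element \<open>x\<close> inverted by an involution \<open>t\<close>.  Taking \<open>t\<close> in \<open>Z\<close> is no loss, since
all involutions are conjugate into \<open>Z\<close>.\<close>

locale suzuki_real = suzuki_like +
  fixes t x :: 'a
  assumes t: "t \<in> Z" "t \<noteq> \<one>" and x: "x \<in> fix0" and t_x: "conj_elt t x = inv x"
begin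

definition A where "A = centralizer x"
definition Q where "Q = normalizer A \<inter> U"
abbreviation orbit where "orbit \<equiv> conjugates A"

lemma x_carrier [simp]: "x \<in> carrier G" using x types_carrier by blast
lemma t_carrier [simp]: "t \<in> carrier G" using t by simp
lemma A_sub: "A \<subseteq> carrier G" by (simp add: A_def centralizer_subset)
lemma A_carrier [simp]: "a \<in> A \<Longrightarrow> a \<in> carrier G" using A_sub by blast
lemma A_subgroup: "subgroup A G" unfolding A_def by (rule centralizer_subgroup) simp
lemma A_closed [simp]: "u \<in> A \<Longrightarrow> v \<in> A \<Longrightarrow> u \<otimes> v \<in> A" "u \<in> A \<Longrightarrow> inv u \<in> A" "\<one> \<in> A"
  using A_subgroup by (auto simp: subgroup_def)
lemma A_fix0: "A - {\<one>} \<subseteq> fix0" unfolding A_def by (rule centralizer_fix0[OF x])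
lemma x_A: "x \<in> A" by (simp add: A_def centralizer_self)

lemmas A_facts = real_centralizer_inverted[OF t x t_x, folded A_def]
lemma t_A: "conj_set t A = A" by (rule A_facts)
lemma A_inverted: "a \<in> A \<Longrightarrow> conj_elt t a = inv a" by (rule A_facts)
lemma A_square_root: "a \<in> A \<Longrightarrow> \<exists>c\<in>A. inv c \<otimes> inv c = a" by (rule A_facts)
lemma A_commute: "a \<in> A \<Longrightarrow> b \<in> A \<Longrightarrow> a \<otimes> b = b \<otimes> a" by (rule A_facts)

lemma real_centralizer:
  assumes "a \<in> A" "a \<noteq> \<one>" shows "centralizer a = A"
proof
  show "A \<subseteq> centralizer a" using A_commute assms by (auto simp: centralizer_def)
  have a: "a \<in> fix0" "conj_elt t a = inv a" using assms A_fix0 A_inverted by auto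
  have "x \<in> centralizer a" using A_commute assms x_A by (auto simp: centralizer_def)
  note commute = real_centralizer_inverted(4)[OF t a _ this]
  show "centralizer a \<subseteq> A"
    using commute centralizer_subset unfolding A_def centralizer_def by blast
qed

lemma card_A_dvd: "card A dvd q ^ 2 + 1"
  by (rule fix0_subgroup_dvd[OF A_subgroup A_fix0])

lemma card_A_ge_3: "3 \<le> card A"
proof -
  have "x \<otimes> x \<noteq> \<one>"
  proof
    assume "x \<otimes> x = \<one>"
    then have "x [^] (2::nat) = \<one>" by (simp add: numeral_eq_Suc)
    moreover have "coprime 2 (q ^ 2 + 1)" using odd_q2 by simp
    ultimately show False using fix0_odd x by blast
  qed
  then have "x \<noteq> inv x" by (metis r_inv x_carrier)
  moreover have x1: "x \<noteq> \<one>" using x one_notin_types by auto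
  moreover have "inv x \<noteq> \<one>" using x1 by simp
  ultimately have "card {\<one>, x, inv x} = 3" by (simp add: eq_commute[of \<one>])
  moreover have "{\<one>, x, inv x} \<subseteq> A" using x_A by auto
  ultimately show ?thesis using card_mono[OF finite_sub[OF A_sub]] by metis
qed

lemma N_subgroup: "subgroup (normalizer A) G" by (rule normalizer_subgroup[OF A_sub])

lemma A_subset_N: "A \<subseteq> normalizer A"
proof
  fix a assume a: "a \<in> A"
  then have "conj_set a A = A"
    using A_sub by (intro conj_set_eqI finite_sub) (auto simp: conj_elt_def)
  then show "a \<in> normalizer A" using a by (simp add: normalizer_def)
qed

lemma A_Int_U: "a \<in> A \<Longrightarrow> a \<in> U \<Longrightarrow> a = \<one>"
  using A_fix0 U_fix1 fix0_not by blast

lemma Q_closed: "u \<in> Q \<Longrightarrow> v \<in> Q \<Longrightarrow> u \<otimes> v \<in> Q" "u \<in> Q \<Longrightarrow> inv u \<in> Q" "\<one> \<in> Q"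
  using N_subgroup by (auto simp: Q_def subgroup_def)

lemma t_Q: "t \<in> Q" using t t_A by (simp add: Q_def normalizer_def)

lemma Q_Z: "s \<in> Q \<Longrightarrow> s \<in> Z \<Longrightarrow> s = \<one> \<or> s = t"
proof (rule disjCI)
  assume s: "s \<in> Q" "s \<in> Z" "s \<noteq> t"
  show "s = \<one>"
  proof (rule ccontr)
    assume s1: "s \<noteq> \<one>"
    have "conj_set s A = A" using s by (simp add: Q_def normalizer_def)
    then have "conj_elt s x = inv x" using involution_inverts(1)[OF A_subgroup A_fix0 s(2) s1] x_A by simp
    then have "conj_elt (s \<otimes> t) x = x"
      using s t x_A A_inverted[of "inv x"] by (simp add: conj_elt_comp A_inverted conj_elt_inv)
    moreover have st: "s \<otimes> t \<in> U" "s \<otimes> t \<in> carrier G" using s t by simp_all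
    ultimately have "s \<otimes> t \<in> A" using conj_elt_fixed_iff[OF st(2) x_carrier]
      unfolding A_def centralizer_def by blast
    then have "s \<otimes> t = \<one>" using st by (intro A_Int_U)
    also have "\<one> = t \<otimes> t" using t Z_square by simp
    finally show False using s t by simp
  qed
qed

lemma Q_not_Z: "s \<in> Q \<Longrightarrow> s \<notin> Z \<Longrightarrow> s \<otimes> s = t"
proof -
  assume s: "s \<in> Q" "s \<notin> Z"
  then have sU: "s \<in> U" by (simp add: Q_def)
  have "s \<otimes> s \<noteq> \<one>"
  proof
    assume "s \<otimes> s = \<one>"
    then obtain z where "z \<in> Z" "s = z \<otimes> \<one>" using U_square_inj[of s \<one>] sU by auto
    then show False using s by simp
  qed
  then show ?thesis using Q_Z[of "s \<otimes> s"] U_square sU s Q_closed by simp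
qed

text \<open>\<open>Q\<close> is a 2-group with \<open>t\<close> as its only involution, because the product of two involutions that invert \<open>A\<close>
centralizes \<open>A\<close>.  As all elements of \<open>Q\<close> outside \<open>Z\<close> are square roots of \<open>t\<close>, they agree
modulo \<open>Z\<close>.\<close>

lemma card_Q: "card Q = 2 \<or> card Q = 4"
proof (cases "Q \<subseteq> Z")
  case True
  then have "Q = {\<one>, t}" using Q_Z t_Q Q_closed by auto
  then show ?thesis using t by simp
next
  case False
  then obtain s where s: "s \<in> Q" "s \<notin> Z" by blast
  then have sU: "s \<in> U" by (simp add: Q_def)
  have "Q = {\<one>, t, s, t \<otimes> s}"
  proof
    show "Q \<subseteq> {\<one>, t, s, t \<otimes> s}"
    proof
      fix r assume r: "r \<in> Q"
      then have rU: "r \<in> U" by (simp add: Q_def)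
      show "r \<in> {\<one>, t, s, t \<otimes> s}"
      proof (cases "r \<in> Z")
        case False
        then obtain z where z: "z \<in> Z" "r = z \<otimes> s"
          using U_square_inj[OF rU sU] Q_not_Z r s by auto
        then have "z = r \<otimes> inv s" using sU by (simp add: word)
        then have "z \<in> Q" using r s Q_closed by simp
        then show ?thesis using Q_Z z sU by auto
      qed (use Q_Z r in blast)
    qed
  qed (use s t_Q Q_closed in auto)
  moreover have "t \<otimes> s \<noteq> s" using t sU by (metis U_carrier Z_U r_cancel_one')
  moreover have ts: "t \<otimes> s \<notin> Z"
  proof
    assume "t \<otimes> s \<in> Z"
    then have "inv t \<otimes> (t \<otimes> s) \<in> Z" using t by simp
    then show False using s t sU by (simp add: cancel_inv_left)
  qed
  moreover have "s \<noteq> \<one>" "s \<noteq> t" using s t by auto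
  moreover have "t \<otimes> s \<noteq> \<one>" using ts Z_closed(3) by metis
  moreover have "t \<otimes> s \<noteq> t" using ts t(1) by metis
  ultimately have "Q = {\<one>, t, s, t \<otimes> s}" "distinct [\<one>, t, s, t \<otimes> s]" using t by auto
  then show ?thesis using distinct_card[of "[\<one>, t, s, t \<otimes> s]"] by simp
qed

text \<open>A Frattini argument: the involutions that invert \<open>A\<close> form the coset \<open>t A\<close>, and \<open>A\<close> permutes them
transitively because every element of \<open>A\<close> is a square.\<close>

lemma N_decomp: "n \<in> normalizer A \<Longrightarrow> \<exists>c\<in>A. \<exists>s\<in>Q. n = c \<otimes> s"
proof -
  assume n: "n \<in> normalizer A"
  then have nc: "n \<in> carrier G" "conj_set n A = A" by (auto simp: normalizer_def)
  have tt: "t \<otimes> t = \<one>" "inv t = t" using Z_square t inv_equality by auto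
  define t' where "t' = conj_elt n t"
  have t'c: "t' \<in> carrier G" using nc by (simp add: t'_def)
  have "x \<in> conj_set n A" using nc x_A by simp
  then obtain a where a: "a \<in> A" "conj_elt n a = x" by (auto simp: conj_set_def)
  have "conj_elt t' x = conj_elt n (conj_elt t a)"
    unfolding t'_def a(2)[symmetric] by (rule conj_elt_conj[OF nc(1) t_carrier A_carrier[OF a(1)]])
  also have "\<dots> = inv x" using a nc by (simp add: A_inverted conj_elt_inv)
  finally have "conj_elt (t \<otimes> t') x = x"
    using x_A t'c by (simp add: conj_elt_comp A_inverted)
  moreover have "t \<otimes> t' \<in> carrier G" using t'c by simp
  ultimately have "t \<otimes> t' \<in> A" using conj_elt_fixed_iff[of "t \<otimes> t'" x] x_carrier
    unfolding A_def centralizer_def by blast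
  then obtain c where c: "c \<in> A" "inv c \<otimes> inv c = t \<otimes> t'" using A_square_root by blast
  have "conj_elt c t = t \<otimes> (conj_elt t c) \<otimes> inv c"
    using c(1) tt by (simp add: conj_elt_def word) (simp add: m_assoc[symmetric])
  also have "\<dots> = t \<otimes> (inv c \<otimes> inv c)" using c(1) by (simp add: A_inverted m_assoc)
  also have "\<dots> = t'" using c(2) tt t'c by (simp add: m_assoc[symmetric])
  finally have "conj_elt c t = conj_elt n t" by (simp add: t'_def)
  then have "conj_elt (inv c \<otimes> n) t = t" using c nc by (metis A_carrier conj_elt_comp conj_elt_inverse(2) inv_closed t_carrier)
  moreover have "inv c \<otimes> n \<in> carrier G" using c nc by simp
  ultimately have "inv c \<otimes> n \<in> centralizer t" using conj_elt_fixed_iff[of "inv c \<otimes> n" t] t_carrier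
    unfolding centralizer_def by blast
  then have "inv c \<otimes> n \<in> U" using centralizer_Z t by simp
  moreover have "inv c \<otimes> n \<in> normalizer A"
    using c n A_subset_N N_subgroup by (meson A_closed(2) subgroup.m_closed subsetD)
  ultimately have "inv c \<otimes> n \<in> Q" by (simp add: Q_def)
  moreover have "n = c \<otimes> (inv c \<otimes> n)" using c nc by (simp add: cancel_inv_left)
  ultimately show ?thesis using c by blast
qed

lemma card_N: "card (normalizer A) = card A * card Q"
proof -
  have "normalizer A = (\<lambda>(a, s). a \<otimes> s) ` (A \<times> Q)"
  proof
    show "normalizer A \<subseteq> (\<lambda>(a, s). a \<otimes> s) ` (A \<times> Q)" using N_decomp by fastforce
    show "(\<lambda>(a, s). a \<otimes> s) ` (A \<times> Q) \<subseteq> normalizer A"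
      using A_subset_N N_subgroup by (auto simp: Q_def subgroup.m_closed subsetD)
  qed
  moreover have "inj_on (\<lambda>(a, s). a \<otimes> s) (A \<times> Q)"
  proof (clarsimp simp: inj_on_def)
    fix a s b r assume *: "a \<in> A" "s \<in> Q" "b \<in> A" "r \<in> Q" "a \<otimes> s = b \<otimes> r"
    have U: "s \<in> U" "r \<in> U" using * by (auto simp: Q_def)
    have "inv b \<otimes> (a \<otimes> s) \<otimes> inv s = inv b \<otimes> (b \<otimes> r) \<otimes> inv s" using * by simp
    then have eq: "inv b \<otimes> a = r \<otimes> inv s" using *(1,3) U by (simp add: word)
    moreover have "inv b \<otimes> a \<in> A" "r \<otimes> inv s \<in> U" using *(1,3) U by simp_all
    ultimately have "inv b \<otimes> a = \<one>" using A_Int_U by metis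
    then have "a = b" using *(1,3) by (simp add: inv_mult_eq_oneD)
    then show "a = b \<and> s = r" using * U by simp
  qed
  ultimately show ?thesis by (simp add: card_image card_cartesian_product)
qed

lemma card_orbit: "card orbit * (card A * card Q) = card (carrier G)"
  using conjugates_card[OF fin A_sub] by (simp add: card_N)

text \<open>An element of \<open>A Q\<close> has its fourth power in \<open>A\<close>, since \<open>Q\<close> has exponent dividing four.  For a
fixed-point-free element, which has odd order, that power is nontrivial and has centralizer \<open>A\<close>.\<close>

lemma fix0_normalizing_A: "y \<in> fix0 \<Longrightarrow> y \<in> normalizer A \<Longrightarrow> y \<in> A"
proof -
  assume y: "y \<in> fix0" "y \<in> normalizer A"
  obtain c s where cs: "c \<in> A" "s \<in> Q" "y = c \<otimes> s" using N_decomp y by blast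
  have s: "s \<in> U" "conj_set s A = A" using cs by (auto simp: Q_def normalizer_def)
  have conj: "conj_elt (s [^] n) a \<in> A" if "a \<in> A" for a and n :: nat
  proof (induction n)
    case (Suc n)
    have "s [^] Suc n = s \<otimes> s [^] n" by (rule nat_pow_Suc2) (use s in simp)
    then have "conj_elt (s [^] Suc n) a = conj_elt s (conj_elt (s [^] n) a)"
      using s that by (simp add: conj_elt_comp del: nat_pow_Suc)
    then show ?case using Suc s by (auto simp: conj_set_def)
  qed (use that in simp)
  have pow: "\<exists>a\<in>A. y [^] n = a \<otimes> s [^] n" for n :: nat
  proof (induction n)
    case 0 show ?case by (auto intro!: bexI[of _ \<one>])
  next
    case (Suc n)
    then obtain a where a: "a \<in> A" "y [^] n = a \<otimes> s [^] n" by blast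
    have "y [^] Suc n = (a \<otimes> conj_elt (s [^] n) c) \<otimes> s [^] Suc n"
      using a s cs(1) by (simp add: cs(3)[symmetric] a(2)) (simp add: cs(3) conj_elt_def word)
    then show ?case using a conj[OF cs(1), of n] by (intro bexI[of _ "a \<otimes> conj_elt (s [^] n) c"]) auto
  qed
  have yc: "y \<in> carrier G" using y types_carrier by blast
  obtain a where a: "a \<in> A" "y [^] (4::nat) = a \<otimes> s [^] (4::nat)" using pow by blast
  have "s [^] (4::nat) = \<one>" using fix1_power4[OF U_fix1] s by (cases "s = \<one>") auto
  then have y4: "y [^] (4::nat) = a" using a by simp
  have "coprime 4 (q ^ 2 + 1)" using odd_q2 coprime_4 by blast
  then have "a \<noteq> \<one>" using fix0_odd[OF y(1), of 4] y4 by auto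
  then have "centralizer a = A" using real_centralizer a by blast
  moreover have "y \<in> centralizer a"
    unfolding y4[symmetric] using yc by (simp add: centralizer_def nat_pow_comm[of y 1 4, simplified])
  ultimately show ?thesis by simp
qed

lemma orbit_cases: "X \<in> orbit \<Longrightarrow> \<exists>g\<in>carrier G. X = conj_set g A" by (auto simp: conjugates_def)

lemma orbit_centralizer:
  assumes "X \<in> orbit" "a \<in> X" "a \<noteq> \<one>" shows "centralizer a = X" "a \<in> fix0"
proof -
  obtain g b where g: "g \<in> carrier G" "X = conj_set g A" "b \<in> A" "a = conj_elt g b"
    using assms by (auto simp: conjugates_def conj_set_def)
  then have "b \<noteq> \<one>" using assms by auto
  then show "centralizer a = X" using real_centralizer g by (simp add: centralizer_conj)
  show "a \<in> fix0" using g A_fix0 \<open>b \<noteq> \<one>\<close> conj_fix0 by blast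
qed

lemma fix0_normalizing_orbit:
  assumes "X \<in> orbit" "y \<in> fix0" "conj_set y X = X" shows "y \<in> X"
proof -
  obtain g where g: "g \<in> carrier G" "X = conj_set g A" using assms orbit_cases by blast
  have y: "y \<in> carrier G" using assms types_carrier by blast
  then have "y \<in> normalizer (conj_set g A)" using assms g by (simp add: normalizer_def)
  then have "conj_elt (inv g) y \<in> normalizer A"
    using g y by (simp add: normalizer_conj A_sub mem_conj_set_iff normalizer_subset)
  then have "conj_elt (inv g) y \<in> A" using fix0_normalizing_A conj_fix0 assms g by simp
  then show ?thesis using g y by (simp add: mem_conj_set_iff A_sub)
qed

lemma A_orbit: "A \<in> orbit" by (rule conjugates_self[OF A_sub])

text \<open>\<open>A\<close> acts freely on its other conjugates, since an element that normalizes one of them lies in it.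
In particular the number of conjugates is prime to the order of \<open>A\<close>.\<close>

lemma card_orbit_mod: "card A dvd card orbit - 1"
proof -
  have "card A dvd card (orbit - {A})"
  proof (rule free_action_dvd[OF A_subgroup])
    fix X k assume X: "X \<in> orbit - {A}"
    show Xc: "X \<subseteq> carrier G" using X conjugates_subset[OF A_sub] by blast
    assume k: "k \<in> A"
    have "conj_set k X \<noteq> A"
    proof
      assume "conj_set k X = A"
      then have "X = conj_set (inv k) A" using k Xc A_sub by (simp add: conj_set_eq_swap)
      also have "\<dots> = A" using k A_subset_N by (auto simp: normalizer_def subset_iff)
      finally show False using X by simp
    qed
    then show "conj_set k X \<in> orbit - {A}" using X k conjugates_closed[OF A_sub] by auto
    assume "conj_set k X = X"
    show "k = \<one>"
    proof (rule ccontr)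
      assume "k \<noteq> \<one>"
      then have "k \<in> fix0" using k A_fix0 by blast
      then have "k \<in> X" using fix0_normalizing_orbit X \<open>conj_set k X = X\<close> by blast
      then show False using orbit_centralizer real_centralizer X k \<open>k \<noteq> \<one>\<close> by blast
    qed
  qed (use finite_sub A_sub finite_conjugates[OF fin] in auto)
  then show ?thesis using A_orbit finite_conjugates[OF fin] by (simp add: card_Diff_singleton)
qed

text \<open>Plays the part of Sylow's theorem.  If \<open>y\<close> lies in no conjugate of \<open>A\<close>, then the group it generates acts
freely on these conjugates, so the order of \<open>y\<close> divides their number; but it also divides
\<open>|A|\<close>, which is prime to that number.\<close>

lemma fix0_in_orbit:
  assumes "y \<in> fix0" "y [^] card A = \<one>" shows "\<exists>X\<in>orbit. y \<in> X"
proof (rule ccontr)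
  assume no: "\<not> (\<exists>X\<in>orbit. y \<in> X)"
  have yc: "y \<in> carrier G" using assms types_carrier by blast
  let ?K = "generate G {y}"
  have K: "subgroup ?K G" using yc by (intro generate_is_subgroup) auto
  have KC: "?K \<subseteq> centralizer y"
    by (rule generate_subgroup_incl) (use yc centralizer_self centralizer_subgroup in auto)
  have "card ?K dvd card orbit"
  proof (rule free_action_dvd[OF K])
    show "finite ?K" using finite_sub subgroup.subset[OF K] by blast
    show "finite orbit" by (rule finite_conjugates[OF fin])
    fix X k assume X: "X \<in> orbit"
    show "X \<subseteq> carrier G" using X conjugates_subset[OF A_sub] by blast
    assume k: "k \<in> ?K"
    then have kc: "k \<in> carrier G" using subgroup.subset[OF K] by blast
    show "conj_set k X \<in> orbit" using conjugates_closed[OF A_sub X kc] .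
    assume kX: "conj_set k X = X"
    show "k = \<one>"
    proof (rule ccontr)
      assume "k \<noteq> \<one>"
      then have "k \<in> fix0" using k KC centralizer_fix0[OF assms(1)] by blast
      then have "k \<in> X" using fix0_normalizing_orbit X kX by blast
      then have "centralizer k = X" using orbit_centralizer X \<open>k \<noteq> \<one>\<close> by blast
      then have "y \<in> X" using k KC centralizer_sym[OF yc] by blast
      then show False using no X by blast
    qed
  qed
  then have "ord y dvd card orbit" using generate_pow_card[OF yc] by simp
  moreover have "ord y dvd card orbit - 1"
    using assms pow_eq_id[OF yc] card_orbit_mod dvd_trans by blast
  moreover have "card orbit > 0" using A_orbit finite_conjugates[OF fin] by (auto simp: card_gt_0_iff)
  ultimately have "ord y = 1" by (metis One_nat_def Suc_pred' dvd_diffD1 nat_dvd_1_iff_1 dvd_diff_nat diff_Suc_Suc diff_diff_cancel Suc_leI)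
  then show False using pow_ord_eq_1[OF yc] one_notin_types assms yc by simp
qed

end

context suzuki_like
begin

section \<open>Every fixed-point-free element is real\<close>

text \<open>Conjugation by \<open>U\<close> turns \<open>u T v h\<close> into \<open>T v' h\<close>.  As \<open>T\<close> inverts \<open>H\<close>, conjugation by \<open>l \<in> H\<close> then
changes \<open>h\<close> by \<open>l\<^sup>-\<^sup>2\<close>, and squaring is bijective on \<open>H\<close>, which has odd order.\<close>

lemma conj_to_T_U:
  assumes "g \<in> carrier G" "g \<notin> B"
  obtains k u where "k \<in> carrier G" "u \<in> U" "conj_elt k g = T \<otimes> u"
  using assms(1)
proof (cases rule: bruhat_cases)
  case (2 u v h)
  \<comment> \<open>a square root of \<open>h\<close>, because \<open>h\<^sup>q = h\<close>\<close>
  define l where "l = h [^] (q div 2)"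
  have "h [^] n \<in> H" for n :: nat by (induction n) (use 2(3) in simp_all)
  then have l: "l \<in> H" unfolding l_def .
  have "h [^] (q - 1) = \<one>" using fix2_power[OF H_fix2] 2 by (cases "h = \<one>") auto
  moreover have "Suc (q - 1) = q div 2 + q div 2" using q_ge_2 even_q by presburger
  ultimately have ll: "l \<otimes> l = h"
    using 2(3) by (simp add: l_def nat_pow_mult) (metis H_carrier l_one nat_pow_Suc)
  define w where "w = conj_elt (inv l) (v \<otimes> conj_elt h u)"
  have w: "w \<in> U" using 2 l H_conj_U by (simp add: w_def)
  have "conj_elt (l \<otimes> inv u) g = (l \<otimes> T) \<otimes> v \<otimes> h \<otimes> u \<otimes> inv l"
    using 2 l by (simp add: conj_elt_def word)
  also have "\<dots> = T \<otimes> inv l \<otimes> v \<otimes> h \<otimes> u \<otimes> inv l" by (simp add: T_swap[OF l])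
  also have "\<dots> = T \<otimes> inv l \<otimes> v \<otimes> (l \<otimes> l) \<otimes> u \<otimes> inv l" by (simp add: ll)
  also have "\<dots> = T \<otimes> w" unfolding w_def ll[symmetric] using 2(1,2) l by (simp add: conj_elt_def word)
  finally show ?thesis using that w 2 l by (metis H_carrier U_carrier inv_closed m_closed)
qed (use assms in simp)

lemma Z_inverts_T_Z: "z \<in> Z \<Longrightarrow> conj_elt z (T \<otimes> z) = inv (T \<otimes> z)"
proof -
  assume z: "z \<in> Z"
  have "inv z = z" "inv T = T" using z Z_square T_T inv_equality by auto
  then show ?thesis using z Z_square by (simp add: conj_elt_def inv_mult_group m_assoc)
qed

lemma T_Z_notin_U: "z \<in> Z \<Longrightarrow> T \<otimes> z \<notin> U"
proof
  assume z: "z \<in> Z" "T \<otimes> z \<in> U"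
  then have "T \<otimes> z \<otimes> inv z \<in> U" by simp
  then have "T \<in> U" using z by (simp add: m_assoc)
  then show False using U_B T_notin_B by blast
qed

text \<open>If the product \<open>T z\<close> of two involutions had a single fixed point, then both involutions would fix it,
whereas they have different fixed points.\<close>

lemma T_Z_not_fix1: "z \<in> Z \<Longrightarrow> z \<noteq> \<one> \<Longrightarrow> T \<otimes> z \<notin> fix1"
proof
  assume z: "z \<in> Z" "z \<noteq> \<one>" and "T \<otimes> z \<in> fix1"
  then obtain V where V: "V \<in> points" "T \<otimes> z \<in> V" "T \<otimes> z \<noteq> \<one>" by (auto simp: fix1_def)
  have "inv (T \<otimes> z) \<in> V" using V point_subgroup by (simp add: subgroup.m_inv_closed)
  moreover have "inv (T \<otimes> z) \<in> conj_set z V" using V z unfolding Z_inverts_T_Z[OF z(1), symmetric]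
    by (simp add: conj_set_def)
  moreover have "inv (T \<otimes> z) \<noteq> \<one>" using V z by simp
  ultimately have "conj_set z V = V" using points_Int V conj_in_point[of z V] z by (metis U_carrier Z_U)
  then have "z \<in> V \<or> z \<in> fix2" using V z by (intro normalizer_point_types) (auto simp: normalizer_def)
  moreover have "z \<notin> fix2" using U_fix1 fix1_fix2_disjoint z by simp
  ultimately have "V = U" using U_Int_point V z by (metis Z_U)
  then show False using V z T_Z_notin_U by blast
qed

lemma suzuki_realI:
  assumes "z \<in> Z" "z \<noteq> \<one>" "T \<otimes> z \<in> fix0" shows "suzuki_real G U Z H T q z (T \<otimes> z)"
  using assms Z_inverts_T_Z
  by (intro suzuki_real.intro suzuki_like_axioms suzuki_real_axioms.intro)

text \<open>The element \<open>T z\<close> supplied by the axiom \<open>trace\<close> must be fixed-point-free: otherwise it has one fixed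
point, which is excluded for a product of involutions with different fixed points, or two,
and then the order of \<open>y\<close> would divide both \<open>q - 1\<close> and \<open>q\<^sup>2 + 1\<close>.\<close>

lemma fix0_real:
  assumes "y \<in> fix0"
  obtains z X where "z \<in> Z" "z \<noteq> \<one>" "T \<otimes> z \<in> fix0" "X \<in> conjugates (centralizer (T \<otimes> z))" "y \<in> X"
proof -
  have yc: "y \<in> carrier G" using assms types_carrier by blast
  have "y \<notin> B"
  proof
    assume "y \<in> B"
    then show False
      by (cases rule: B_cases) (use assms U_fix1 fix0_not one_notin_types conj_fix2 H_fix2 in \<open>auto; metis U_carrier\<close>)+
  qed
  then obtain k u where ku: "k \<in> carrier G" "u \<in> U" "conj_elt k y = T \<otimes> u"
    using conj_to_T_U yc by blast
  have y': "T \<otimes> u \<in> fix0" using conj_fix0 ku assms by metis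
  have pow: "y [^] n = \<one>" if "(T \<otimes> u) [^] n = \<one>" for n :: nat
    using that ku yc by (metis conj_elt_eq_one conj_elt_pow nat_pow_closed)
  have odd: "\<not> coprime n (q ^ 2 + 1)" if "(T \<otimes> u) [^] n = \<one>" for n
    using fix0_odd[OF y' that] .
  have "coprime 4 (q ^ 2 + 1)" using odd_q2 coprime_4 by blast
  then have "(T \<otimes> u) [^] (4::nat) \<noteq> \<one>" using odd by blast
  then obtain z where z: "z \<in> Z" "z \<noteq> \<one>" and zu: "\<And>n::nat. (T \<otimes> z) [^] n = \<one> \<Longrightarrow> (T \<otimes> u) [^] n = \<one>"
    using trace[OF ku(2)] by blast
  have "T \<otimes> z \<notin> fix2"
  proof
    assume "T \<otimes> z \<in> fix2"
    then have "(T \<otimes> u) [^] (q - 1) = \<one>" using zu fix2_power by blast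
    moreover have "coprime (q - 1) (q ^ 2 + 1)"
    proof (rule coprimeI)
      fix d assume d: "d dvd q - 1" "d dvd q ^ 2 + 1"
      have "q ^ 2 + 1 = (q - 1) * (q + 1) + 2"
        using q_ge_2 by (cases q) (auto simp: power2_eq_square)
      then have "d dvd 2" using d by (metis dvd_add_right_iff dvd_mult2)
      moreover have "odd d" using d odd_q2 dvd_trans by blast
      ultimately show "is_unit d" using two_is_prime_nat by (auto simp: prime_nat_iff)
    qed
    ultimately show False using odd by blast
  qed
  moreover have "T \<otimes> z \<noteq> \<one>" using T_Z_notin_U[OF z(1)] U_closed(3) by metis
  ultimately have x: "T \<otimes> z \<in> fix0" using T_Z_not_fix1[OF z] z by (intro fix0_alt) auto
  then interpret R: suzuki_real G U Z H T q z "T \<otimes> z" using suzuki_realI z by blast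
  have "(T \<otimes> z) [^] card R.A = \<one>" by (rule subgroup_pow_card[OF R.A_subgroup R.x_A])
  then have "y [^] card R.A = \<one>" using zu pow by blast
  then obtain X where "X \<in> conjugates R.A" "y \<in> X" using R.fix0_in_orbit[OF assms] by blast
  then show ?thesis using that z x unfolding R.A_def by blast
qed

text \<open>For the Suzuki groups with \<open>q > 2\<close> these are the cyclic groups of orders \<open>q + r + 1\<close> and \<open>q - r + 1\<close> with
\<open>r\<^sup>2 = 2q\<close>.\<close>

definition nonsplit where "nonsplit = centralizer ` fix0"

lemma fix0_centralizer:
  assumes "y \<in> fix0"
  shows "a \<in> centralizer y \<Longrightarrow> a \<noteq> \<one> \<Longrightarrow> centralizer a = centralizer y"
    and "a \<in> centralizer y \<Longrightarrow> b \<in> centralizer y \<Longrightarrow> a \<otimes> b = b \<otimes> a"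
proof -
  obtain z X where z: "z \<in> Z" "z \<noteq> \<one>" "T \<otimes> z \<in> fix0" and X: "X \<in> conjugates (centralizer (T \<otimes> z))" "y \<in> X"
    using fix0_real assms by blast
  interpret R: suzuki_real G U Z H T q z "T \<otimes> z" using suzuki_realI z by blast
  have X': "X \<in> R.orbit" using X by (simp add: R.A_def)
  have y: "y \<noteq> \<one>" "y \<in> carrier G" using assms one_notin_types types_carrier by auto
  have CX: "centralizer y = X" by (rule R.orbit_centralizer(1)[OF X' X(2) y(1)])
  show 1: "centralizer a = centralizer y" if "a \<in> centralizer y" "a \<noteq> \<one>" for a
    using R.orbit_centralizer(1)[OF X'] that CX by simp
  show "a \<otimes> b = b \<otimes> a" if "a \<in> centralizer y" "b \<in> centralizer y"
  proof (cases "b = \<one>")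
    case False
    then have "a \<in> centralizer b" using 1 that by blast
    then show ?thesis by (simp add: centralizer_def)
  qed (use that centralizer_subset[of y] in auto)
qed

lemma nonsplit_class:
  assumes "X \<in> nonsplit"
  shows "X \<subseteq> carrier G" "3 \<le> card X" "card X dvd q ^ 2 + 1" "conjugates X \<subseteq> nonsplit"
    "Y \<in> conjugates X \<Longrightarrow> card Y = card X"
    "card (conjugates X) * (card X * 2) = card (carrier G) \<or> card (conjugates X) * (card X * 4) = card (carrier G)"
proof -
  obtain y where yT: "y \<in> fix0" and Xy: "X = centralizer y" using assms by (auto simp: nonsplit_def)
  obtain z X' where z: "z \<in> Z" "z \<noteq> \<one>" "T \<otimes> z \<in> fix0" and X: "X' \<in> conjugates (centralizer (T \<otimes> z))" "y \<in> X'"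
    using fix0_real yT by blast
  interpret R: suzuki_real G U Z H T q z "T \<otimes> z" using suzuki_realI z by blast
  have X': "X' \<in> R.orbit" using X by (simp add: R.A_def)
  have y: "y \<noteq> \<one>" "y \<in> carrier G" using yT one_notin_types types_carrier by auto
  have CX: "X = X'" unfolding Xy by (rule R.orbit_centralizer(1)[OF X' X(2) y(1)])
  show Xc: "X \<subseteq> carrier G" using Xy centralizer_subset by simp
  have card: "card Y = card R.A" if "Y \<in> R.orbit" for Y
    using that conj_set_card[OF _ R.A_sub] by (auto simp: conjugates_def)
  have conj: "conjugates X = R.orbit" using conjugates_eq[OF R.A_sub X'] CX by simp
  have cX: "card X = card R.A" using card CX X' by simp
  show "3 \<le> card X" "card X dvd q ^ 2 + 1" using R.card_A_ge_3 R.card_A_dvd cX by simp_all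
  show "conjugates X \<subseteq> nonsplit"
  proof
    fix Y assume Y: "Y \<in> conjugates X"
    then have "3 \<le> card Y" using card conj R.card_A_ge_3 by simp
    then have "\<not> Y \<subseteq> {\<one>}" using card_mono[of "{\<one>}" Y] by auto
    then obtain a where a: "a \<in> Y" "a \<noteq> \<one>" by blast
    then have "centralizer a = Y" "a \<in> fix0" using R.orbit_centralizer Y conj by auto
    then show "Y \<in> nonsplit" by (auto simp: nonsplit_def)
  qed
  show "Y \<in> conjugates X \<Longrightarrow> card Y = card X" using card conj cX by simp
  show "card (conjugates X) * (card X * 2) = card (carrier G) \<or> card (conjugates X) * (card X * 4) = card (carrier G)"
    using R.card_orbit R.card_Q conj cX by auto
qed

lemma nonsplit_Int:
  assumes "X \<in> nonsplit" "Y \<in> nonsplit" "X \<noteq> Y" "a \<in> X" "a \<in> Y" shows "a = \<one>"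
  using assms fix0_centralizer(1) unfolding nonsplit_def by (metis imageE)

lemma fix0_eq: "fix0 = \<Union>nonsplit - {\<one>}"
proof
  have "x \<in> centralizer x" if "x \<in> fix0" for x using that centralizer_self types_carrier by blast
  then show "fix0 \<subseteq> \<Union>nonsplit - {\<one>}"
    using one_notin_types unfolding nonsplit_def by blast
  show "\<Union>nonsplit - {\<one>} \<subseteq> fix0" using centralizer_fix0 by (auto simp: nonsplit_def)
qed

section \<open>Counting\<close>

lemma card_fix1: "card fix1 = (q ^ 2 + 1) * (q ^ 2 - 1)"
proof -
  have "card V = q ^ 2" if "V \<in> points" for V
    using that conj_set_card[OF _ U_sub] by (auto simp: conjugates_def card_U)
  moreover have "card fix1 = (\<Sum>X\<in>points. card X - 1)"
    unfolding fix1_def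
    by (rule card_Union_punctured)
     (use finite_conjugates[OF fin] finite_sub point_carrier point_subgroup points_Int in
      \<open>auto simp: subgroup.one_closed\<close>)
  ultimately show ?thesis by (simp add: card_points)
qed

lemma H_nontrivial: assumes "2 < q" obtains h where "h \<in> H" "h \<noteq> \<one>"
proof -
  have "card H \<ge> 2" using assms by (simp add: card_H)
  then have "\<not> H \<subseteq> {\<one>}" using card_mono[of "{\<one>}" H] by auto
  then show ?thesis using that by blast
qed

lemma normalizer_H: "2 < q \<Longrightarrow> card (normalizer H) = 2 * (q - 1)"
proof -
  assume q: "2 < q"
  then obtain h where h: "h \<in> H" "h \<noteq> \<one>" by (rule H_nontrivial)
  have T_conj: "conj_elt T k = inv k" if "k \<in> H" for k
  proof -
    have "inv T = T" using T_T inv_equality by simp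
    then have "conj_elt T k = T \<otimes> (k \<otimes> T)" using that by (simp add: conj_elt_def m_assoc)
    then show ?thesis using that T_swap[OF that] by simp
  qed
  have "normalizer H = H \<union> (\<otimes>) T ` H"
  proof
    show "normalizer H \<subseteq> H \<union> (\<otimes>) T ` H"
    proof
      fix g assume "g \<in> normalizer H"
      then have g: "g \<in> carrier G" "conj_set g H = H" by (auto simp: normalizer_def)
      have "conj_elt g h \<in> conj_set g H" using h by (simp add: conj_set_def)
      then have k: "conj_elt g h \<in> H" using g by simp
      have "g \<otimes> h = conj_elt g h \<otimes> g" using g h by (simp add: conj_elt_def m_assoc)
      then show "g \<in> H \<union> (\<otimes>) T ` H" using H_transporter[OF g(1) h k] by auto
    qed
    have H: "conj_set k H = H" if "k \<in> H" for k
      using that H_sub by (intro conj_set_eqI finite_sub) (auto simp: conj_elt_def)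
    have "conj_set T H = H" using H_sub T_conj by (intro conj_set_eqI finite_sub) auto
    then show "H \<union> (\<otimes>) T ` H \<subseteq> normalizer H"
      using H H_sub by (auto simp: normalizer_def conj_set_comp)
  qed
  moreover have "H \<inter> (\<otimes>) T ` H = {}"
  proof (rule ccontr)
    assume "H \<inter> (\<otimes>) T ` H \<noteq> {}"
    then obtain k where k: "k \<in> H" "T \<otimes> k \<in> H" by auto
    then have "T \<otimes> k \<otimes> inv k \<in> H" by simp
    then show False using k T_notin_B H_B by (simp add: m_assoc)
  qed
  moreover have "card ((\<otimes>) T ` H) = card H" by (rule card_image) (auto simp: inj_on_def)
  ultimately show ?thesis using finite_sub[OF H_sub] by (simp add: card_Un_disjoint card_H)
qed

lemma card_split_tori: "2 < q \<Longrightarrow> 2 * card split_tori = q ^ 2 * (q ^ 2 + 1)"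
proof -
  assume q: "2 < q"
  have "q ^ 2 * (q - 1) * (q ^ 2 + 1) = card split_tori * (2 * (q - 1))"
    using conjugates_card[OF fin H_sub] unfolding normalizer_H[OF q] card_G .
  then have "(q - 1) * (2 * card split_tori) = (q - 1) * (q ^ 2 * (q ^ 2 + 1))" by (simp only: ac_simps)
  moreover have "q - 1 \<noteq> 0" using q by simp
  ultimately show ?thesis by (metis mult_left_cancel)
qed

lemma card_fix2: "2 * card fix2 = q ^ 2 * (q ^ 2 + 1) * (q - 2)"
proof (cases "q = 2")
  case True
  then have "card H = 1" by (simp add: card_H)
  then have "H = {\<one>}" using H_closed(3) by (metis card_1_singletonE singletonD)
  then have "fix2 = {}" using fix2_conjE by (metis all_not_in_conv singletonD)
  then show ?thesis using True by simp
next
  case False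
  then have q: "2 < q" using q_ge_2 by simp
  have "card V = q - 1" if "V \<in> split_tori" for V
    using that conj_set_card[OF _ H_sub] by (auto simp: conjugates_def card_H)
  moreover have "card fix2 = (\<Sum>X\<in>split_tori. card X - 1)"
    unfolding fix2_def
  proof (rule card_Union_punctured)
    fix X Y a assume "X \<in> split_tori" "Y \<in> split_tori" "X \<noteq> Y" "a \<in> X" "a \<in> Y"
    then show "a = \<one>" using centralizer_torus by metis
  qed (use finite_conjugates[OF fin] finite_sub torus_carrier torus_subgroup in
      \<open>auto simp: subgroup.one_closed\<close>)
  ultimately have "card fix2 = card split_tori * (q - 2)" by (simp add: numeral_2_eq_2)
  then show ?thesis using card_split_tori[OF q] by (metis mult.assoc)
qed

lemma finite_types: "finite fix1" "finite fix2" "finite fix0"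
  using finite_sub types_carrier by auto

text \<open>Obtained by subtracting the elements with one or two fixed points from the order of the group.\<close>

lemma card_fix0: "2 * int (card fix0) = int q ^ 3 * (int q - 1) ^ 2"
proof -
  have "carrier G = insert \<one> (fix1 \<union> fix2 \<union> fix0)" using types_cover types_carrier by auto
  moreover have "card (insert \<one> (fix1 \<union> fix2 \<union> fix0)) = Suc (card (fix1 \<union> fix2 \<union> fix0))"
    using one_notin_types finite_types by simp
  moreover have "card (fix1 \<union> fix2 \<union> fix0) = card fix1 + card fix2 + card fix0"
  proof -
    have "fix1 \<inter> fix2 = {}" "(fix1 \<union> fix2) \<inter> fix0 = {}" using fix1_fix2_disjoint fix0_not by blast+
    then show ?thesis using finite_types by (simp add: card_Un_disjoint)
  qed
  ultimately have "card (carrier G) = 1 + card fix1 + card fix2 + card fix0" by (simp only: add.assoc Suc_eq_plus1_left)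
  then have "int (card (carrier G)) = 1 + int (card fix1) + int (card fix2) + int (card fix0)" by simp
  then have "int (q ^ 2 * (q - 1) * (q ^ 2 + 1)) =
      1 + int ((q ^ 2 + 1) * (q ^ 2 - 1)) + int (card fix2) + int (card fix0)"
    unfolding card_G card_fix1 .
  moreover have "2 * int (card fix2) = int (q ^ 2 * (q ^ 2 + 1) * (q - 2))" using card_fix2 by (metis of_nat_mult of_nat_numeral)
  moreover have "1 \<le> q ^ 2" using q_ge_2 by simp
  then have "int (q - 1) = int q - 1" "int (q ^ 2 - 1) = int q ^ 2 - 1" "int (q - 2) = int q - 2"
    using q_ge_2 by (simp_all add: of_nat_diff)
  ultimately have "int q ^ 2 * (int q - 1) * (int q ^ 2 + 1) =
      1 + (int q ^ 2 + 1) * (int q ^ 2 - 1) + int (card fix2) + int (card fix0)"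
    "2 * int (card fix2) = int q ^ 2 * (int q ^ 2 + 1) * (int q - 2)"
    by (simp_all only: of_nat_mult of_nat_add of_nat_power of_nat_1)
  then show ?thesis by (simp add: algebra_simps power2_eq_square power3_eq_cube)
qed

lemma card_fix0_sum: "card fix0 = (\<Sum>X\<in>nonsplit. card X - 1)"
  unfolding fix0_eq
proof (rule card_Union_punctured)
  show "finite nonsplit" using finite_types by (simp add: nonsplit_def)
  fix X assume X: "X \<in> nonsplit"
  show "finite X" using nonsplit_class(1)[OF X] finite_sub by blast
  show "\<one> \<in> X" using X types_carrier by (auto simp: nonsplit_def centralizer_def)
qed (use nonsplit_Int in blast)

text \<open>A torus acts freely on the five points, so it has order five; and there are only four fixed-point-free
elements.\<close>

lemma card_nonsplit_q_2: "q = 2 \<Longrightarrow> card nonsplit = 1"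
proof -
  assume q: "q = 2"
  have "card fix0 = 4" using card_fix0 q by simp
  then have "fix0 \<noteq> {}" by auto
  then obtain X where X: "X \<in> nonsplit" by (auto simp: nonsplit_def)
  have "card X dvd 5" "3 \<le> card X" using nonsplit_class[OF X] q by simp_all
  then have "card X \<le> 5" "card X dvd 5" "3 \<le> card X" by (auto dest: dvd_imp_le)
  then have "card X = 3 \<or> card X = 4 \<or> card X = 5" by auto
  then have cX: "card X = 5" using \<open>card X dvd 5\<close> by auto
  have one: "\<one> \<in> X" using X types_carrier by (auto simp: nonsplit_def centralizer_def)
  have "X - {\<one>} \<subseteq> fix0" using X fix0_eq by auto
  moreover have "card (X - {\<one>}) = card fix0" using \<open>card fix0 = 4\<close> cX one by simp
  ultimately have XT: "X - {\<one>} = fix0" using finite_types card_subset_eq by blast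
  have "Y = X" if "Y \<in> nonsplit" for Y
  proof -
    obtain y where y: "y \<in> fix0" "Y = centralizer y" using \<open>Y \<in> nonsplit\<close> by (auto simp: nonsplit_def)
    then have "y \<in> X" "y \<noteq> \<one>" using XT by auto
    moreover have "y \<in> Y" using y centralizer_self types_carrier by blast
    ultimately show ?thesis using nonsplit_Int[OF X \<open>Y \<in> nonsplit\<close>] by blast
  qed
  then have "nonsplit = {X}" using X by blast
  then show ?thesis by simp
qed

text \<open>Let \<open>\<alpha>\<close> be the order of a torus, \<open>n\<close> the number of its conjugates and \<open>w\<close> its index in its
normalizer, so that \<open>n \<alpha> w\<close> is the order \<open>g\<close> of the group.  Its class contributes
\<open>n (\<alpha> - 1)\<close> to the number \<open>M\<close> of fixed-point-free elements, which is at least \<open>g/6\<close> for \<open>w = 4\<close> and at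
least \<open>g/3\<close> for \<open>w = 2\<close>, as \<open>\<alpha> \<ge> 3\<close>.  Since \<open>M < g/2\<close>, there are at most two classes, and if there are two,
both have \<open>w = 4\<close>.  A single class is impossible: with \<open>w = 4\<close> it is too small, and with
\<open>w = 2\<close> it would require \<open>\<alpha> = (q\<^sup>2 + 1)/(q + 1)\<close>, which is not an integer.  So there are two classes, whose
sizes satisfy \<open>M = (g/4 - n) + (g/4 - n')\<close>.\<close>

lemma card_nonsplit:
  assumes q: "2 < q" shows "2 * int (card nonsplit) = int q ^ 2 * (int q ^ 2 - 1)"
proof -
  define Q where "Q = int q"
  have Q4: "4 \<le> Q" unfolding Q_def using q even_q by presburger
  define g where "g = int (card (carrier G))"
  define M where "M = int (card fix0)"
  have g: "g = Q ^ 2 * (Q - 1) * (Q ^ 2 + 1)"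
    using q_ge_2 by (simp add: g_def card_G Q_def of_nat_diff distrib_left)
  have M2: "2 * M = Q ^ 3 * (Q - 1) ^ 2" using card_fix0 by (simp add: M_def Q_def)
  have gM: "g - 2 * M = Q ^ 2 * (Q - 1) * (Q + 1)"
    unfolding g M2 by (simp add: algebra_simps power2_eq_square power3_eq_cube)
  have Mg: "2 * M < g"
  proof -
    have "0 < Q ^ 2 * (Q - 1) * (Q + 1)" using Q4 by simp
    then show ?thesis using gM by linarith
  qed
  have finA: "finite nonsplit" using finite_types by (simp add: nonsplit_def)
  define S where "S F = (\<Sum>X\<in>F. int (card X) - 1)" for F :: "'a set set"
  have M: "M = S nonsplit"
  proof -
    have "M = (\<Sum>X\<in>nonsplit. int (card X - 1))" by (simp add: M_def card_fix0_sum)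
    also have "\<dots> = S nonsplit"
      unfolding S_def using nonsplit_class(2) by (intro sum.cong) (auto simp: of_nat_diff, force)
    finally show ?thesis .
  qed
  have mono: "S F \<le> M" if "F \<subseteq> nonsplit" for F
    unfolding M S_def using that finA nonsplit_class(2) by (intro sum_mono2) (force simp: subset_iff)+
  have disj: "S (F \<union> F') = S F + S F'" if "F \<subseteq> nonsplit" "F' \<subseteq> nonsplit" "F \<inter> F' = {}" for F F'
    unfolding S_def using that finA by (intro sum.union_disjoint) (auto intro: finite_subset)
  define oc where "oc X = int (card (conjugates X))" for X
  have orbS: "S (conjugates X) = oc X * int (card X) - oc X" if "X \<in> nonsplit" for X
  proof -
    have "S (conjugates X) = (\<Sum>Y\<in>conjugates X. int (card X) - 1)"
      unfolding S_def using nonsplit_class(5)[OF that] by (intro sum.cong) auto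
    then show ?thesis by (simp add: oc_def algebra_simps)
  qed
  have orb: "2 * (oc X * int (card X)) = g \<or> 4 * (oc X * int (card X)) = g" "3 * oc X \<le> oc X * int (card X)"
    if "X \<in> nonsplit" for X
  proof -
    have "int (card (conjugates X) * (card X * 2)) = g \<or> int (card (conjugates X) * (card X * 4)) = g"
      using nonsplit_class(6)[OF that] g_def by metis
    then show "2 * (oc X * int (card X)) = g \<or> 4 * (oc X * int (card X)) = g" by (simp add: oc_def mult_ac)
    have "oc X * 3 \<le> oc X * int (card X)"
      using nonsplit_class(2)[OF that] by (intro mult_left_mono) (auto simp: oc_def)
    then show "3 * oc X \<le> oc X * int (card X)" by simp
  qed
  have orbd: "conjugates X \<inter> conjugates Y = {}"
    if "X \<in> nonsplit" "Y \<in> nonsplit" "Y \<notin> conjugates X" for X Y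
  proof (rule ccontr)
    assume "conjugates X \<inter> conjugates Y \<noteq> {}"
    then obtain W where "W \<in> conjugates X" "W \<in> conjugates Y" by blast
    then have "conjugates X = conjugates Y" using conjugates_eq that nonsplit_class(1) by metis
    then show False using that conjugates_self nonsplit_class(1) by blast
  qed
  note sub = nonsplit_class(4)
  have "M \<noteq> 0"
  proof
    assume "M = 0"
    then have "Q ^ 3 * (Q - 1) ^ 2 = 0" using M2 by simp
    then show False using Q4 by simp
  qed
  then have "nonsplit \<noteq> {}" by (auto simp: M S_def)
  then obtain X where X: "X \<in> nonsplit" by blast
  have "nonsplit \<noteq> conjugates X"
  proof
    assume eq: "nonsplit = conjugates X"
    then have MX: "M = oc X * int (card X) - oc X" using M orbS[OF X] by simp
    from orb(1)[OF X] show False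
    proof
      assume 2: "2 * (oc X * int (card X)) = g"
      then have "2 * oc X = Q ^ 2 * (Q - 1) * (Q + 1)" using MX gM by linarith
      then have "Q ^ 2 * (Q - 1) * ((Q + 1) * int (card X)) = (2 * oc X) * int (card X)" by simp
      also have "\<dots> = Q ^ 2 * (Q - 1) * (Q ^ 2 + 1)" using 2 g by simp
      finally have "(Q + 1) * int (card X) = Q ^ 2 + 1" using Q4 by simp
      moreover have "Q ^ 2 + 1 = (Q + 1) * (Q - 1) + 2" by (simp add: algebra_simps power2_eq_square)
      ultimately have "(Q + 1) * (int (card X) - (Q - 1)) = 2" by (simp add: algebra_simps)
      then have "(Q + 1) dvd 2" by (metis dvd_triv_left)
      then have "Q + 1 \<le> 2" by (rule zdvd_imp_le) simp
      then show False using Q4 by simp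
    next
      assume 4: "4 * (oc X * int (card X)) = g"
      have "0 \<le> oc X" by (simp add: oc_def)
      then have "4 * M \<le> g" using MX 4 by linarith
      then have "2 * (2 * M) \<le> g" by simp
      then have "2 * (Q ^ 3 * (Q - 1) ^ 2) \<le> Q ^ 2 * (Q - 1) * (Q ^ 2 + 1)" unfolding M2 g .
      then have "Q ^ 2 * (Q - 1) * (2 * Q * (Q - 1)) \<le> Q ^ 2 * (Q - 1) * (Q ^ 2 + 1)"
        by (simp add: algebra_simps power2_eq_square power3_eq_cube)
      then have "2 * Q * (Q - 1) \<le> Q ^ 2 + 1" using Q4 by (simp add: mult_le_cancel_left)
      then have "Q * (Q - 2) \<le> 1" by (simp add: algebra_simps power2_eq_square)
      moreover have "4 * 2 \<le> Q * (Q - 2)" using Q4 by (intro mult_mono) auto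
      ultimately show False by simp
    qed
  qed
  then obtain Y where Y: "Y \<in> nonsplit" "Y \<notin> conjugates X" using sub[OF X] by blast
  have S2: "S (conjugates X \<union> conjugates Y) = oc X * int (card X) - oc X + (oc Y * int (card Y) - oc Y)"
    using disj[OF sub[OF X] sub[OF Y(1)] orbd[OF X Y]] orbS X Y by simp
  have le2: "S (conjugates X \<union> conjugates Y) \<le> M"
    using mono sub[OF X] sub[OF Y(1)] by simp
  have M0: "0 \<le> M" by (simp add: M_def)
  have w: "4 * (oc X * int (card X)) = g" "4 * (oc Y * int (card Y)) = g"
    using M0 le2 S2 orb(2)[OF X] orb(2)[OF Y(1)] Mg orb(1)[OF X] orb(1)[OF Y(1)]
    by - (elim disjE; linarith)+
  have "nonsplit = conjugates X \<union> conjugates Y"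
  proof (rule ccontr)
    assume "nonsplit \<noteq> conjugates X \<union> conjugates Y"
    then obtain W where W: "W \<in> nonsplit" "W \<notin> conjugates X" "W \<notin> conjugates Y"
      using sub[OF X] sub[OF Y(1)] by blast
    have "S (conjugates X \<union> conjugates Y \<union> conjugates W) =
        S (conjugates X \<union> conjugates Y) + (oc W * int (card W) - oc W)"
      using disj[of "conjugates X \<union> conjugates Y" "conjugates W"] sub[OF X] sub[OF Y(1)] sub[OF W(1)]
        orbd[OF X W(1,2)] orbd[OF Y(1) W(1,3)] orbS[OF W(1)] by (simp add: Int_Un_distrib2)
    moreover have "S (conjugates X \<union> conjugates Y \<union> conjugates W) \<le> M"
      using mono sub[OF X] sub[OF Y(1)] sub[OF W(1)] by simp
    ultimately show False
      using M0 S2 orb(2)[OF X] orb(2)[OF Y(1)] orb(2)[OF W(1)] w Mg orb(1)[OF W(1)]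
      by - (elim disjE; linarith)
  qed
  moreover have "int (card (conjugates X \<union> conjugates Y)) = oc X + oc Y"
    using orbd[OF X Y] finite_conjugates[OF fin] by (simp add: oc_def card_Un_disjoint)
  ultimately have "int (card nonsplit) = oc X + oc Y" "M = oc X * int (card X) - oc X + (oc Y * int (card Y) - oc Y)"
    using M S2 by simp_all
  then have "2 * int (card nonsplit) = g - 2 * M" using w by linarith
  also have "\<dots> = Q ^ 2 * (Q ^ 2 - 1)" unfolding gM by (simp add: algebra_simps power2_eq_square)
  finally show ?thesis by (simp add: Q_def)
qed

section \<open>Covers\<close>

text \<open>The member of the partition that contains a given nontrivial element.\<close>

definition piece where
  "piece x = (if x \<in> fix1 then (THE V. V \<in> points \<and> x \<in> V) else centralizer x)"

lemma piece_point: "V \<in> points \<Longrightarrow> x \<in> V \<Longrightarrow> x \<noteq> \<one> \<Longrightarrow> piece x = V"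
proof -
  assume *: "V \<in> points" "x \<in> V" "x \<noteq> \<one>"
  then have "x \<in> fix1" by (auto simp: fix1_def)
  moreover have "(THE V. V \<in> points \<and> x \<in> V) = V" using * points_Int by (intro the_equality) blast+
  ultimately show ?thesis by (simp add: piece_def)
qed

text \<open>The members of the partition contain the centralizers of their nontrivial elements, so commuting
elements share a member.\<close>

lemma piece_cong:
  assumes "x \<in> carrier G" "x \<noteq> \<one>" "z \<in> carrier G" "z \<noteq> \<one>" "z \<otimes> x = x \<otimes> z"
  shows "piece x = piece z"
proof -
  have z: "z \<in> centralizer x" using assms by (simp add: centralizer_def)
  consider "x \<in> fix1" | "x \<in> fix2" | "x \<in> fix0" using types_cover assms by blast
  then show ?thesis
  proof cases
    case 1
    then obtain V where V: "V \<in> points" "x \<in> V" by (auto simp: fix1_def)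
    then have "z \<in> V" using centralizer_point assms z by blast
    then show ?thesis using piece_point V assms by simp
  next
    case 2
    then obtain K where K: "K \<in> split_tori" "x \<in> K" by (auto simp: fix2_def)
    then have "z \<in> K" using centralizer_torus assms z by blast
    then have "z \<in> fix2" "centralizer z = centralizer x" using K assms centralizer_torus by (auto simp: fix2_def)
    then show ?thesis using 2 fix1_fix2_disjoint by (auto simp: piece_def)
  next
    case 3
    then have "z \<in> fix0" "centralizer z = centralizer x"
      using centralizer_fix0 fix0_centralizer z assms by blast+
    then show ?thesis using 3 fix0_not by (simp add: piece_def)
  qed
qed

lemma fix2_centralizer_commute:
  "y \<in> fix2 \<Longrightarrow> a \<in> centralizer y \<Longrightarrow> b \<in> centralizer y \<Longrightarrow> a \<otimes> b = b \<otimes> a"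
proof -
  assume y: "y \<in> fix2" and ab: "a \<in> centralizer y" "b \<in> centralizer y"
  then obtain K where K: "K \<in> split_tori" "y \<in> K" "y \<noteq> \<one>" by (auto simp: fix2_def)
  then have C: "centralizer y = K" by (rule centralizer_torus)
  show ?thesis
  proof (cases "b = \<one>")
    case False
    then have "a \<in> centralizer b" using centralizer_torus K C ab by simp
    then show ?thesis by (simp add: centralizer_def)
  qed (use ab centralizer_subset[of y] in auto)
qed

text \<open>Only the class of the conjugates of \<open>U\<close> restricts \<open>c\<close>: they have class two if \<open>q > 2\<close>, and are
abelian if \<open>q = 2\<close>.\<close>

lemma piece_cover:
  assumes c: "1 \<le> c" and V: "\<And>V. V \<in> points \<Longrightarrow> c_nilpotent_subgroup c G V"
  shows "c_nilpotent_cover c G (piece ` (carrier G - {\<one>}))" "two_minimal c G (piece ` (carrier G - {\<one>}))"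
    "omega_nilp c G = card (piece ` (carrier G - {\<one>}))"
proof -
  have self: "x \<in> piece x" if "x \<in> carrier G" "x \<noteq> \<one>" for x
  proof (cases "x \<in> fix1")
    case True
    then obtain V where V: "V \<in> points" "x \<in> V" by (auto simp: fix1_def)
    then show ?thesis using piece_point that by simp
  qed (use that centralizer_self in \<open>simp add: piece_def\<close>)
  have nilp: "c_nilpotent_subgroup c G (piece x)" if "x \<in> carrier G - {\<one>}" for x
  proof (cases "x \<in> fix1")
    case True
    then obtain V' where "V' \<in> points" "x \<in> V'" by (auto simp: fix1_def)
    then show ?thesis using piece_point V that by simp
  next
    case False
    then have "x \<in> fix2 \<or> x \<in> fix0" using that types_cover by blast
    then have "c_nilpotent_subgroup c G (centralizer x)"
      using fix2_centralizer_commute[of x] fix0_centralizer(2)[of x] that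
      by (intro nilpotent_if_commutative centralizer_subgroup c) auto
    then show ?thesis using False by (simp add: piece_def)
  qed
  have sep: "\<not> c_nilpotent_subgroup c G (generate G {x, y})"
    if "x \<in> carrier G - {\<one>}" "y \<in> carrier G - {\<one>}" "piece x \<noteq> piece y" for x y
  proof
    assume n: "c_nilpotent_subgroup c G (generate G {x, y})"
    have xy: "x \<in> generate G {x, y}" "y \<in> generate G {x, y}" by (auto intro: generate.incl)
    have "generate G {x, y} \<noteq> {\<one>}" using xy that by auto
    then obtain z where z: "z \<in> generate G {x, y}" "z \<noteq> \<one>" "\<And>k. k \<in> generate G {x, y} \<Longrightarrow> z \<otimes> k = k \<otimes> z"
      using nilpotent_center[OF n] by metis
    have "z \<in> carrier G" using z(1) n by (auto simp: c_nilpotent_subgroup_def dest: subgroup.subset)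
    then have "piece x = piece z" "piece y = piece z"
      using piece_cong[OF _ _ _ z(2) z(3)[OF xy(1)]] piece_cong[OF _ _ _ z(2) z(3)[OF xy(2)]] that(1,2)
      by blast+
    then show False using that(3) by simp
  qed
  obtain v where "v \<in> U" "v \<noteq> \<one>" by (rule U_nontrivial)
  then have "piece v = U" "v \<in> carrier G - {\<one>}" using piece_point U_point by auto
  then have "\<one> \<in> \<Union>(piece ` (carrier G - {\<one>}))" using U_closed(3) by blast
  then have cover: "carrier G \<subseteq> \<Union>(piece ` (carrier G - {\<one>}))" using self by blast
  show "c_nilpotent_cover c G (piece ` (carrier G - {\<one>}))" "two_minimal c G (piece ` (carrier G - {\<one>}))"
    "omega_nilp c G = card (piece ` (carrier G - {\<one>}))"
    using omega_nilp_eq_card_cover[OF fin _ nilp _ cover sep] self by auto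
qed

lemma piece_image:
  "piece ` (carrier G - {\<one>}) = points \<union> (centralizer ` fix2 \<union> nonsplit)"
proof -
  have "carrier G - {\<one>} = fix1 \<union> (fix2 \<union> fix0)" using types_cover types_carrier one_notin_types by blast
  moreover have "piece ` fix1 = points"
  proof
    show "piece ` fix1 \<subseteq> points" using piece_point by (auto simp: fix1_def)
    show "points \<subseteq> piece ` fix1"
    proof
      fix V assume V: "V \<in> points"
      then obtain g where g: "g \<in> carrier G" "V = conj_set g U" by (auto simp: conjugates_def)
      obtain u where u: "u \<in> U" "u \<noteq> \<one>" by (rule U_nontrivial)
      have "conj_elt g u \<in> V" "conj_elt g u \<noteq> \<one>" using g u by (auto simp: conj_set_def)
      then have "conj_elt g u \<in> fix1" "piece (conj_elt g u) = V" using V piece_point by (auto simp: fix1_def)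
      then show "V \<in> piece ` fix1" by blast
    qed
  qed
  moreover have "piece ` fix2 = centralizer ` fix2" "piece ` fix0 = nonsplit"
    unfolding nonsplit_def using fix1_fix2_disjoint fix0_not by (auto simp: piece_def)
  ultimately show ?thesis by (simp add: image_Un)
qed

lemma centralizers_disjoint:
  "x \<in> fix1 \<Longrightarrow> y \<in> fix2 \<union> fix0 \<Longrightarrow> centralizer x \<noteq> centralizer y" "x \<in> fix2 \<Longrightarrow> y \<in> fix0 \<Longrightarrow> centralizer x \<noteq> centralizer y"
proof -
  have self: "x \<in> centralizer x" if "x \<in> fix1 \<union> fix2 \<union> fix0" for x using that types_carrier centralizer_self by blast
  show "x \<in> fix2 \<Longrightarrow> y \<in> fix0 \<Longrightarrow> centralizer x \<noteq> centralizer y"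
    using self[of y] centralizer_fix1_fix2 by auto
  show "centralizer x \<noteq> centralizer y" if x: "x \<in> fix1" and y: "y \<in> fix2 \<union> fix0"
  proof
    assume eq: "centralizer x = centralizer y"
    obtain V where V: "V \<in> points" "x \<in> V" "x \<noteq> \<one>" using x by (auto simp: fix1_def)
    have "y \<in> V" using self[of y] y eq centralizer_point V by blast
    moreover have "y \<noteq> \<one>" using y one_notin_types by auto
    ultimately have "y \<in> fix1" using V by (auto simp: fix1_def)
    then show False using y fix1_fix2_disjoint fix0_not by auto
  qed
qed

lemma card_fix2_centralizers: "2 < q \<Longrightarrow> centralizer ` fix2 = split_tori" "q = 2 \<Longrightarrow> fix2 = {}"
proof -
  show "q = 2 \<Longrightarrow> fix2 = {}" using card_fix2 finite_types by simp
  assume q: "2 < q"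
  then obtain h where h: "h \<in> H" "h \<noteq> \<one>" by (rule H_nontrivial)
  show "centralizer ` fix2 = split_tori"
  proof
    show "centralizer ` fix2 \<subseteq> split_tori" using centralizer_torus by (auto simp: fix2_def)
    show "split_tori \<subseteq> centralizer ` fix2"
    proof
      fix V assume V: "V \<in> split_tori"
      then obtain g where g: "g \<in> carrier G" "V = conj_set g H" by (auto simp: conjugates_def)
      have "conj_elt g h \<in> V" "conj_elt g h \<noteq> \<one>" using g h by (auto simp: conj_set_def)
      then have "conj_elt g h \<in> fix2" "centralizer (conj_elt g h) = V" using V centralizer_torus by (auto simp: fix2_def)
      then show "V \<in> centralizer ` fix2" by blast
    qed
  qed
qed

lemma card_pieces:
  "card (piece ` (carrier G - {\<one>})) = card points + card (centralizer ` fix2) + card nonsplit"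
proof -
  have fin': "finite points" "finite (centralizer ` fix2)" "finite nonsplit"
    using finite_conjugates[OF fin] finite_types by (auto simp: nonsplit_def)
  have 1: "centralizer ` fix2 \<inter> nonsplit = {}" using centralizers_disjoint(2) by (auto simp: nonsplit_def)
  have "V \<noteq> centralizer y" if V: "V \<in> points" and y: "y \<in> fix2 \<union> fix0" for V y
  proof
    assume "V = centralizer y"
    moreover have "y \<in> centralizer y" using y types_carrier centralizer_self by blast
    moreover have "y \<noteq> \<one>" using y one_notin_types by auto
    ultimately have "y \<in> fix1" using V by (auto simp: fix1_def)
    then show False using y fix1_fix2_disjoint fix0_not by auto
  qed
  then have "points \<inter> (centralizer ` fix2 \<union> nonsplit) = {}" unfolding nonsplit_def by blast
  then show ?thesis unfolding piece_image using fin' 1 by (simp add: card_Un_disjoint)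
qed

lemma omega_class_2:
  assumes q: "2 < q" shows "int (card (piece ` (carrier G - {\<one>}))) = int q ^ 4 + int q ^ 2 + 1"
proof -
  have "2 * int (card split_tori) = int q ^ 2 * (int q ^ 2 + 1)"
    using arg_cong[OF card_split_tori[OF q], of int] by (simp add: distrib_left)
  then have "2 * int (card (piece ` (carrier G - {\<one>}))) = 2 * (int q ^ 4 + int q ^ 2 + 1)"
    using card_nonsplit[OF q] card_pieces card_fix2_centralizers(1)[OF q] card_points
    by (simp add: algebra_simps power2_eq_square power4_eq_xxxx)
  then show ?thesis by simp
qed

lemma omega_q_2: "q = 2 \<Longrightarrow> card (piece ` (carrier G - {\<one>})) = 6"
  using card_nonsplit_q_2 card_pieces card_fix2_centralizers(2) card_points by simp

lemma point_nilpotent: "V \<in> points \<Longrightarrow> 2 \<le> c \<Longrightarrow> c_nilpotent_subgroup c G V"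
proof -
  assume V: "V \<in> points" and c: "2 \<le> c"
  then obtain g where g: "g \<in> carrier G" "V = conj_set g U" by (auto simp: conjugates_def)
  show ?thesis
  proof (rule nilpotent_if_central_commutators[OF point_subgroup[OF V] conj_set_subgroup[OF Z_subgroup g(1)] c])
    fix x y assume "x \<in> V" "y \<in> V"
    then obtain u v where uv: "u \<in> U" "v \<in> U" "x = conj_elt g u" "y = conj_elt g v"
      using g by (auto simp: conj_set_def)
    obtain z where z: "z \<in> Z" "u \<otimes> v = z \<otimes> (v \<otimes> u)" using U_commutator uv by blast
    have "x \<otimes> y \<otimes> inv x \<otimes> inv y = conj_elt g (u \<otimes> v \<otimes> inv u \<otimes> inv v)"
      using uv g by (simp add: conj_elt_mult conj_elt_inv)
    also have "u \<otimes> v \<otimes> inv u \<otimes> inv v = z" unfolding z(2) using z(1) uv by (simp add: word)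
    finally show "x \<otimes> y \<otimes> inv x \<otimes> inv y \<in> conj_set g Z" using z by (simp add: conj_set_def)
  next
    fix z y assume "z \<in> conj_set g Z" "y \<in> V"
    then obtain u v where uv: "u \<in> Z" "v \<in> U" "z = conj_elt g u" "y = conj_elt g v"
      using g by (auto simp: conj_set_def)
    then show "z \<otimes> y = y \<otimes> z" using g Z_central[OF uv(1,2)] by (simp add: conj_elt_mult[symmetric])
  qed
qed

section \<open>Covers by abelian subgroups\<close>

lemma U_involution_iff: "u \<in> U \<Longrightarrow> u \<otimes> u = \<one> \<longleftrightarrow> u \<in> Z"
  using U_square_inj[of u \<one>] Z_square by auto

lemma centralizer_U:
  assumes u: "u \<in> U - Z" shows "centralizer u = Z \<union> (\<lambda>z. z \<otimes> u) ` Z"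
proof
  have u1: "u \<noteq> \<one>" using u Z_closed(3) by auto
  show "centralizer u \<subseteq> Z \<union> (\<lambda>z. z \<otimes> u) ` Z"
  proof
    fix y assume y: "y \<in> centralizer u"
    then have yU: "y \<in> U" using centralizer_U_subset u u1 by blast
    have "y \<otimes> u = u \<otimes> y" using y by (simp add: centralizer_def)
    then show "y \<in> Z \<union> (\<lambda>z. z \<otimes> u) ` Z" using U_commute[of y u] yU u by blast
  qed
  have "z \<otimes> u \<otimes> u = u \<otimes> (z \<otimes> u)" if "z \<in> Z" for z
  proof -
    have "z \<otimes> u \<otimes> u = u \<otimes> z \<otimes> u" using Z_central[OF that] u by simp
    then show ?thesis using that u by (simp add: m_assoc)
  qed
  then show "Z \<union> (\<lambda>z. z \<otimes> u) ` Z \<subseteq> centralizer u"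
    using u Z_central by (auto simp: centralizer_def)
qed

lemma centralizer_U_commute:
  assumes u: "u \<in> U - Z" and ab: "a \<in> centralizer u" "b \<in> centralizer u" shows "a \<otimes> b = b \<otimes> a"
proof -
  have u1: "u \<noteq> \<one>" using u Z_closed(3) by auto
  have U: "a \<in> U" "b \<in> U" using centralizer_U_subset[of u] u u1 ab by auto
  show ?thesis
  proof (cases "a \<in> Z \<or> b \<in> Z")
    case True
    then show ?thesis using Z_central U by metis
  next
    case False
    then obtain z where z: "z \<in> Z" "b = z \<otimes> u" using ab centralizer_U[OF u] by auto
    have "a \<otimes> b = a \<otimes> z \<otimes> u" using z U u by (simp add: m_assoc)
    also have "\<dots> = z \<otimes> (a \<otimes> u)" using z U u Z_central[OF z(1) U(1)] by (simp add: m_assoc[symmetric])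
    also have "\<dots> = z \<otimes> (u \<otimes> a)" using ab by (simp add: centralizer_def)
    finally show ?thesis using z U u by (simp add: m_assoc)
  qed
qed

lemma coset_Z_card: "u \<in> U \<Longrightarrow> card ((\<lambda>z. z \<otimes> u) ` Z) = q"
  by (subst card_image) (auto simp: inj_on_def card_Z)

text \<open>Elements of a point satisfy \<open>x\<^sup>4 = 1\<close>, so these are the elements of order four.\<close>

definition order_four where "order_four = {x \<in> fix1. x \<otimes> x \<noteq> \<one>}"

lemma conj_involution_iff:
  "g \<in> carrier G \<Longrightarrow> x \<in> carrier G \<Longrightarrow> conj_elt g x \<otimes> conj_elt g x = \<one> \<longleftrightarrow> x \<otimes> x = \<one>"
  by (simp add: conj_elt_mult[symmetric])

lemma order_four_conjE:
  assumes "x \<in> order_four" obtains g u where "g \<in> carrier G" "u \<in> U - Z" "x = conj_elt g u"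
proof -
  have x: "x \<in> fix1" "x \<otimes> x \<noteq> \<one>" using assms by (auto simp: order_four_def)
  obtain g u where g: "g \<in> carrier G" "u \<in> U" "x = conj_elt g u" using fix1_conjE[OF x(1)] by metis
  then have "u \<notin> Z" using x by (simp add: conj_involution_iff U_involution_iff)
  then show ?thesis using that g by blast
qed

lemma U_order_four: "u \<in> U - Z \<Longrightarrow> u \<in> order_four"
proof -
  assume u: "u \<in> U - Z"
  then have "u \<noteq> \<one>" using Z_closed(3) by blast
  then show ?thesis using u U_fix1[of u] U_involution_iff[of u] by (simp add: order_four_def)
qed

lemma order_four_centralizer_commute:
  assumes "x \<in> order_four" "a \<in> centralizer x" "b \<in> centralizer x" shows "a \<otimes> b = b \<otimes> a"
proof -
  obtain g u where g: "g \<in> carrier G" "u \<in> U - Z" "x = conj_elt g u" using order_four_conjE assms(1) by metis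
  then have "centralizer x = conj_set g (centralizer u)" by (simp add: centralizer_conj)
  then obtain c d where cd: "c \<in> centralizer u" "d \<in> centralizer u" "a = conj_elt g c" "b = conj_elt g d"
    using assms by (auto simp: conj_set_def)
  have "c \<in> carrier G" "d \<in> carrier G" using cd centralizer_subset by auto
  then show ?thesis using cd g centralizer_U_commute[OF g(2) cd(1,2)] by (simp add: conj_elt_mult[symmetric])
qed

text \<open>The centralizer of \<open>u\<close> is \<open>Z \<union> Z u\<close>, and the elements of order four in it, which form \<open>Z u\<close>,
all have this same centralizer.  So each point carries \<open>(q\<^sup>2 - q)/q = q - 1\<close> such centralizers.\<close>

lemma order_four_fibre_U:
  assumes u: "u \<in> U - Z" shows "{y \<in> order_four. centralizer y = centralizer u} = (\<lambda>z. z \<otimes> u) ` Z"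
proof
  show "{y \<in> order_four. centralizer y = centralizer u} \<subseteq> (\<lambda>z. z \<otimes> u) ` Z"
  proof
    fix y assume "y \<in> {y \<in> order_four. centralizer y = centralizer u}"
    then have y: "y \<in> order_four" "centralizer y = centralizer u" by auto
    have "y \<in> carrier G" using y(1) types_carrier by (auto simp: order_four_def)
    then have "y \<in> centralizer u" using y(2) centralizer_self by metis
    moreover have "y \<notin> Z" using y Z_square by (auto simp: order_four_def)
    ultimately show "y \<in> (\<lambda>z. z \<otimes> u) ` Z" using centralizer_U[OF u] by blast
  qed
  show "(\<lambda>z. z \<otimes> u) ` Z \<subseteq> {y \<in> order_four. centralizer y = centralizer u}"
  proof
    fix y assume "y \<in> (\<lambda>z. z \<otimes> u) ` Z"
    then obtain z where z: "z \<in> Z" "y = z \<otimes> u" by blast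
    have yZ: "y \<notin> Z"
    proof
      assume "y \<in> Z"
      then have "inv z \<otimes> y \<in> Z" using z by simp
      then show False using u z by (simp add: cancel_inv_left)
    qed
    then have yU: "y \<in> U - Z" using z u by simp
    have yC: "y \<in> centralizer u" using z centralizer_U[OF u] by blast
    have uC: "u \<in> centralizer y" using u by (intro centralizer_sym[OF _ yC]) auto
    have "centralizer y = centralizer u"
    proof
      show "centralizer u \<subseteq> centralizer y"
      proof
        fix w assume w: "w \<in> centralizer u"
        then show "w \<in> centralizer y"
          using centralizer_U_commute[OF u w yC] centralizer_subset[of u] by (auto simp: centralizer_def)
      qed
      show "centralizer y \<subseteq> centralizer u"
      proof
        fix w assume w: "w \<in> centralizer y"
        then show "w \<in> centralizer u"
          using centralizer_U_commute[OF yU w uC] centralizer_subset[of y] by (auto simp: centralizer_def)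
      qed
    qed
    then show "y \<in> {y \<in> order_four. centralizer y = centralizer u}" using U_order_four[OF yU] by simp
  qed
qed

lemma conj_order_four: "g \<in> carrier G \<Longrightarrow> x \<in> order_four \<Longrightarrow> conj_elt g x \<in> order_four"
  using conj_fix1 conj_involution_iff types_carrier by (auto simp: order_four_def)

lemma order_four_fibre:
  assumes "x \<in> order_four" shows "card {y \<in> order_four. centralizer y = centralizer x} = q"
proof -
  obtain g u where g: "g \<in> carrier G" "u \<in> U - Z" "x = conj_elt g u" using order_four_conjE assms(1) by metis
  let ?F = "{y \<in> order_four. centralizer y = centralizer u}"
  have F: "?F \<subseteq> carrier G" using types_carrier by (auto simp: order_four_def)
  have "{y \<in> order_four. centralizer y = centralizer x} = conj_set g ?F"
  proof
    show "conj_set g ?F \<subseteq> {y \<in> order_four. centralizer y = centralizer x}"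
    proof
      fix y assume "y \<in> conj_set g ?F"
      then obtain v where v: "v \<in> order_four" "centralizer v = centralizer u" "y = conj_elt g v"
        by (auto simp: conj_set_def)
      have "v \<in> carrier G" using v types_carrier by (auto simp: order_four_def)
      then show "y \<in> {y \<in> order_four. centralizer y = centralizer x}"
        using v g conj_order_four by (simp add: centralizer_conj)
    qed
    show "{y \<in> order_four. centralizer y = centralizer x} \<subseteq> conj_set g ?F"
    proof
      fix y assume "y \<in> {y \<in> order_four. centralizer y = centralizer x}"
      then have y: "y \<in> order_four" "centralizer y = centralizer x" by auto
      have yc: "y \<in> carrier G" using y types_carrier by (auto simp: order_four_def)
      have "centralizer (conj_elt (inv g) y) = conj_set (inv g) (centralizer (conj_elt g u))"
        using y g yc by (simp add: centralizer_conj)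
      also have "\<dots> = centralizer u" using g by (simp add: centralizer_conj conj_set_inverse centralizer_subset)
      finally show "y \<in> conj_set g ?F" using y g yc F conj_order_four by (simp add: mem_conj_set_iff)
    qed
  qed
  then show ?thesis using conj_set_card[OF g(1) F] order_four_fibre_U[OF g(2)] coset_Z_card g(2) by simp
qed

lemma card_order_four: "card order_four = (q ^ 2 + 1) * (q ^ 2 - q)"
proof -
  define I where "I = {x \<in> carrier G. x \<otimes> x = \<one>}"
  have "order_four = (\<Union>V\<in>points. V - I)"
    using types_carrier one_notin_types by (auto simp: order_four_def fix1_def I_def)
  also have "card \<dots> = (\<Sum>V\<in>points. card (V - I))"
  proof (rule card_UN_disjoint)
    have "\<one> \<in> I" by (simp add: I_def)
    then show "\<forall>i\<in>points. \<forall>j\<in>points. i \<noteq> j \<longrightarrow> (i - I) \<inter> (j - I) = {}"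
      using points_Int by blast
  qed (use finite_conjugates[OF fin] finite_sub[OF point_carrier] in auto)
  also have "\<dots> = (\<Sum>V\<in>points. q ^ 2 - q)"
  proof (rule sum.cong)
    fix V assume "V \<in> points"
    then obtain g where g: "g \<in> carrier G" "V = conj_set g U" by (auto simp: conjugates_def)
    have "V - I = conj_set g (U - Z)"
    proof
      show "V - I \<subseteq> conj_set g (U - Z)" unfolding g(2)
        using g(1) Z_square by (auto simp: conj_set_def I_def conj_involution_iff)
      show "conj_set g (U - Z) \<subseteq> V - I" unfolding g(2)
        using g(1) by (auto simp: conj_set_def I_def conj_involution_iff U_involution_iff)
    qed
    moreover have "card (U - Z) = q ^ 2 - q"
      using card_Diff_subset[of Z U] Z_subset_U finite_sub[OF U_sub] finite_subset card_U card_Z by metis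
    ultimately show "card (V - I) = q ^ 2 - q" using g conj_set_card[of g "U - Z"] U_sub
      by (simp add: subset_iff)
  qed simp
  finally show ?thesis by (simp add: card_points)
qed

lemma card_order_four_centralizers: "card (centralizer ` order_four) = (q ^ 2 + 1) * (q - 1)"
proof -
  have "finite order_four" using finite_types by (simp add: order_four_def)
  then have "card order_four = card (centralizer ` order_four) * q"
  proof (rule card_image_fibres)
    fix y assume "y \<in> centralizer ` order_four"
    then show "card {x \<in> order_four. centralizer x = y} = q" using order_four_fibre by auto
  qed
  moreover have "(q ^ 2 + 1) * (q ^ 2 - q) = (q ^ 2 + 1) * (q - 1) * q"
    by (simp add: power2_eq_square algebra_simps diff_mult_distrib diff_mult_distrib2)
  ultimately have "card (centralizer ` order_four) * q = (q ^ 2 + 1) * (q - 1) * q" using card_order_four by simp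
  then show ?thesis using q_ge_2 by (metis mult_right_cancel not_numeral_le_zero)
qed

definition noninvol where "noninvol = {x \<in> carrier G. x \<otimes> x \<noteq> \<one>}"

lemma noninvol_eq: "noninvol = order_four \<union> (fix2 \<union> fix0)"
proof
  show "noninvol \<subseteq> order_four \<union> (fix2 \<union> fix0)"
  proof
    fix x assume "x \<in> noninvol"
    then have x: "x \<in> carrier G" "x \<otimes> x \<noteq> \<one>" by (auto simp: noninvol_def)
    then have "x \<noteq> \<one>" by auto
    then show "x \<in> order_four \<union> (fix2 \<union> fix0)" using types_cover[OF x(1)] x by (auto simp: order_four_def)
  qed
  have sq: "x [^] (2::nat) = x \<otimes> x" if "x \<in> carrier G" for x using that by (simp add: numeral_eq_Suc)
  have "x \<otimes> x \<noteq> \<one>" if x: "x \<in> fix2" for x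
  proof
    assume "x \<otimes> x = \<one>"
    then have "x [^] (2::nat) = \<one>" using x types_carrier sq by auto
    moreover have "coprime 2 (q - 1)" using even_q q_ge_2 by simp
    ultimately have "x = \<one>" using fix2_power[OF x] x types_carrier by (intro pow_coprime_one[of x 2 "q - 1"]) auto
    then show False using x one_notin_types by simp
  qed
  moreover have "x \<otimes> x \<noteq> \<one>" if x: "x \<in> fix0" for x
  proof
    assume "x \<otimes> x = \<one>"
    then have "x [^] (2::nat) = \<one>" using x types_carrier sq by auto
    moreover have "coprime 2 (q ^ 2 + 1)" using odd_q2 by simp
    ultimately show False using fix0_odd x by blast
  qed
  ultimately show "order_four \<union> (fix2 \<union> fix0) \<subseteq> noninvol" using types_carrier by (auto simp: noninvol_def order_four_def)
qed

text \<open>Involutions have to be left out: the centralizer of an involution of \<open>U\<close> is \<open>U\<close>, which is not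
abelian unless \<open>q = 2\<close>.\<close>

lemma noninvol_centralizer_commute:
  "x \<in> noninvol \<Longrightarrow> a \<in> centralizer x \<Longrightarrow> b \<in> centralizer x \<Longrightarrow> a \<otimes> b = b \<otimes> a"
  unfolding noninvol_eq using order_four_centralizer_commute fix2_centralizer_commute fix0_centralizer(2) by blast

lemma U_minus_Z: obtains u where "u \<in> U - Z"
proof -
  have "card Z < card U" using q_ge_2 by (simp add: card_U card_Z power2_eq_square)
  then have "\<not> U \<subseteq> Z" using card_mono[of Z U] finite_sub[OF U_sub] finite_subset[OF Z_subset_U] by auto
  then show ?thesis using that by blast
qed

lemma centralizer_cover:
  "c_nilpotent_cover 1 G (centralizer ` noninvol)" "two_minimal 1 G (centralizer ` noninvol)"
  "omega_nilp 1 G = card (centralizer ` noninvol)"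
proof -
  have R1c: "noninvol \<subseteq> carrier G" by (auto simp: noninvol_def)
  have self: "x \<in> centralizer x" if "x \<in> noninvol" for x using that R1c centralizer_self by blast
  have nilp: "c_nilpotent_subgroup 1 G (centralizer x)" if "x \<in> noninvol" for x
    using noninvol_centralizer_commute[OF that] that R1c
    by (intro nilpotent_if_commutative centralizer_subgroup) auto
  have sub: "centralizer x \<subseteq> centralizer y" if "x \<in> noninvol" "y \<in> centralizer x" for x y
  proof
    fix w assume w: "w \<in> centralizer x"
    then show "w \<in> centralizer y"
      using noninvol_centralizer_commute[OF that(1) w that(2)] centralizer_subset[of x] by (auto simp: centralizer_def)
  qed
  have sep: "\<not> c_nilpotent_subgroup 1 G (generate G {x, y})"
    if "x \<in> noninvol" "y \<in> noninvol" "centralizer x \<noteq> centralizer y" for x y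
  proof
    assume "c_nilpotent_subgroup 1 G (generate G {x, y})"
    then have "x \<otimes> y = y \<otimes> x"
      by (rule one_nilpotent_commute) (auto intro: generate.incl)
    then have "y \<in> centralizer x" "x \<in> centralizer y" using that R1c by (auto simp: centralizer_def)
    then show False using sub that by blast
  qed
  obtain u where u: "u \<in> U - Z" by (rule U_minus_Z)
  have uR: "u \<in> noninvol" using U_order_four[OF u] noninvol_eq by simp
  have cover: "carrier G \<subseteq> \<Union>(centralizer ` noninvol)"
  proof
    fix g assume g: "g \<in> carrier G"
    show "g \<in> \<Union>(centralizer ` noninvol)"
    proof (cases "g \<in> noninvol")
      case False
      show ?thesis
      proof (cases "g = \<one>")
        case True
        then have "g \<in> centralizer u" using u by (simp add: centralizer_def)
        then show ?thesis using uR by blast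
      next
        case g1: False
        then have "g \<in> fix1" using types_cover[OF g] False noninvol_eq by blast
        then obtain k v where k: "k \<in> carrier G" "v \<in> U" "g = conj_elt k v" using fix1_conjE by metis
        have "v \<in> Z" using k False g by (simp add: noninvol_def conj_involution_iff U_involution_iff)
        then have "v \<in> centralizer u" using centralizer_U[OF u] by simp
        then have "g \<in> centralizer (conj_elt k u)" using k u by (auto simp: centralizer_conj conj_set_def)
        moreover have "conj_elt k u \<in> noninvol" using conj_order_four[OF k(1) U_order_four[OF u]] noninvol_eq by simp
        ultimately show ?thesis by blast
      qed
    qed (use self in blast)
  qed
  show "c_nilpotent_cover 1 G (centralizer ` noninvol)" "two_minimal 1 G (centralizer ` noninvol)"
    "omega_nilp 1 G = card (centralizer ` noninvol)"
    using omega_nilp_eq_card_cover[OF fin R1c nilp self cover sep] by auto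
qed

lemma omega_class_1:
  assumes q: "2 < q"
  shows "int (card (centralizer ` noninvol)) = int q ^ 4 + int q ^ 3 - int q ^ 2 + int q - 1"
proof -
  have fin': "finite (centralizer ` order_four)" "finite (centralizer ` fix2)" "finite nonsplit"
    using finite_types by (auto simp: nonsplit_def order_four_def)
  have 1: "centralizer ` fix2 \<inter> nonsplit = {}" using centralizers_disjoint(2) by (auto simp: nonsplit_def)
  have 2: "centralizer ` order_four \<inter> (centralizer ` fix2 \<union> nonsplit) = {}"
    using centralizers_disjoint(1) unfolding nonsplit_def order_four_def by blast
  have "centralizer ` noninvol = centralizer ` order_four \<union> (centralizer ` fix2 \<union> nonsplit)"
    unfolding noninvol_eq nonsplit_def by (simp add: image_Un)
  then have "card (centralizer ` noninvol) = (q ^ 2 + 1) * (q - 1) + card split_tori + card nonsplit"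
    using fin' 1 2 card_fix2_centralizers(1)[OF q] card_order_four_centralizers by (simp add: card_Un_disjoint)
  moreover have "int (q - 1) = int q - 1" using q_ge_2 by (simp add: of_nat_diff)
  ultimately have "int (card (centralizer ` noninvol)) = (int q ^ 2 + 1) * (int q - 1) + int (card split_tori) + int (card nonsplit)"
    by (simp only: of_nat_mult of_nat_add of_nat_power of_nat_1)
  moreover have "2 * int (card split_tori) = int q ^ 2 * (int q ^ 2 + 1)"
    using arg_cong[OF card_split_tori[OF q], of int] by (simp add: distrib_left)
  ultimately have "2 * int (card (centralizer ` noninvol)) = 2 * (int q ^ 4 + int q ^ 3 - int q ^ 2 + int q - 1)"
    using card_nonsplit[OF q]
    by (simp add: algebra_simps power2_eq_square power3_eq_cube power4_eq_xxxx)
  then show ?thesis by simp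
qed

text \<open>For \<open>q = 2\<close> the group \<open>U\<close> has order four and coincides with the centralizer of an element of order four.\<close>

lemma point_nilpotent_q_2:
  assumes "q = 2" "V \<in> points" "1 \<le> c" shows "c_nilpotent_subgroup c G V"
proof -
  obtain g where g: "g \<in> carrier G" "V = conj_set g U" using assms(2) by (auto simp: conjugates_def)
  obtain u where u: "u \<in> U - Z" by (rule U_minus_Z)
  have "Z \<inter> (\<lambda>z. z \<otimes> u) ` Z = {}"
  proof (rule ccontr)
    assume "Z \<inter> (\<lambda>z. z \<otimes> u) ` Z \<noteq> {}"
    then obtain z where z: "z \<in> Z" "z \<otimes> u \<in> Z" by auto
    have "inv z \<otimes> (z \<otimes> u) \<in> Z" by (rule Z_closed(1)[OF Z_closed(2)[OF z(1)] z(2)])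
    moreover have "inv z \<otimes> (z \<otimes> u) = u" using u z(1) by (intro cancel_inv_left) auto
    ultimately show False using u by simp
  qed
  then have "card (centralizer u) = card U"
    unfolding centralizer_U[OF u] using coset_Z_card[of u] u assms(1) finite_subset[OF Z_subset_U finite_sub[OF U_sub]]
    by (simp add: card_Un_disjoint card_Z card_U)
  moreover have "centralizer u \<subseteq> U"
    using u Z_closed(3) by (intro centralizer_U_subset) auto
  ultimately have CU: "centralizer u = U" using finite_sub[OF U_sub] by (simp add: card_subset_eq)
  show ?thesis
  proof (rule nilpotent_if_commutative[OF point_subgroup[OF assms(2)] assms(3)])
    fix x y assume "x \<in> V" "y \<in> V"
    then obtain a b where ab: "a \<in> U" "b \<in> U" "x = conj_elt g a" "y = conj_elt g b"
      using g by (auto simp: conj_set_def)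
    have "a \<otimes> b = b \<otimes> a" using centralizer_U_commute[OF u] CU ab by simp
    then show "x \<otimes> y = y \<otimes> x" using ab g by (simp add: conj_elt_mult[symmetric])
  qed
qed

theorem minimal_cover_exists:
  assumes "1 \<le> c" shows "\<exists>\<N>. c_nilpotent_cover c G \<N> \<and> two_minimal c G \<N>"
proof -
  have "c = 1 \<or> 2 \<le> c" using assms by (cases c) (auto simp: one_enat_def numeral_eq_enat)
  then consider "c = 1" | "2 \<le> c" by blast
  then show ?thesis
    using centralizer_cover piece_cover[OF assms point_nilpotent] by cases blast+
qed

theorem omega_large:
  assumes "2 < q"
  shows "2 \<le> c \<Longrightarrow> int (omega_nilp c G) = int q ^ 4 + int q ^ 2 + 1"
    and "int (omega_nilp 1 G) = int q ^ 4 + int q ^ 3 - int q ^ 2 + int q - 1"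
proof -
  show "int (omega_nilp 1 G) = int q ^ 4 + int q ^ 3 - int q ^ 2 + int q - 1"
    using centralizer_cover(3) omega_class_1[OF assms] by simp
  assume c: "2 \<le> c"
  moreover have "(1::enat) \<le> 2" by simp
  ultimately have "1 \<le> c" by (rule order_trans[rotated])
  then show "int (omega_nilp c G) = int q ^ 4 + int q ^ 2 + 1"
    using piece_cover(3)[OF _ point_nilpotent[OF _ c]] omega_class_2[OF assms] by simp
qed

theorem omega_small: "q = 2 \<Longrightarrow> 1 \<le> c \<Longrightarrow> omega_nilp c G = 6"
  using piece_cover(3)[OF _ point_nilpotent_q_2] omega_q_2 by simp

end

section \<open>Finite fields of characteristic two\<close>

lemma char2_add_cancel:
  fixes x y :: "'a::field"
  assumes "(2::'a) = 0"
  shows "x + x = 0" "x + (x + y) = y" "- x = x" "x - y = x + y"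
proof -
  show 1: "x + x = 0" for x :: 'a using assms by (metis mult_2 mult_zero_left)
  show "x + (x + y) = y" using 1[of x] by (simp add: add.assoc[symmetric])
  show 2: "- x = x" for x :: 'a using 1[of x] by (simp add: minus_unique)
  show "x - y = x + y" using 2[of y] by (simp add: diff_conv_add_uminus del: add_uminus_conv_diff)
qed

lemma finite_field_power_CARD:
  fixes x :: "'a::{field,finite}"
  shows "x ^ CARD('a) = x"
proof (cases "x = 0")
  case False
  have "(\<Prod>y\<in>UNIV-{0}. x * y) = (\<Prod>y\<in>UNIV-{0::'a}. y)"
    by (rule prod.reindex_bij_witness[of _ "\<lambda>y. y / x" "\<lambda>y. x * y"]) (use False in auto)
  hence "x ^ (CARD('a) - 1) * \<Prod>(UNIV-{0}) = 1 * \<Prod>(UNIV-{0::'a})"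
    by (simp add: prod.distrib)
  moreover have "\<Prod>(UNIV-{0::'a}) \<noteq> 0" by simp
  ultimately have "x ^ (CARD('a) - 1) = 1" by (metis mult_right_cancel)
  moreover have "CARD('a) = Suc (CARD('a) - 1)" by (simp add: card_gt_0_iff)
  ultimately show ?thesis by (metis mult.right_neutral power_Suc)
qed (simp add: card_gt_0_iff)

lemma two_eq_zero_if_CARD_power_two:
  assumes "CARD('a::{field,finite}) = 2 ^ k"
  shows "(2::'a) = 0"
proof -
  have "(\<Sum>x\<in>UNIV. x + 1) = (\<Sum>x\<in>(UNIV::'a set). x)"
    by (rule sum.reindex_bij_witness[of _ "\<lambda>y. y - 1" "\<lambda>y. y + 1"]) auto
  hence "of_nat CARD('a) = (0::'a)" by (simp add: sum.distrib)
  thus ?thesis by (simp add: assms)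
qed

text \<open>The field with \<open>q\<close> elements together with the endomorphism \<open>t\<close> whose square is the Frobenius map.\<close>

locale suzuki_field =
  fixes m :: nat and t :: "'a::{field,finite} \<Rightarrow> 'a"
  assumes card_field: "CARD('a) = 2 ^ (2 * m + 1)"
  defines "t \<equiv> suz_twist m"
begin

lemma two_zero: "(2::'a) = 0"
  by (rule two_eq_zero_if_CARD_power_two[OF card_field])

lemma numeral_char2: "numeral (num.Bit0 k) = (0::'a)" "numeral (num.Bit1 k) = (1::'a)"
proof -
  show *: "numeral (num.Bit0 k) = (0::'a)"
    unfolding numeral_Bit0 by (rule char2_add_cancel[OF two_zero])
  show "numeral (num.Bit1 k) = (1::'a)" using * unfolding numeral_Bit1 numeral_Bit0 by simp
qed

lemmas char2 = char2_add_cancel[OF two_zero] numeral_char2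

lemma t_mult: "t (x * y) = t x * t y"
  by (simp add: t_def suz_twist_def power_mult_distrib)

lemma t_add: "t (x + y) = t x + t y"
proof -
  have "(x + y) ^ (2 ^ k) = x ^ (2 ^ k) + y ^ (2 ^ k)" for k
  proof (induction k)
    case (Suc k)
    have "(x + y) ^ 2 ^ Suc k = (x ^ 2 ^ k + y ^ 2 ^ k) ^ 2"
      by (simp add: power_mult[symmetric] mult.commute Suc[symmetric])
    also have "\<dots> = (x ^ 2 ^ k) ^ 2 + (y ^ 2 ^ k) ^ 2" by (simp add: power2_sum two_zero)
    finally show ?case by (simp add: power_mult[symmetric] mult.commute)
  qed simp
  thus ?thesis by (simp only: t_def suz_twist_def)
qed

lemma t_0 [simp]: "t 0 = 0" and t_1 [simp]: "t 1 = 1"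
  by (simp_all add: t_def suz_twist_def)

lemma t_inverse: "t (inverse x) = inverse (t x)"
  by (simp add: t_def suz_twist_def power_inverse)

lemma t_divide: "t (x / y) = t x / t y"
  by (simp add: divide_inverse t_mult t_inverse)

lemma t_eq_0 [simp]: "t x = 0 \<longleftrightarrow> x = 0"
  by (simp add: t_def suz_twist_def)

lemma t_t: "t (t x) = x * x"
proof -
  have *: "(2::nat) ^ (m + 1) * 2 ^ (m + 1) = CARD('a) * 2"
    unfolding card_field by (simp add: power_add[symmetric])
  have "t (t x) = x ^ (2 ^ (m + 1) * 2 ^ (m + 1))"
    by (simp only: t_def suz_twist_def power_mult)
  also have "\<dots> = (x ^ CARD('a)) ^ 2" by (simp only: * power_mult)
  finally show ?thesis by (simp add: finite_field_power_CARD power2_eq_square)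
qed

lemma t_eq_iff [simp]: "t x = t y \<longleftrightarrow> x = y"
proof
  assume "t x = t y"
  hence "t (x + y) = 0" by (simp add: t_add char2)
  hence "x + y = 0" by simp
  thus "x = y" by (metis char2(2) add.right_neutral)
qed simp

lemma surj_t: "\<exists>y. t y = x"
  using finite_UNIV_inj_surj[of t] by (metis inj_def t_eq_iff surj_def finite)

lemma t_fixed: "t x = x \<longleftrightarrow> x = 0 \<or> x = 1"
  using t_t[of x] by (metis mult_cancel_right1 t_0 t_1)

lemma mult_t_eq_1: "x * t x = 1 \<Longrightarrow> x = 1"
proof -
  assume *: "x * t x = 1"
  have "t x * (x * x) = 1" using arg_cong[OF *, of t] by (simp add: t_mult t_t)
  with * show "x = 1" by (simp add: mult.assoc[symmetric] mult.commute)
qed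

text \<open>The lower left entry of \<open>suz_S m a b\<close>.  That it vanishes only for \<open>a = b = 0\<close> means that a
tangent plane of the ovoid of points \<open>(1, a, b, N a b)\<close> meets the ovoid in a single point.\<close>

definition N where "N a b = a * a * t a + a * b + t b"

text \<open>For \<open>a \<noteq> 0\<close> and \<open>b = a t(a) c\<close> the value is \<open>a\<^sup>2 t(a) (1 + c + t(c))\<close>.  Adding \<open>1 + c + t(c) = 0\<close> to its image
under \<open>t\<close> gives \<open>c + c\<^sup>2 = 0\<close>, so \<open>c\<close> is \<open>0\<close> or \<open>1\<close>, which contradicts the equation.\<close>

lemma N_eq_0_iff: "N a b = 0 \<longleftrightarrow> a = 0 \<and> b = 0"
proof
  assume 0: "N a b = 0"
  show "a = 0 \<and> b = 0"
  proof (cases "a = 0")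
    case True with 0 show ?thesis by (simp add: N_def)
  next
    case False
    define c where "c = b / (a * t a)"
    have b: "b = a * t a * c" using False by (simp add: c_def)
    have "a * a * t a * (1 + c + t c) = 0"
      using 0 unfolding N_def b by (simp add: t_mult t_t algebra_simps)
    hence 1: "1 + c + t c = 0" using False by simp
    have "t (1 + c + t c) = 0" using 1 by simp
    hence 2: "1 + t c + c * c = 0" by (simp add: t_add t_t)
    have "(1 + c + t c) + (1 + t c + c * c) = c + c * c" by (simp add: char2 ac_simps)
    hence "c + c * c = 0" using 1 2 by simp
    hence "c * (1 + c) = 0" by (simp add: algebra_simps)
    hence "c = 0 \<or> c = 1" using char2(2)[of 1 c] char2(3)[of 1] by (auto simp: add_eq_0_iff)
    with 1 show ?thesis by (auto simp: char2)
  qed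
qed (simp add: N_def)

section \<open>The matrices of the Suzuki group\<close>

abbreviation S where "S \<equiv> suz_S m :: 'a \<Rightarrow> 'a \<Rightarrow> 'a^4^4"
abbreviation T where "T \<equiv> suz_T :: 'a^4^4"

text \<open>The diagonal matrices \<open>suz_M m l\<close>, parametrised by their first diagonal entry \<open>k\<close> instead of \<open>l\<close>.  Since
\<open>k = l\<^sup>1\<^sup>+\<^sup>s\<close> with \<open>s = 2\<^sup>m\<close> implies \<open>l = k\<^sup>2 / t(k)\<close>, this is only a change of
parameter, and it lets all entries be expressed by \<open>k\<close> and \<open>t(k)\<close>.\<close>

definition D :: "'a \<Rightarrow> 'a^4^4" where
  "D k = vector [vector [k, 0, 0, 0], vector [0, t k / k, 0, 0],
                 vector [0, 0, k / t k, 0], vector [0, 0, 0, 1 / k]]"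

lemma S_def: "S a b = vector [vector [1, 0, 0, 0], vector [a, 1, 0, 0],
    vector [b, t a, 1, 0], vector [N a b, a * t a + b, a, 1]]"
  by (simp add: suz_S_def Let_def N_def t_def power2_eq_square)

lemma vector_4:
  "(vector [x,y,z,w] :: 'b::zero^4) $ 1 = x" "(vector [x,y,z,w] :: 'b::zero^4) $ 2 = y"
  "(vector [x,y,z,w] :: 'b::zero^4) $ 3 = z" "(vector [x,y,z,w] :: 'b::zero^4) $ 4 = w"
  unfolding vector_def by simp_all

lemmas mat4 = vec_eq_iff forall_4 matrix_matrix_mult_def sum_4 vector_4 mat_def

lemma S_mult: "S a b ** S c d = S (a + c) (b + d + t a * c)"
  unfolding S_def
  by (simp add: mat4 N_def t_add t_mult t_t algebra_simps char2)

lemma T_T: "T ** T = mat 1"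
  unfolding suz_T_def by (simp add: mat4)

lemma D_mult: "D k ** D l = D (k * l)"
  unfolding D_def by (simp add: mat4 t_mult)

lemma S_0: "S 0 0 = mat 1" unfolding S_def by (simp add: mat4 N_def)
lemma D_1: "D 1 = mat 1" unfolding D_def by (simp add: mat4)

lemma suz_M_eq_D:
  assumes "l \<noteq> 0" shows "suz_M m l = D (l ^ (1 + 2 ^ m))"
proof -
  have "t (l ^ (2 ^ m)) = l ^ (2 ^ m * 2 ^ (m + 1))"
    by (simp only: t_def suz_twist_def power_mult)
  also have "(2::nat) ^ m * 2 ^ (m + 1) = CARD('a)" unfolding card_field power_add[symmetric] by (rule arg_cong[of _ _ "(^) 2"]) simp
  also have "l ^ CARD('a) = l" by (rule finite_field_power_CARD)
  finally have "t (l ^ (2 ^ m)) = l" .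
  moreover have "t l = (l ^ 2 ^ m) * (l ^ 2 ^ m)"
    by (simp add: t_def suz_twist_def power_add[symmetric] mult_2)
  ultimately have "t (l ^ (1 + 2 ^ m)) = l ^ (1 + 2 ^ m) * l ^ (2 ^ m)"
    by (simp add: t_mult)
  with assms show ?thesis unfolding suz_M_def D_def
    by (simp add: mat4 power_inverse divide_simps)
qed

lemma D_eq_suz_M: "k \<noteq> 0 \<Longrightarrow> \<exists>l. l \<noteq> 0 \<and> D k = suz_M m l"
proof -
  assume k: "k \<noteq> 0"
  define l where "l = k * k / t k"
  have "l ^ (2 ^ m) = t k / k"
  proof -
    have "k * k = t (t k)" by (simp add: t_t)
    hence "l = t (t k / k)" by (simp add: l_def t_divide)
    hence "l ^ (2 ^ m) = (t k / k) ^ (2 ^ (m + 1) * 2 ^ m)" by (simp add: t_def suz_twist_def power_mult)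
    also have "(2::nat) ^ (m + 1) * 2 ^ m = CARD('a)" unfolding card_field power_add[symmetric] by (rule arg_cong[of _ _ "(^) 2"]) simp
    finally show ?thesis by (simp add: finite_field_power_CARD)
  qed
  hence "l ^ (1 + 2 ^ m) = k" using k by (simp add: l_def)
  moreover have "l \<noteq> 0" using k by (simp add: l_def)
  ultimately show ?thesis using suz_M_eq_D by metis
qed

lemma T_D_T: "k \<noteq> 0 \<Longrightarrow> T ** D k ** T = D (1 / k)"
  unfolding D_def suz_T_def by (simp add: mat4 t_divide)

lemma D_S: "k \<noteq> 0 \<Longrightarrow> D k ** S a b = S (t k / (k * k) * a) (b / t k) ** D k"
  unfolding D_def S_def by (simp add: mat4 N_def t_divide t_mult t_t divide_simps)

text \<open>The Bruhat decomposition of \<open>T S T\<close>.  The parameters on the right are forced by the first column and the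
first row of the product.\<close>

lemma T_S_T:
  assumes "a \<noteq> 0 \<or> b \<noteq> 0"
  defines "n \<equiv> N a b"
  defines "e \<equiv> (a * t a + b) / n"
  shows "T ** S a b ** T = S (b / n) (a / n) ** D n ** T ** S e (e * t e + a / n)"
proof -
  have n0: "n \<noteq> 0" using assms by (simp add: N_eq_0_iff n_def)
  hence n'0: "t n \<noteq> 0" by simp
  obtain A B n' where A: "A = t a" and B: "B = t b" and n': "n' = t n" by blast
  have n: "n = a * a * A + a * b + B" by (simp add: n_def N_def A B)
  have n'_eq: "n' = A * A * (a * a) + A * B + b * b"
    by (simp add: n' n t_add t_mult A B t_t)
  have te: "t e = (A * (a * a) + B) / n'" by (simp add: e_def t_divide t_add t_mult t_t A B n')
  have n'0: "n' \<noteq> 0" using n0 n' by simp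
  have 1: "N (b / n) (a / n) = 1 / n"
  proof -
    have "N (b / n) (a / n) = b * b * B / (n * n * n') + a * b / (n * n) + A / n'"
      by (simp add: N_def t_divide A B n' mult.commute)
    also have "\<dots> = (b * b * B + a * b * n' + A * n * n) / (n * n * n')"
      using n0 n'0 by (simp add: divide_simps algebra_simps)
    also have "b * b * B + a * b * n' + A * n * n = n * n'"
      unfolding n n'_eq by (simp add: algebra_simps char2)
    finally show ?thesis using n0 n'0 by (simp add: divide_simps)
  qed
  have 2: "N e (e * t e + a / n) = 1 / n"
  proof -
    define E where "E = a * A + b"
    define E' where "E' = A * (a * a) + B"
    have tf: "t (e * t e + a / n) = t e * (e * e) + A / n'"
      by (simp add: t_add t_mult t_t t_divide A n')
    have "N e (e * t e + a / n) = e * e * t e + e * a / n + A / n'"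
      unfolding N_def tf by (simp add: algebra_simps char2)
    also have "\<dots> = E * E * E' / (n * n * n') + E * a / (n * n) + A / n'"
      unfolding te by (simp add: e_def A E_def E'_def)
    also have "\<dots> = (E * E * E' + E * a * n' + A * n * n) / (n * n * n')"
      using n0 n'0 by (simp add: divide_simps algebra_simps)
    also have "E * E * E' + E * a * n' + A * n * n = n * n'"
      unfolding n n'_eq E_def E'_def by (simp add: algebra_simps char2)
    finally show ?thesis using n0 n'0 by (simp add: divide_simps)
  qed
  have 3: "t (b / n) = B / n'" by (simp add: t_divide B n')
  show ?thesis
    unfolding S_def 1 2 D_def suz_T_def 
    by (simp add: mat4 3 te n'[symmetric] A[symmetric] B[symmetric] n_def[symmetric],
        simp add: e_def A[symmetric], simp add: divide_simps n0 n'0,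
        simp add: n n'_eq algebra_simps char2)
qed

text \<open>The characteristic polynomial of \<open>T S\<close> is palindromic and, by the self-duality of the group
under \<open>t\<close>, its middle coefficient is \<open>t\<close> applied to the trace.  The relation is checked in the form
\<open>X\<^sup>2 = s X + t(s) + s X\<^sup>-\<^sup>1 + X\<^sup>-\<^sup>2\<close>, which keeps the degrees of the entries small.\<close>

lemma char_poly_T_S:
  fixes a b
  defines "s \<equiv> N a b + t a" and "X \<equiv> (*v) (T ** S a b)"
  shows "X (X (X (X v))) = s *s X (X (X v)) + t s *s X (X v) + s *s X v + v"
proof -
  obtain A B where A: "A = t a" and B: "B = t b" by blast
  define Y where "Y = (*v) (S a (b + a * A) ** T)"
  have "S a (b + a * A) ** S a b = mat 1"
    unfolding S_mult by (simp add: A char2 S_0[symmetric] algebra_simps)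
  hence "S a (b + a * A) ** T ** (T ** S a b) = mat 1"
    by (metis T_T matrix_mul_assoc matrix_mul_lid)
  hence YX: "Y (X v) = v" for v unfolding X_def Y_def by (simp add: matrix_vector_mul_assoc)
  have N: "N a b = a * a * A + a * b + B" "N a (b + a * A) = a * a * A + a * b + B"
    by (simp_all add: N_def A B t_add t_mult t_t char2 algebra_simps)
  have s: "s = a * a * A + a * b + B + A" by (simp add: s_def N A)
  have ts: "t s = A * A * (a * a) + A * B + b * b + a * a"
    by (simp add: s t_add t_mult A B t_t)
  have "X (X v) = s *s X v + t s *s v + s *s Y v + Y (Y v)" for v
    unfolding X_def Y_def matrix_vector_mul_assoc[symmetric] ts S_def N A[symmetric] suz_T_def
    by (simp add: vec_eq_iff forall_4 matrix_vector_mult_def sum_4 vector_4,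
        simp add: s algebra_simps char2)
  from this[of "X (X v)"] show ?thesis by (simp add: YX)
qed

end

section \<open>The Suzuki group satisfies the axioms\<close>

lemma GL4_simps [simp]:
  "carrier GL4 = {A. invertible A}" "mult GL4 = (**)" "one GL4 = mat 1"
  by (simp_all add: GL4_def)

lemma GL4_group: "group (GL4 :: ('a::field ^ 4 ^ 4) monoid)"
proof (rule groupI)
  fix A :: "'a ^ 4 ^ 4" assume "A \<in> carrier GL4"
  then obtain B where B: "A ** B = mat 1" "B ** A = mat 1" by (auto simp: invertible_def)
  then show "\<exists>B\<in>carrier GL4. B \<otimes>\<^bsub>GL4\<^esub> A = \<one>\<^bsub>GL4\<^esub>"
    by (intro bexI[of _ B]) (auto simp: invertible_def)
next
  show "\<one>\<^bsub>GL4\<^esub> \<in> carrier (GL4 :: ('a ^ 4 ^ 4) monoid)"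
    by (simp add: invertible_def exI[of _ "mat 1"])
qed (simp_all add: matrix_mul_assoc invertible_mult)

text \<open>Reduction of the \<open>n\<close>-th power modulo a quartic polynomial.  The quantifier order matters: the
coefficients of the remainder serve all maps \<open>X\<close> that satisfy the same relation.\<close>

lemma funpow_recurrence:
  fixes s s' :: "'a::field"
  shows "\<exists>r0 r1 r2 r3. \<forall>X :: 'a^'n \<Rightarrow> 'a^'n.
    (\<forall>v. X (X (X (X v))) = s *s X (X (X v)) + s' *s X (X v) + s *s X v + v) \<longrightarrow>
    (\<forall>v. (X ^^ n) v = r0 *s v + r1 *s X v + r2 *s X (X v) + r3 *s X (X (X v)))"
proof (induction n)
  case 0
  show ?case by (intro exI[of _ 1] exI[of _ 0]) simp
next
  case (Suc n)
  then obtain r0 r1 r2 r3 where r: "\<And>X :: 'a^'n \<Rightarrow> 'a^'n. \<And>v.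
    (\<And>v. X (X (X (X v))) = s *s X (X (X v)) + s' *s X (X v) + s *s X v + v) \<Longrightarrow>
    (X ^^ n) v = r0 *s v + r1 *s X v + r2 *s X (X v) + r3 *s X (X (X v))"
    by metis
  show ?case
  proof (intro exI allI impI)
    fix X :: "'a^'n \<Rightarrow> 'a^'n" and v
    assume X: "\<forall>v. X (X (X (X v))) = s *s X (X (X v)) + s' *s X (X v) + s *s X v + v"
    have "(X ^^ Suc n) v = (X ^^ n) (X v)" by (simp add: funpow_swap1)
    also have "\<dots> = r0 *s X v + r1 *s X (X v) + r2 *s X (X (X v)) + r3 *s X (X (X (X v)))"
      using r[of X] X by blast
    also have "\<dots> = r3 *s v + (r0 + r3 * s) *s X v + (r1 + r3 * s') *s X (X v) + (r2 + r3 * s) *s X (X (X v))"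
      using X by (simp add: vec.scale_right_distrib vec.scale_left_distrib algebra_simps)
    finally show "(X ^^ Suc n) v = r3 *s v + (r0 + r3 * s) *s X v + (r1 + r3 * s') *s X (X v) + (r2 + r3 * s) *s X (X (X v))" .
  qed
qed

context suzuki_field
begin

abbreviation G :: "('a^4^4) monoid" where "G \<equiv> suzuki_group m"
definition Us where "Us = range (\<lambda>(a, b). S a b)"
definition Zs where "Zs = range (\<lambda>b. S 0 b)"
definition Hs where "Hs = D ` (UNIV - {0})"

lemma S_Us [simp]: "S a b \<in> Us" and S_Zs [simp]: "S 0 b \<in> Zs" and D_Hs [simp]: "k \<noteq> 0 \<Longrightarrow> D k \<in> Hs"
  by (auto simp: Us_def Zs_def Hs_def)

lemma Us_E: assumes "x \<in> Us" obtains a b where "x = S a b" using assms by (auto simp: Us_def)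
lemma Zs_E: assumes "x \<in> Zs" obtains b where "x = S 0 b" using assms by (auto simp: Zs_def)
lemma Hs_E: assumes "x \<in> Hs" obtains k where "k \<noteq> 0" "x = D k" using assms by (auto simp: Hs_def)

lemma S_inj: "S a b = S c d \<longleftrightarrow> a = c \<and> b = d"
proof
  assume "S a b = S c d"
  then have "S a b $ 2 $ 1 = S c d $ 2 $ 1" "S a b $ 3 $ 1 = S c d $ 3 $ 1" by simp_all
  then show "a = c \<and> b = d" by (simp add: S_def vector_4)
qed simp

lemma D_inj: "D k = D l \<longleftrightarrow> k = l"
proof
  assume "D k = D l"
  then have "D k $ 1 $ 1 = D l $ 1 $ 1" by simp
  then show "k = l" by (simp add: D_def vector_4)
qed simp

lemma S_inverse: "S a (b + t a * a) ** S a b = mat 1" "S a b ** S a (b + t a * a) = mat 1"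
  by (simp_all add: S_mult char2 S_0[symmetric] add.commute)

lemma D_inverse: "k \<noteq> 0 \<Longrightarrow> D (1 / k) ** D k = mat 1" "k \<noteq> 0 \<Longrightarrow> D k ** D (1 / k) = mat 1"
  by (simp_all add: D_mult D_1)

lemma S_invertible: "invertible (S a b)" unfolding invertible_def using S_inverse by blast
lemma D_invertible: "k \<noteq> 0 \<Longrightarrow> invertible (D k)" unfolding invertible_def using D_inverse by blast
lemma T_invertible: "invertible T" unfolding invertible_def using T_T by blast

lemma generators: "{suz_S m a b |a b. True} \<union> {suz_M m l |l. l \<noteq> 0} \<union> {suz_T} = Us \<union> Hs \<union> {T}"
proof -
  have "{suz_M m l |l. l \<noteq> 0} = Hs"
    unfolding Hs_def using suz_M_eq_D D_eq_suz_M by (fastforce simp: image_iff)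
  then show ?thesis unfolding Us_def by auto
qed

lemma gen_subset: "Us \<union> Hs \<union> {T} \<subseteq> carrier GL4"
  using S_invertible D_invertible T_invertible by (auto simp: Us_def Hs_def)

lemma carrier_G: "carrier G = generate GL4 (Us \<union> Hs \<union> {T})"
  unfolding suzuki_group_def generators by simp

lemma G_simps [simp]: "x \<otimes>\<^bsub>G\<^esub> y = x ** y" "\<one>\<^bsub>G\<^esub> = mat 1"
  by (simp_all add: suzuki_group_def)

lemma G_group: "group G"
proof -
  interpret GL: group "GL4 :: ('a^4^4) monoid" by (rule GL4_group)
  have "group (GL4\<lparr>carrier := generate GL4 (Us \<union> Hs \<union> {T})\<rparr>)"
    using GL.generate_is_subgroup[OF gen_subset] GL4_group by (rule subgroup.subgroup_is_group)
  then show ?thesis unfolding suzuki_group_def generators .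
qed

sublocale G: group G by (rule G_group)

lemma in_G: "x \<in> Us \<union> Hs \<union> {T} \<Longrightarrow> x \<in> carrier G"
  unfolding carrier_G by (rule generate.incl)
lemma S_G [simp]: "S a b \<in> carrier G" by (rule in_G) (auto simp: Us_def)
lemma D_G [simp]: "k \<noteq> 0 \<Longrightarrow> D k \<in> carrier G" by (rule in_G) (auto simp: Hs_def)
lemma T_G [simp]: "T \<in> carrier G" by (rule in_G) simp

lemma inv_S: "inv\<^bsub>G\<^esub> (S a b) = S a (b + t a * a)"
  using G.inv_equality[of "S a (b + t a * a)" "S a b"] S_inverse by simp
lemma inv_D: "k \<noteq> 0 \<Longrightarrow> inv\<^bsub>G\<^esub> (D k) = D (1 / k)"
  using G.inv_equality[of "D (1 / k)" "D k"] D_inverse by simp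

lemma D_T: "k \<noteq> 0 \<Longrightarrow> D k ** T = T ** D (1 / k)"
  using T_D_T[of k] T_T by (metis matrix_mul_assoc matrix_mul_lid)

text \<open>The union of the two Bruhat cells.  It contains the generators and is closed under multiplication,
so it contains the group generated by them.\<close>

definition cells where
  "cells = {S a b ** D k |a b k. k \<noteq> 0} \<union> {S a b ** T ** (S c d ** D k) |a b c d k. k \<noteq> 0}"

lemma cells_S: "x \<in> cells \<Longrightarrow> S a b ** x \<in> cells"
proof -
  assume "x \<in> cells"
  then consider c d k where "k \<noteq> 0" "x = S c d ** D k"
    | c d e f k where "k \<noteq> 0" "x = S c d ** T ** (S e f ** D k)" by (auto simp: cells_def)
  then show ?thesis
  proof cases
    case 1
    then have "S a b ** x = S (a + c) (b + d + t a * c) ** D k" by (simp add: matrix_mul_assoc S_mult)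
    then show ?thesis using 1 by (auto simp: cells_def)
  next
    case 2
    then have "S a b ** x = S (a + c) (b + d + t a * c) ** T ** (S e f ** D k)"
      by (simp add: matrix_mul_assoc S_mult)
    then show ?thesis using 2 unfolding cells_def by blast
  qed
qed

lemma D_S_D: "l \<noteq> 0 \<Longrightarrow> D l ** (S a b ** D k) = S (t l / (l * l) * a) (b / t l) ** D (l * k)"
proof -
  assume l: "l \<noteq> 0"
  have "D l ** (S a b ** D k) = D l ** S a b ** D k" by (simp only: matrix_mul_assoc)
  also have "\<dots> = S (t l / (l * l) * a) (b / t l) ** (D l ** D k)"
    by (simp only: D_S[OF l] matrix_mul_assoc[symmetric])
  finally show ?thesis by (simp only: D_mult)
qed

lemma cells_D: "x \<in> cells \<Longrightarrow> l \<noteq> 0 \<Longrightarrow> D l ** x \<in> cells"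
proof -
  assume l: "l \<noteq> 0" and "x \<in> cells"
  then consider c d k where "k \<noteq> 0" "x = S c d ** D k"
    | c d e f k where "k \<noteq> 0" "x = S c d ** T ** (S e f ** D k)" by (auto simp: cells_def)
  then show ?thesis
  proof cases
    case 1
    then have "D l ** x = S (t l / (l * l) * c) (d / t l) ** D (l * k)" using l by (simp add: D_S_D)
    moreover have "l * k \<noteq> 0" using 1 l by simp
    ultimately show ?thesis unfolding cells_def by blast
  next
    case 2
    have "D l ** x = D l ** S c d ** T ** (S e f ** D k)" using 2 by (simp only: matrix_mul_assoc)
    also have "\<dots> = S (t l / (l * l) * c) (d / t l) ** (D l ** T) ** (S e f ** D k)"
      by (simp only: D_S[OF l] matrix_mul_assoc)
    also have "\<dots> = S (t l / (l * l) * c) (d / t l) ** T ** (D (1 / l) ** (S e f ** D k))"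
      by (simp only: D_T[OF l] matrix_mul_assoc)
    also have "D (1 / l) ** (S e f ** D k) = S (t (1 / l) / (1 / l * (1 / l)) * e) (f / t (1 / l)) ** D (1 / l * k)"
      using l by (intro D_S_D) simp
    finally have *: "D l ** x = S (t l / (l * l) * c) (d / t l) ** T **
        (S (t (1 / l) / (1 / l * (1 / l)) * e) (f / t (1 / l)) ** D (1 / l * k))" .
    moreover have "1 / l * k \<noteq> 0" using 2 l by simp
    ultimately show ?thesis unfolding cells_def by blast
  qed
qed

lemma cells_T_S: "k \<noteq> 0 \<Longrightarrow> T ** (S c d ** D k) \<in> cells"
proof -
  assume k: "k \<noteq> 0"
  have "T ** (S c d ** D k) = S 0 0 ** T ** (S c d ** D k)" by (simp add: S_0)
  then show ?thesis using k unfolding cells_def by blast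
qed

lemma cells_T: "x \<in> cells \<Longrightarrow> T ** x \<in> cells"
proof -
  assume "x \<in> cells"
  then consider c d k where "k \<noteq> 0" "x = S c d ** D k"
    | c d e f k where "k \<noteq> 0" "x = S c d ** T ** (S e f ** D k)" by (auto simp: cells_def)
  then show ?thesis
  proof cases
    case 1
    then show ?thesis using cells_T_S by simp
  next
    case 2
    show ?thesis
    proof (cases "c = 0 \<and> d = 0")
      case True
      then have "T ** x = S e f ** D k" using 2 T_T by (simp add: S_0 matrix_mul_assoc)
      then show ?thesis using 2 by (auto simp: cells_def)
    next
      case False
      then obtain a' b' n e' f' where n: "n \<noteq> 0" "T ** S c d ** T = S a' b' ** D n ** T ** S e' f'"
        using T_S_T[of c d] N_eq_0_iff[of c d] by blast
      have "T ** x = S a' b' ** (D n ** (T ** (S (e' + e) (f' + f + t e' * e) ** D k)))"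
        using n 2 by (simp add: matrix_mul_assoc S_mult flip: S_mult)
      then show ?thesis using cells_T_S cells_D cells_S n 2 by simp
    qed
  qed
qed

lemma cells_mult: "x \<in> cells \<Longrightarrow> y \<in> cells \<Longrightarrow> x ** y \<in> cells"
proof -
  assume y: "y \<in> cells" and "x \<in> cells"
  then consider c d k where "k \<noteq> 0" "x = S c d ** D k"
    | c d e f k where "k \<noteq> 0" "x = S c d ** T ** (S e f ** D k)" by (auto simp: cells_def)
  then show ?thesis
    using y cells_S cells_D cells_T by cases (simp_all add: matrix_mul_assoc[symmetric])
qed

lemma cells_gen: "S a b \<in> cells" "k \<noteq> 0 \<Longrightarrow> D k \<in> cells" "T \<in> cells"
proof -
  have 1: "S a b ** D k \<in> cells" if "k \<noteq> 0" for a b k using that by (auto simp: cells_def)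
  show "S a b \<in> cells" using 1[of 1 a b] by (simp add: D_1)
  show "k \<noteq> 0 \<Longrightarrow> D k \<in> cells" using 1[of k 0 0] by (simp add: S_0)
  show "T \<in> cells" using cells_T_S[of 1 0 0] by (simp add: S_0 D_1)
qed

lemma carrier_cells: "carrier G \<subseteq> cells"
proof
  interpret GL: group "GL4 :: ('a^4^4) monoid" by (rule GL4_group)
  fix x assume "x \<in> carrier G"
  then have "x \<in> generate GL4 (Us \<union> Hs \<union> {T})" by (simp add: carrier_G)
  then show "x \<in> cells"
  proof induction
    case one
    then show ?case using cells_gen(1)[of 0 0] by (simp add: S_0)
  next
    case (incl h)
    then show ?case using cells_gen by (auto simp: Us_def Hs_def)
  next
    case (inv h)
    have S: "inv\<^bsub>GL4\<^esub> (S a b) = S a (b + t a * a)" for a b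
      by (rule GL.inv_equality) (simp_all add: S_inverse S_invertible)
    have D: "inv\<^bsub>GL4\<^esub> (D k) = D (1 / k)" if "k \<noteq> 0" for k
      by (rule GL.inv_equality) (simp_all add: that D_inverse D_invertible)
    have T: "inv\<^bsub>GL4\<^esub> T = T"
      by (rule GL.inv_equality) (simp_all add: T_T T_invertible)
    consider a b where "h = S a b" | k where "k \<noteq> 0" "h = D k" | "h = T"
      using inv by (auto simp: Us_def Hs_def)
    then show ?case by cases (simp_all add: S D T cells_gen)
  next
    case (eng h1 h2)
    then show ?case using cells_mult by simp
  qed
qed

lemma pow_funpow: "x \<in> carrier G \<Longrightarrow> (x [^]\<^bsub>G\<^esub> n) *v v = (((*v) x) ^^ n) v"
  by (induction n arbitrary: v) (simp_all add: matrix_vector_mul_assoc[symmetric] funpow_swap1)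

lemma pow_eq_one_iff: "x \<in> carrier G \<Longrightarrow> x [^]\<^bsub>G\<^esub> n = mat 1 \<longleftrightarrow> (\<forall>v. (((*v) x) ^^ n) v = v)"
  by (simp add: matrix_eq pow_funpow)

text \<open>Let \<open>s\<close> be the trace of \<open>T S\<close>.  For \<open>s = 0\<close> the relation reads \<open>X\<^sup>4 = 1\<close>.  Otherwise \<open>T z\<close> with
\<open>z = suz_S m 0 c\<close> and \<open>t(c) = s\<close> has the same trace, and the last unit vector \<open>e\<close> is cyclic for it.  Hence if \<open>(T z)\<^sup>n\<close> fixes \<open>e\<close>, the
remainder of \<open>X\<^sup>n\<close> modulo the common polynomial is \<open>1\<close>.\<close>

lemma trace_axiom:
  "(T ** S a b) [^]\<^bsub>G\<^esub> (4::nat) = mat 1 \<or>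
   (\<exists>z\<in>Zs. z \<noteq> mat 1 \<and> (\<forall>n::nat. (T ** z) [^]\<^bsub>G\<^esub> n = mat 1 \<longrightarrow> (T ** S a b) [^]\<^bsub>G\<^esub> n = mat 1))"
proof -
  define s where "s = N a b + t a"
  have TS: "T ** S c d \<in> carrier G" for c d using G.m_closed[of T "S c d"] by simp
  show ?thesis
  proof (cases "s = 0")
    case True
    have "(((*v) (T ** S a b)) ^^ 4) v = v" for v
      using char_poly_T_S[of a b v, folded s_def] True by (simp add: eval_nat_numeral)
    then show ?thesis using pow_eq_one_iff[OF TS] by blast
  next
    case False
    obtain c where c: "t c = s" using surj_t by blast
    then have c0: "c \<noteq> 0" using False by auto
    have s': "N 0 c + t 0 = s" using c by (simp add: N_def)
    have "S 0 c \<noteq> mat 1" using c0 S_inj[of 0 c 0 0] by (simp add: S_0)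
    moreover have "S 0 c \<in> Zs" by (auto simp: Zs_def)
    moreover have "(T ** S a b) [^]\<^bsub>G\<^esub> n = mat 1" if n: "(T ** S 0 c) [^]\<^bsub>G\<^esub> n = mat 1" for n :: nat
    proof -
      define X where "X = (*v) (T ** S 0 c)"
      define Y where "Y = (*v) (T ** S a b)"
      obtain r0 r1 r2 r3 where r: "\<And>X :: 'a^4 \<Rightarrow> 'a^4. \<And>v.
        (\<And>v. X (X (X (X v))) = s *s X (X (X v)) + t s *s X (X v) + s *s X v + v) \<Longrightarrow>
        (X ^^ n) v = r0 *s v + r1 *s X v + r2 *s X (X v) + r3 *s X (X (X v))"
        using funpow_recurrence[of s "t s" n, where 'n = 4] by metis
      define e :: "'a^4" where "e = vector [0, 0, 0, 1]"
      have X1: "X e = vector [1, 0, 0, 0]"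
        unfolding X_def e_def suz_T_def S_def matrix_vector_mul_assoc[symmetric]
        by (simp add: vec_eq_iff forall_4 matrix_vector_mult_def sum_4 vector_4)
      have X2: "X (X e) = vector [s, c, 0, 1]"
        unfolding X1 unfolding X_def suz_T_def S_def matrix_vector_mul_assoc[symmetric]
        by (simp add: vec_eq_iff forall_4 matrix_vector_mult_def sum_4 vector_4 N_def c)
      have X3: "X (X (X e)) = vector [s * s + c * c + 1, c * s, c, s]"
        unfolding X2 unfolding X_def suz_T_def S_def matrix_vector_mul_assoc[symmetric]
        by (simp add: vec_eq_iff forall_4 matrix_vector_mult_def sum_4 vector_4 N_def c)
      have "(X ^^ n) e = e" using n pow_eq_one_iff[OF TS] unfolding X_def by blast
      moreover have "(X ^^ n) e = r0 *s e + r1 *s X e + r2 *s X (X e) + r3 *s X (X (X e))"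
        unfolding X_def by (rule r[OF char_poly_T_S[of 0 c, unfolded s']])
      ultimately have "r0 *s e + r1 *s X e + r2 *s X (X e) + r3 *s X (X (X e)) = e" by simp
      then have "r3 * c = 0" "r2 * c + r3 * (c * s) = 0" "r1 + r2 * s + r3 * (s * s + c * c + 1) = 0"
        "r0 + r2 + r3 * s = 1"
        unfolding X3 unfolding X2 unfolding X1 unfolding e_def
        by (simp_all add: vec_eq_iff forall_4 vector_4)
      then have "r3 = 0" "r2 = 0" "r1 = 0" "r0 = 1" using c0 by auto
      moreover have "(Y ^^ n) v = r0 *s v + r1 *s Y v + r2 *s Y (Y v) + r3 *s Y (Y (Y v))" for v
        unfolding Y_def by (rule r[OF char_poly_T_S[of a b, folded s_def]])
      ultimately have "(Y ^^ n) v = v" for v by simp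
      then show ?thesis using pow_eq_one_iff[OF TS] unfolding Y_def by blast
    qed
    ultimately show ?thesis by blast
  qed
qed

declare Us_E [elim!] Zs_E [elim!] Hs_E [elim!]

sublocale G: suzuki_like G Us Zs Hs T "CARD('a)"
proof (intro suzuki_like.intro G_group suzuki_like_axioms.intro; (unfold G_simps)?)
  show "finite (carrier G)" by simp
  show "subgroup Us G"
  proof (rule G.subgroupI)
    show "Us \<noteq> {}" using S_Us by blast
    fix x y assume "x \<in> Us" "y \<in> Us"
    then show "x \<otimes>\<^bsub>G\<^esub> y \<in> Us" by (auto simp: S_mult)
  qed (auto simp: inv_S)
  show "subgroup Zs G"
  proof (rule G.subgroupI)
    show "Zs \<noteq> {}" using S_Zs by blast
    fix x y assume "x \<in> Zs" "y \<in> Zs"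
    then show "x \<otimes>\<^bsub>G\<^esub> y \<in> Zs" by (auto simp: S_mult)
  qed (auto simp: inv_S)
  show "subgroup Hs G"
  proof (rule G.subgroupI)
    show "Hs \<noteq> {}" by (metis D_Hs one_neq_zero empty_iff)
    fix x y assume "x \<in> Hs" "y \<in> Hs"
    then show "x \<otimes>\<^bsub>G\<^esub> y \<in> Hs" by (auto simp: D_mult)
    show "inv\<^bsub>G\<^esub> x \<in> Hs" using \<open>x \<in> Hs\<close> by (auto simp: inv_D)
  qed auto
  show "Zs \<subseteq> Us" by auto
  show "T \<in> carrier G" "T ** T = mat 1" using T_T by simp_all
  have "inj (\<lambda>(a, b). S a b)" by (auto simp: inj_def S_inj)
  then show "card Us = CARD('a) ^ 2" by (simp add: Us_def card_image power2_eq_square)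
  have "inj (\<lambda>b. S 0 b)" by (auto simp: inj_def S_inj)
  then show "card Zs = CARD('a)" by (simp add: Zs_def card_image)
  have "inj_on D (UNIV - {0})" by (auto simp: inj_on_def D_inj)
  then show "card Hs = CARD('a) - 1" by (simp add: Hs_def card_image)
  show "2 \<le> CARD('a)" "even CARD('a)" by (simp_all add: card_field)
  show "\<exists>v\<in>Us. h ** u = v ** h" if "h \<in> Hs" "u \<in> Us" for h u
  proof -
    note asm = that
    obtain a b k where *: "h = D k" "k \<noteq> 0" "u = S a b" using asm by auto
    then show ?thesis using D_S[of k a b] S_Us by auto
  qed
  show "h ** k = k ** h" if "h \<in> Hs" "k \<in> Hs" for h k
    using that by (auto simp: D_mult mult.commute)
  show "T ** h ** T ** h = mat 1" if "h \<in> Hs" for h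
    using that by (auto simp: T_D_T D_inverse)
  show "\<exists>v\<in>Us. \<exists>h\<in>Hs. g = v ** h \<or> (\<exists>u\<in>Us. g = u ** T ** (v ** h))"
    if "g \<in> carrier G" for g
  proof -
    have "g \<in> cells" using that carrier_cells by blast
    then consider c d k where "k \<noteq> 0" "g = S c d ** D k"
      | c d e f k where "k \<noteq> 0" "g = S c d ** T ** (S e f ** D k)" by (auto simp: cells_def)
    then show ?thesis
    proof cases
      case 1
      then show ?thesis by (intro bexI[of _ "S c d"] bexI[of _ "D k"]) auto
    next
      case 2
      then have "\<exists>u\<in>Us. g = u ** T ** (S e f ** D k)" by (intro bexI[of _ "S c d"]) auto
      then show ?thesis using 2 by (intro bexI[of _ "S e f"] bexI[of _ "D k"]) auto
    qed
  qed
  show "u = mat 1" if "u \<in> Us" "v \<in> Us" "h \<in> Hs" "T ** u ** T = v ** h" for u v h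
  proof -
    note asm = that
    obtain a b c d k where u: "u = S a b" "v = S c d" "h = D k" using asm by auto
    have "(T ** S a b ** T) $ 1 $ 2 = (S c d ** D k) $ 1 $ 2"
      "(T ** S a b ** T) $ 1 $ 3 = (S c d ** D k) $ 1 $ 3"
      using that u by simp_all
    then have "a = 0" "b = 0"
      unfolding suz_T_def S_def D_def by (simp_all add: matrix_matrix_mult_def sum_4 vector_4)
    then show ?thesis using u by (simp add: S_0)
  qed
  show "h = mat 1 \<or> u = mat 1" if "h \<in> Hs" "u \<in> Us" "h ** u = u ** h" for h u
  proof -
    note asm = that
    obtain a b k where u: "u = S a b" "h = D k" "k \<noteq> 0" using asm by auto
    have "S (t k / (k * k) * a) (b / t k) ** D k = S a b ** D k" using that u D_S by simp
    then have "S (t k / (k * k) * a) (b / t k) ** D k ** D (1 / k) = S a b ** D k ** D (1 / k)" by simp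
    then have "S (t k / (k * k) * a) (b / t k) = S a b"
      using D_inverse[OF u(3)] by (simp add: matrix_mul_assoc[symmetric])
    then have ab: "t k / (k * k) * a = a" "b / t k = b" by (simp_all add: S_inj)
    have "t k = 1 \<Longrightarrow> k = 1" using t_eq_iff[of k 1] by simp
    moreover have "k = 1" if sq: "t k = k * k"
    proof -
      have "t k = t (t k)" unfolding t_t by (rule sq)
      then have "t k = k" unfolding t_eq_iff by (rule sym)
      then show ?thesis using t_fixed[of k] u(3) by simp
    qed
    ultimately have "k = 1 \<or> (a = 0 \<and> b = 0)" using ab u(3) by (auto simp: divide_simps)
    then show ?thesis using u by (auto simp: D_1 S_0)
  qed
  show "z ** u = u ** z" if "z \<in> Zs" "u \<in> Us" for z u
    using that by (auto simp: S_mult add.commute)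
  show "z ** z = mat 1" if "z \<in> Zs" for z
    using that by (auto simp: S_mult char2 S_0)
  show "u ** u \<in> Zs" if "u \<in> Us" for u
    using that by (auto simp: S_mult char2)
  show "\<exists>z\<in>Zs. u = z ** v" if "u \<in> Us" "v \<in> Us" "u ** u = v ** v" for u v
  proof -
    note asm = that
    obtain a b c d where u: "u = S a b" "v = S c d" using asm by auto
    have *: "t a * a = t c * c" using that u by (simp add: S_mult char2 S_inj)
    have "a = c"
    proof (cases "c = 0")
      case True
      then show ?thesis using * by simp
    next
      case False
      then have "a / c * t (a / c) = 1" using * by (simp add: t_divide divide_simps mult.commute)
      then have "a / c = 1" by (rule mult_t_eq_1)
      then show ?thesis using False by simp
    qed
    then have "u = S 0 (b + d) ** v" using u by (simp add: S_mult add.assoc char2)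
    then show ?thesis by auto
  qed
  show "\<exists>z\<in>Zs. u ** v = z ** (v ** u)" if "u \<in> Us" "v \<in> Us" for u v
  proof -
    note asm = that
    obtain a b c d where u: "u = S a b" "v = S c d" using asm by auto
    have "u ** v = S 0 (t a * c + t c * a) ** (v ** u)" using u by (simp add: S_mult char2 ac_simps)
    then show ?thesis by auto
  qed
  show "\<exists>z\<in>Zs. u = z ** v" if "u \<in> Us - Zs" "v \<in> Us - Zs" "u ** v = v ** u" for u v
  proof -
    note asm = that
    obtain a b c d where u: "u = S a b" "v = S c d" using asm by auto
    have ac: "a \<noteq> 0" "c \<noteq> 0" using that u by auto
    have "b + d + t a * c = d + b + t c * a" using that u by (simp add: S_mult S_inj)
    then have "t a * c = t c * a" by (simp add: add.commute)
    then have "t (a / c) = a / c" using ac by (simp add: t_divide divide_simps mult.commute)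
    then have "a = c" using ac t_fixed[of "a / c"] by simp
    then have "u = S 0 (b + d) ** v" using u by (simp add: S_mult add.assoc char2)
    then show ?thesis by auto
  qed
  show "(T ** u) [^]\<^bsub>G\<^esub> (4::nat) = mat 1 \<or>
      (\<exists>z\<in>Zs. z \<noteq> mat 1 \<and> (\<forall>n::nat. (T ** z) [^]\<^bsub>G\<^esub> n = mat 1 \<longrightarrow> (T ** u) [^]\<^bsub>G\<^esub> n = mat 1))"
    if "u \<in> Us" for u
    using that trace_axiom by auto
qed

end

theorem theorem5p7:
  fixes m q :: nat and G :: "('a::{field,finite} ^ 4 ^ 4) monoid"
  assumes "q = 2 ^ (2 * m + 1)"
    and "CARD('a) = q"
    and "G = suzuki_group m"
  shows "(\<forall>c::enat. 1 \<le> c \<longrightarrow> (\<exists>\<N>. c_nilpotent_cover c G \<N> \<and> two_minimal c G \<N>)) \<and>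
    (1 \<le> m \<longrightarrow>
       (\<forall>c::enat. 2 \<le> c \<longrightarrow> int (omega_nilp c G) = int q ^ 4 + int q ^ 2 + 1) \<and>
       int (omega_nilp 1 G) = int q ^ 4 + int q ^ 3 - int q ^ 2 + int q - 1) \<and>
    (m = 0 \<longrightarrow> (\<forall>c::enat. 1 \<le> c \<longrightarrow> omega_nilp c G = 6))"
proof -
  interpret suzuki_field m "suz_twist m :: 'a \<Rightarrow> 'a" by unfold_locales (use assms in simp_all)
  have "2 < CARD('a)" if "1 \<le> m"
  proof -
    have "(2::nat) ^ 1 < 2 ^ (2 * m + 1)" using that by (intro power_strict_increasing) auto
    then show ?thesis using assms by simp
  qed
  moreover have "CARD('a) = 2" if "m = 0" using that assms by simp
  ultimately show ?thesis
    using G.minimal_cover_exists G.omega_large G.omega_small unfolding assms(3) assms(2)[symmetric] by blast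
qed

end
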